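(* Let $\mathsf M$ be a model category. Then the following data define a bicategory $\mathsf M\text{-}\mathrm{span}^2$. (1) Objects: all objects of $\mathsf M$. (2) For objects $x,y$, the Hom category $\mathsf M\text{-}\mathrm{span}^2(x,y)$ is given by: (2.1) 1-cells are all spans $\hat f=(x\xleftarrow{f_l}f\xrightarrow{f_r}y)$ in $\mathsf M$ with $f_l$ and $f_r$ fibrations. (2.2) 2-cells from $\hat f$ to $\hat f'$ are all equivalence classes $[\hat{\hat\alpha}]$ of spans of spans $\hat{\hat\alpha}=(f\xleftarrow{\alpha_l}\alpha\xrightarrow{\alpha_r}f')$ with $\alpha_l$ an acyclic fibration, under the equivalence relation generated by: $\hat{\hat\alpha}\sim\hat{\hat\alpha}'$ if there exists a morphism of spans of spans $\theta:\hat{\hat\alpha}\to\hat{\hat\alpha}'$. (2.3) The vertical composition of $[\hat{\hat\alpha}]=[f\xleftarrow{\alpha_l}\alpha\xrightarrow{\alpha_r}f']$ and $[\hat{\hat\alpha}']=[f'\xleftarrow{\alpha'_l}\alpha'\xrightarrow{\alpha'_r}f'']$ is $[\hat{\hat\alpha}']\circ[\hat{\hat\alpha}]:=[f\xleftarrow{\alpha_l\tilde\alpha'_l}\alpha\times_{f'}\alpha'\xrightarrow{\alpha'_r\tilde\alpha_r}f'']$, where $\tilde\alpha'_l:\alpha\times_{f'}\alpha'\to\alpha$ and $\tilde\alpha_r:\alpha\times_{f'}\alpha'\to\alpha'$ are the pullback projections. (2.4) The identity 2-cell of $\hat f$ is $[f\xleftarrow{1_f}f\xrightarrow{1_f}f]$.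 (3) The identity 1-cell of $x$ is the span $1_x:=(x\xleftarrow{1_x}x\xrightarrow{1_x}x)$. (4) The horizontal composition functor $c_{xyz}:\mathsf M\text{-}\mathrm{span}^2(y,z)\times\mathsf M\text{-}\mathrm{span}^2(x,y)\to\mathsf M\text{-}\mathrm{span}^2(x,z)$ is given by: (4.1) for 1-cells $\hat f=(x\xleftarrow{f_l}f\xrightarrow{f_r}y)$ and $\hat g=(y\xleftarrow{g_l}g\xrightarrow{g_r}z)$, $\hat g\circ\hat f:=(x\xleftarrow{f_l\tilde g_l}f\times_yg\xrightarrow{g_r\tilde f_r}z)$, with $\tilde g_l:f\times_yg\to f$, $\tilde f_r:f\times_yg\to g$ the projections; (4.2) for 2-cells $[\hat{\hat\alpha}]=[f\xleftarrow{\alpha_l}\alpha\xrightarrow{\alpha_r}f']$ and $[\hat{\hat\beta}]=[g\xleftarrow{\beta_l}\beta\xrightarrow{\beta_r}g']$, $[\hat{\hat\beta}]*[\hat{\hat\alpha}]:=[f\times_yg\xleftarrow{\alpha_l\times_y\beta_l}\alpha\times_y\beta\xrightarrow{\alpha_r\times_y\beta_r}f'\times_yg']$. (5) For 1-cells $\hat f=(w\leftarrow f\to x)$, $\hat g=(x\leftarrow g\to y)$, $\hat h=(y\leftarrow h\to z)$, the component of the associator $(\hat h\circ\hat g)\circ\hat f\to\hat h\circ(\hat g\circ\hat f)$ is $$a_{\hat h,\hat g,\hat f}:=[f\times_x(g\times_yh)\xleftarrow{1}f\times_x(g\times_yh)\xrightarrow{a_{f,g,h}}(f\times_xg)\times_yh],$$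 where $a_{f,g,h}$ is the canonical isomorphism of iterated pullbacks; it equals $[f\times_x(g\times_yh)\xleftarrow{a_{f,g,h}^{-1}}(f\times_xg)\times_yh\xrightarrow{1}(f\times_xg)\times_yh]$. (6) For a 1-cell $\hat f=(x\leftarrow f\to y)$, the component of the left unitor is $l_{\hat f}:=[f\times_yy\xleftarrow{1}f\times_yy\xrightarrow{l_f}f]=[f\times_yy\xleftarrow{l_f^{-1}}f\xrightarrow{1_f}f]$ and the component of the right unitor is $r_{\hat f}:=[x\times_xf\xleftarrow{1}x\times_xf\xrightarrow{r_f}f]=[x\times_xf\xleftarrow{r_f^{-1}}f\xrightarrow{1_f}f]$, where $l_f:f\times_yy\to f$ and $r_f:x\times_xf\to f$ are the canonical isomorphisms (projections).
   Context: A model category has all small limits and colimits; pullbacks are chosen once and for all. A span from $x$ to $y$ is a diagram $x\xleftarrow{f_l}f\xrightarrow{f_r}y$. A span of spans from $\hat f=(x\xleftarrow{f_l}f\xrightarrow{f_r}y)$ to $\hat f'=(x\xleftarrow{f'_l}f'\xrightarrow{f'_r}y)$ is a span $f\xleftarrow{\alpha_l}\alpha\xrightarrow{\alpha_r}f'$ with $f_l\alpha_l=f'_l\alpha_r$ and $f_r\alpha_l=f'_r\alpha_r$. A morphism of spans of spans from $(f\xleftarrow{\alpha_l}\alpha\xrightarrow{\alpha_r}f')$ to $(f\xleftarrow{\alpha'_l}\alpha'\xrightarrow{\alpha'_r}f')$ is a morphism $\theta:\alpha\to\alpha'$ with $\alpha'_l\theta=\alpha_l$ and $\alpha'_r\theta=\alpha_r$.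 In the pullback $\alpha\times_y\beta$ the maps to $y$ are $f_r\alpha_l=f'_r\alpha_r$ and $g_l\beta_l=g'_l\beta_r$. An acyclic fibration is a fibration that is also a weak equivalence. *)

theory Defs
  imports Main
begin

unbundle cardinal_syntax

section \<open>Categories, functors, natural transformations\<close>

record ('o, 'm) cat =
  Ob :: "'o set"
  Ar :: "'m set"
  Dom :: "'m \<Rightarrow> 'o"
  Cod :: "'m \<Rightarrow> 'o"
  Id :: "'o \<Rightarrow> 'm"
  Comp :: "'m \<Rightarrow> 'm \<Rightarrow> 'm"  (infixl "\<cdot>\<index>" 70)

definition hom :: "('o, 'm, 'x) cat_scheme \<Rightarrow> 'o \<Rightarrow> 'o \<Rightarrow> 'm set" where
  "hom C x y = {f \<in> Ar C. Dom C f = x \<and> Cod C f = y}"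

locale category =
  fixes C :: "('o, 'm, 'x) cat_scheme" (structure)
  assumes Dom_closed: "f \<in> Ar C \<Longrightarrow> Dom C f \<in> Ob C"
    and Cod_closed: "f \<in> Ar C \<Longrightarrow> Cod C f \<in> Ob C"
    and Id_hom: "x \<in> Ob C \<Longrightarrow> Id C x \<in> hom C x x"
    and Comp_hom: "f \<in> hom C x y \<Longrightarrow> g \<in> hom C y z \<Longrightarrow> g \<cdot> f \<in> hom C x z"
    and Id_left: "f \<in> hom C x y \<Longrightarrow> Id C y \<cdot> f = f"
    and Id_right: "f \<in> hom C x y \<Longrightarrow> f \<cdot> Id C x = f"
    and Comp_assoc: "f \<in> hom C w x \<Longrightarrow> g \<in> hom C x y \<Longrightarrow> h \<in> hom C y z \<Longrightarrow>
      (h \<cdot> g) \<cdot> f = h \<cdot> (g \<cdot> f)"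

definition inverses :: "('o, 'm, 'x) cat_scheme \<Rightarrow> 'm \<Rightarrow> 'm \<Rightarrow> bool" where
  "inverses C f g \<longleftrightarrow> f \<in> Ar C \<and> g \<in> hom C (Cod C f) (Dom C f) \<and>
     g \<cdot>\<^bsub>C\<^esub> f = Id C (Dom C f) \<and> f \<cdot>\<^bsub>C\<^esub> g = Id C (Cod C f)"

definition is_iso :: "('o, 'm, 'x) cat_scheme \<Rightarrow> 'm \<Rightarrow> bool" where
  "is_iso C f \<longleftrightarrow> (\<exists>g. inverses C f g)"

definition inv_of :: "('o, 'm, 'x) cat_scheme \<Rightarrow> 'm \<Rightarrow> 'm" where
  "inv_of C f = (THE g. inverses C f g)"

record ('o1, 'm1, 'o2, 'm2) ftor =
  fob :: "'o1 \<Rightarrow> 'o2"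
  far :: "'m1 \<Rightarrow> 'm2"

locale cat_functor = A: category A + B: category B
  for A :: "('o1, 'm1, 'x1) cat_scheme" and B :: "('o2, 'm2, 'x2) cat_scheme" +
  fixes F :: "('o1, 'm1, 'o2, 'm2) ftor"
  assumes fob_closed: "x \<in> Ob A \<Longrightarrow> fob F x \<in> Ob B"
    and far_hom: "f \<in> hom A x y \<Longrightarrow> far F f \<in> hom B (fob F x) (fob F y)"
    and far_Id: "x \<in> Ob A \<Longrightarrow> far F (Id A x) = Id B (fob F x)"
    and far_Comp: "f \<in> hom A x y \<Longrightarrow> g \<in> hom A y z \<Longrightarrow>
      far F (g \<cdot>\<^bsub>A\<^esub> f) = far F g \<cdot>\<^bsub>B\<^esub> far F f"

locale nat_trans = F: cat_functor A B F + G: cat_functor A B G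
  for A :: "('o1, 'm1, 'x1) cat_scheme" and B :: "('o2, 'm2, 'x2) cat_scheme" and F G +
  fixes t :: "'o1 \<Rightarrow> 'm2"
  assumes component: "x \<in> Ob A \<Longrightarrow> t x \<in> hom B (fob F x) (fob G x)"
    and natural: "f \<in> hom A x y \<Longrightarrow> far G f \<cdot>\<^bsub>B\<^esub> t x = t y \<cdot>\<^bsub>B\<^esub> far F f"

locale nat_iso = nat_trans +
  assumes component_iso: "x \<in> Ob A \<Longrightarrow> is_iso B (t x)"

definition id_ftor :: "('o, 'm, 'o, 'm) ftor" where
  "id_ftor = \<lparr>fob = (\<lambda>x. x), far = (\<lambda>f. f)\<rparr>"

definition prod_cat ::
  "('o1, 'm1, 'x1) cat_scheme \<Rightarrow> ('o2, 'm2, 'x2) cat_scheme \<Rightarrow> ('o1 \<times> 'o2, 'm1 \<times> 'm2) cat" where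
  "prod_cat A B = \<lparr>
     Ob = Ob A \<times> Ob B,
     Ar = Ar A \<times> Ar B,
     Dom = (\<lambda>(f, g). (Dom A f, Dom B g)),
     Cod = (\<lambda>(f, g). (Cod A f, Cod B g)),
     Id = (\<lambda>(x, y). (Id A x, Id B y)),
     Comp = (\<lambda>(f', g') (f, g). (f' \<cdot>\<^bsub>A\<^esub> f, g' \<cdot>\<^bsub>B\<^esub> g))\<rparr>"


section \<open>Bicategories\<close>

text \<open>In \<open>HComp x y z\<close> and the structure isomorphisms, tuples of 1-cells and of 2-cells are
  written in composition order: \<open>HComp x y z\<close> goes from
  \<open>Hom(y,z) \<times> Hom(x,y)\<close> to \<open>Hom(x,z)\<close>, and \<open>Assoc w x y z (h, g, f)\<close> is the component
  \<open>(h \<circ> g) \<circ> f \<rightarrow> h \<circ> (g \<circ> f)\<close> for \<open>f : w \<rightarrow> x\<close>, \<open>g : x \<rightarrow> y\<close>, \<open>h : y \<rightarrow> z\<close>.\<close>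

record ('o, 'f, 'c) bicat =
  Ob0 :: "'o set"
  HomCat :: "'o \<Rightarrow> 'o \<Rightarrow> ('f, 'c) cat"
  Id1 :: "'o \<Rightarrow> 'f"
  HComp :: "'o \<Rightarrow> 'o \<Rightarrow> 'o \<Rightarrow> ('f \<times> 'f, 'c \<times> 'c, 'f, 'c) ftor"
  Assoc :: "'o \<Rightarrow> 'o \<Rightarrow> 'o \<Rightarrow> 'o \<Rightarrow> 'f \<times> 'f \<times> 'f \<Rightarrow> 'c"
  LUnit :: "'o \<Rightarrow> 'o \<Rightarrow> 'f \<Rightarrow> 'c"
  RUnit :: "'o \<Rightarrow> 'o \<Rightarrow> 'f \<Rightarrow> 'c"

locale bicategory =
  fixes B :: "('o, 'f, 'c, 'x) bicat_scheme"
  assumes Hom_category: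
      "x \<in> Ob0 B \<Longrightarrow> y \<in> Ob0 B \<Longrightarrow> category (HomCat B x y)"
    and Id1_closed:
      "x \<in> Ob0 B \<Longrightarrow> Id1 B x \<in> Ob (HomCat B x x)"
    and HComp_functor:
      "x \<in> Ob0 B \<Longrightarrow> y \<in> Ob0 B \<Longrightarrow> z \<in> Ob0 B \<Longrightarrow>
       cat_functor (prod_cat (HomCat B y z) (HomCat B x y)) (HomCat B x z) (HComp B x y z)"
    and Assoc_iso:
      "w \<in> Ob0 B \<Longrightarrow> x \<in> Ob0 B \<Longrightarrow> y \<in> Ob0 B \<Longrightarrow> z \<in> Ob0 B \<Longrightarrow>
       nat_iso (prod_cat (HomCat B y z) (prod_cat (HomCat B x y) (HomCat B w x))) (HomCat B w z)
         \<lparr>fob = (\<lambda>(h, g, f). fob (HComp B w x z) (fob (HComp B x y z) (h, g), f)),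
          far = (\<lambda>(h, g, f). far (HComp B w x z) (far (HComp B x y z) (h, g), f))\<rparr>
         \<lparr>fob = (\<lambda>(h, g, f). fob (HComp B w y z) (h, fob (HComp B w x y) (g, f))),
          far = (\<lambda>(h, g, f). far (HComp B w y z) (h, far (HComp B w x y) (g, f)))\<rparr>
         (Assoc B w x y z)"
    and LUnit_iso:
      "x \<in> Ob0 B \<Longrightarrow> y \<in> Ob0 B \<Longrightarrow>
       nat_iso (HomCat B x y) (HomCat B x y)
         \<lparr>fob = (\<lambda>f. fob (HComp B x y y) (Id1 B y, f)),
          far = (\<lambda>\<alpha>. far (HComp B x y y) (Id (HomCat B y y) (Id1 B y), \<alpha>))\<rparr>
         id_ftor
         (LUnit B x y)"
    and RUnit_iso:
      "x \<in> Ob0 B \<Longrightarrow> y \<in> Ob0 B \<Longrightarrow>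
       nat_iso (HomCat B x y) (HomCat B x y)
         \<lparr>fob = (\<lambda>f. fob (HComp B x x y) (f, Id1 B x)),
          far = (\<lambda>\<alpha>. far (HComp B x x y) (\<alpha>, Id (HomCat B x x) (Id1 B x)))\<rparr>
         id_ftor
         (RUnit B x y)"
    and pentagon:
      "v \<in> Ob0 B \<Longrightarrow> w \<in> Ob0 B \<Longrightarrow> x \<in> Ob0 B \<Longrightarrow> y \<in> Ob0 B \<Longrightarrow> z \<in> Ob0 B \<Longrightarrow>
       f \<in> Ob (HomCat B v w) \<Longrightarrow> g \<in> Ob (HomCat B w x) \<Longrightarrow>
       h \<in> Ob (HomCat B x y) \<Longrightarrow> k \<in> Ob (HomCat B y z) \<Longrightarrow>
       Assoc B v x y z (k, h, fob (HComp B v w x) (g, f)) \<cdot>\<^bsub>HomCat B v z\<^esub>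
         Assoc B v w x z (fob (HComp B x y z) (k, h), g, f)
       = far (HComp B v y z) (Id (HomCat B y z) k, Assoc B v w x y (h, g, f)) \<cdot>\<^bsub>HomCat B v z\<^esub>
         Assoc B v w y z (k, fob (HComp B w x y) (h, g), f) \<cdot>\<^bsub>HomCat B v z\<^esub>
         far (HComp B v w z) (Assoc B w x y z (k, h, g), Id (HomCat B v w) f)"
    and triangle:
      "x \<in> Ob0 B \<Longrightarrow> y \<in> Ob0 B \<Longrightarrow> z \<in> Ob0 B \<Longrightarrow>
       f \<in> Ob (HomCat B x y) \<Longrightarrow> g \<in> Ob (HomCat B y z) \<Longrightarrow>
       far (HComp B x y z) (Id (HomCat B y z) g, LUnit B x y f) \<cdot>\<^bsub>HomCat B x z\<^esub>
         Assoc B x y y z (g, Id1 B y, f)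
       = far (HComp B x y z) (RUnit B y z g, Id (HomCat B x y) f)"


section \<open>Small limits and colimits\<close>

text \<open>The infinite set \<open>U\<close> plays the role of a universe: a category is small with respect to \<open>U\<close>
  if its objects and arrows are elements of \<open>U\<close> and it has fewer than \<open>|U|\<close> arrows (hence
  also fewer than \<open>|U|\<close> objects).  If \<open>U\<close> is a Grothendieck universe, these are up to
  isomorphism exactly the categories that are elements of \<open>U\<close>.\<close>

definition small_category :: "'i set \<Rightarrow> ('i, 'i) cat \<Rightarrow> bool" where
  "small_category U J \<longleftrightarrow> category J \<and> Ob J \<subseteq> U \<and> Ar J \<subseteq> U \<and> |Ar J| <o |U|"

definition is_cone ::
  "('i, 'i) cat \<Rightarrow> ('o, 'm, 'x) cat_scheme \<Rightarrow> ('i, 'i, 'o, 'm) ftor \<Rightarrow> 'o \<Rightarrow> ('i \<Rightarrow> 'm) \<Rightarrow> bool" where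
  "is_cone J C D v c \<longleftrightarrow> v \<in> Ob C \<and>
     (\<forall>j\<in>Ob J. c j \<in> hom C v (fob D j)) \<and>
     (\<forall>u\<in>Ar J. far D u \<cdot>\<^bsub>C\<^esub> c (Dom J u) = c (Cod J u))"

definition is_limit ::
  "('i, 'i) cat \<Rightarrow> ('o, 'm, 'x) cat_scheme \<Rightarrow> ('i, 'i, 'o, 'm) ftor \<Rightarrow> 'o \<Rightarrow> ('i \<Rightarrow> 'm) \<Rightarrow> bool" where
  "is_limit J C D v c \<longleftrightarrow> is_cone J C D v c \<and>
     (\<forall>v' c'. is_cone J C D v' c' \<longrightarrow>
        (\<exists>!h. h \<in> hom C v' v \<and> (\<forall>j\<in>Ob J. c j \<cdot>\<^bsub>C\<^esub> h = c' j)))"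

definition is_cocone ::
  "('i, 'i) cat \<Rightarrow> ('o, 'm, 'x) cat_scheme \<Rightarrow> ('i, 'i, 'o, 'm) ftor \<Rightarrow> 'o \<Rightarrow> ('i \<Rightarrow> 'm) \<Rightarrow> bool" where
  "is_cocone J C D v c \<longleftrightarrow> v \<in> Ob C \<and>
     (\<forall>j\<in>Ob J. c j \<in> hom C (fob D j) v) \<and>
     (\<forall>u\<in>Ar J. c (Cod J u) \<cdot>\<^bsub>C\<^esub> far D u = c (Dom J u))"

definition is_colimit ::
  "('i, 'i) cat \<Rightarrow> ('o, 'm, 'x) cat_scheme \<Rightarrow> ('i, 'i, 'o, 'm) ftor \<Rightarrow> 'o \<Rightarrow> ('i \<Rightarrow> 'm) \<Rightarrow> bool" where
  "is_colimit J C D v c \<longleftrightarrow> is_cocone J C D v c \<and>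
     (\<forall>v' c'. is_cocone J C D v' c' \<longrightarrow>
        (\<exists>!h. h \<in> hom C v v' \<and> (\<forall>j\<in>Ob J. h \<cdot>\<^bsub>C\<^esub> c j = c' j)))"

definition has_small_limits :: "'i set \<Rightarrow> ('o, 'm, 'x) cat_scheme \<Rightarrow> bool" where
  "has_small_limits U C \<longleftrightarrow>
     (\<forall>J D. small_category U J \<and> cat_functor J C D \<longrightarrow> (\<exists>v c. is_limit J C D v c))"

definition has_small_colimits :: "'i set \<Rightarrow> ('o, 'm, 'x) cat_scheme \<Rightarrow> bool" where
  "has_small_colimits U C \<longleftrightarrow>
     (\<forall>J D. small_category U J \<and> cat_functor J C D \<longrightarrow> (\<exists>v c. is_colimit J C D v c))"


section \<open>Model categories\<close>

record ('o, 'm) model = "('o, 'm) cat" +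
  Weq :: "'m set"
  Cof :: "'m set"
  Fib :: "'m set"

definition retract_of :: "('o, 'm, 'x) cat_scheme \<Rightarrow> 'm \<Rightarrow> 'm \<Rightarrow> bool" where
  "retract_of C f g \<longleftrightarrow> f \<in> Ar C \<and> g \<in> Ar C \<and>
     (\<exists>i r j s. i \<in> hom C (Dom C f) (Dom C g) \<and> r \<in> hom C (Dom C g) (Dom C f) \<and>
        j \<in> hom C (Cod C f) (Cod C g) \<and> s \<in> hom C (Cod C g) (Cod C f) \<and>
        r \<cdot>\<^bsub>C\<^esub> i = Id C (Dom C f) \<and> s \<cdot>\<^bsub>C\<^esub> j = Id C (Cod C f) \<and>
        g \<cdot>\<^bsub>C\<^esub> i = j \<cdot>\<^bsub>C\<^esub> f \<and> f \<cdot>\<^bsub>C\<^esub> r = s \<cdot>\<^bsub>C\<^esub> g)"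

definition lifts_against :: "('o, 'm, 'x) cat_scheme \<Rightarrow> 'm \<Rightarrow> 'm \<Rightarrow> bool" where
  "lifts_against C i p \<longleftrightarrow>
     (\<forall>u v. u \<in> hom C (Dom C i) (Dom C p) \<and> v \<in> hom C (Cod C i) (Cod C p) \<and>
        p \<cdot>\<^bsub>C\<^esub> u = v \<cdot>\<^bsub>C\<^esub> i \<longrightarrow>
        (\<exists>h. h \<in> hom C (Cod C i) (Dom C p) \<and> h \<cdot>\<^bsub>C\<^esub> i = u \<and> p \<cdot>\<^bsub>C\<^esub> h = v))"

text \<open>The axioms are those of Dwyer and Spalinski, with all small (instead of finite) limits and
  colimits; factorizations are not required to be functorial.\<close>

locale model_category = category M
  for M :: "('o, 'm, 'x) model_scheme" (structure) +
  fixes U :: "'i set"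
  assumes infinite_universe: "infinite U"
    and small_limits: "has_small_limits U M"
    and small_colimits: "has_small_colimits U M"
    and classes_Ar: "Weq M \<subseteq> Ar M" "Cof M \<subseteq> Ar M" "Fib M \<subseteq> Ar M"
    and classes_Id: "S \<in> {Weq M, Cof M, Fib M} \<Longrightarrow> x \<in> Ob M \<Longrightarrow> Id M x \<in> S"
    and classes_Comp: "S \<in> {Weq M, Cof M, Fib M} \<Longrightarrow> f \<in> S \<Longrightarrow> g \<in> S \<Longrightarrow>
      Cod M f = Dom M g \<Longrightarrow> g \<cdot> f \<in> S"
    and two_of_three_left:
      "f \<in> hom M x y \<Longrightarrow> g \<in> hom M y z \<Longrightarrow> g \<in> Weq M \<Longrightarrow> g \<cdot> f \<in> Weq M \<Longrightarrow> f \<in> Weq M"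
    and two_of_three_right:
      "f \<in> hom M x y \<Longrightarrow> g \<in> hom M y z \<Longrightarrow> f \<in> Weq M \<Longrightarrow> g \<cdot> f \<in> Weq M \<Longrightarrow> g \<in> Weq M"
    and retracts: "S \<in> {Weq M, Cof M, Fib M} \<Longrightarrow> g \<in> S \<Longrightarrow> retract_of M f g \<Longrightarrow> f \<in> S"
    and lifting: "i \<in> Cof M \<Longrightarrow> p \<in> Fib M \<Longrightarrow> i \<in> Weq M \<or> p \<in> Weq M \<Longrightarrow> lifts_against M i p"
    and factor_acyclic_fib: "f \<in> Ar M \<Longrightarrow>
      \<exists>i p. i \<in> Cof M \<and> p \<in> Fib M \<inter> Weq M \<and> Cod M i = Dom M p \<and> p \<cdot> i = f"
    and factor_acyclic_cof: "f \<in> Ar M \<Longrightarrow>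
      \<exists>i p. i \<in> Cof M \<inter> Weq M \<and> p \<in> Fib M \<and> Cod M i = Dom M p \<and> p \<cdot> i = f"


section \<open>Spans and chosen pullbacks\<close>

datatype 'm span = Span (lleg: 'm) (rleg: 'm)

definition apex :: "('o, 'm, 'x) cat_scheme \<Rightarrow> 'm span \<Rightarrow> 'o" where
  "apex C s = Dom C (lleg s)"

definition spans :: "('o, 'm, 'x) cat_scheme \<Rightarrow> 'o \<Rightarrow> 'o \<Rightarrow> 'm span set" where
  "spans C x y = {s. lleg s \<in> hom C (apex C s) x \<and> rleg s \<in> hom C (apex C s) y}"

definition span_mor :: "('o, 'm, 'x) cat_scheme \<Rightarrow> 'm span \<Rightarrow> 'm span \<Rightarrow> 'm set" where
  "span_mor C s t = {u \<in> hom C (apex C s) (apex C t).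
     lleg t \<cdot>\<^bsub>C\<^esub> u = lleg s \<and> rleg t \<cdot>\<^bsub>C\<^esub> u = rleg s}"

definition commuting_spans :: "('o, 'm, 'x) cat_scheme \<Rightarrow> 'm \<Rightarrow> 'm \<Rightarrow> 'm span set" where
  "commuting_spans C f g =
     {s \<in> spans C (Dom C f) (Dom C g). f \<cdot>\<^bsub>C\<^esub> lleg s = g \<cdot>\<^bsub>C\<^esub> rleg s}"

definition is_pullback :: "('o, 'm, 'x) cat_scheme \<Rightarrow> 'm \<Rightarrow> 'm \<Rightarrow> 'm span \<Rightarrow> bool" where
  "is_pullback C f g s \<longleftrightarrow> s \<in> commuting_spans C f g \<and>
     (\<forall>t\<in>commuting_spans C f g. \<exists>!u. u \<in> span_mor C t s)"

definition pullback_choice :: "('o, 'm, 'x) cat_scheme \<Rightarrow> ('m \<Rightarrow> 'm \<Rightarrow> 'm span) \<Rightarrow> bool" where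
  "pullback_choice C pb \<longleftrightarrow>
     (\<forall>f\<in>Ar C. \<forall>g\<in>Ar C. Cod C f = Cod C g \<longrightarrow> is_pullback C f g (pb f g))"

text \<open>For a pullback \<open>s\<close> and a competing span \<open>t\<close>, the induced map of apexes.\<close>

definition induced :: "('o, 'm, 'x) cat_scheme \<Rightarrow> 'm span \<Rightarrow> 'm span \<Rightarrow> 'm" where
  "induced C t s = (THE u. u \<in> span_mor C t s)"

text \<open>Composition \<open>T \<circ> S\<close> of spans along the chosen pullback.  It is used both for 1-cells and
  for the vertical composition of spans of spans, which are themselves spans between apexes.\<close>

definition span_comp ::
  "('o, 'm, 'x) cat_scheme \<Rightarrow> ('m \<Rightarrow> 'm \<Rightarrow> 'm span) \<Rightarrow> 'm span \<Rightarrow> 'm span \<Rightarrow> 'm span" where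
  "span_comp C pb T S = (let p = pb (rleg S) (lleg T) in
     Span (lleg S \<cdot>\<^bsub>C\<^esub> lleg p) (rleg T \<cdot>\<^bsub>C\<^esub> rleg p))"

definition id_span :: "('o, 'm, 'x) cat_scheme \<Rightarrow> 'o \<Rightarrow> 'm span" where
  "id_span C x = Span (Id C x) (Id C x)"

definition spans_of_spans :: "('o, 'm, 'x) cat_scheme \<Rightarrow> 'm span \<Rightarrow> 'm span \<Rightarrow> 'm span set" where
  "spans_of_spans C F F' = {a \<in> spans C (apex C F) (apex C F').
     lleg F \<cdot>\<^bsub>C\<^esub> lleg a = lleg F' \<cdot>\<^bsub>C\<^esub> rleg a \<and>
     rleg F \<cdot>\<^bsub>C\<^esub> lleg a = rleg F' \<cdot>\<^bsub>C\<^esub> rleg a}"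


text \<open>Every model category admits a choice of pullbacks.\<close>

lemma five_distinct: assumes "infinite (U::'i set)"
  shows "\<exists>a b c d e. a\<in>U \<and> b\<in>U \<and> c\<in>U \<and> d\<in>U \<and> e\<in>U \<and> distinct [a,b,c,d,e]"
proof -
  obtain S where "S \<subseteq> U" "card S = 5" "finite S" using infinite_arbitrarily_large[OF assms] by metis
  then obtain xs where "set xs = S" "distinct xs" using finite_distinct_list by blast
  hence "length xs = 5" using \<open>card S = 5\<close> distinct_card by metis
  then obtain a b c d e where "xs = [a,b,c,d,e]"
    by (auto simp: numeral_eq_Suc length_Suc_conv)
  thus ?thesis using \<open>set xs = S\<close> \<open>S \<subseteq> U\<close> \<open>distinct xs\<close> by (metis list.set_intros(1) list.set_intros(2) subset_iff)
qed

lemma pullbacks_exist: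
  fixes M :: "('o,'m,'x) model_scheme" and U :: "'i set"
  assumes "model_category M U" shows "\<exists>pb. pullback_choice M pb"
proof -
  interpret model_category M U by fact
  have "\<exists>s. is_pullback M f g s" if f: "f \<in> Ar M" and g: "g \<in> Ar M" and fg: "Cod M f = Cod M g" for f g
  proof -
    obtain a b c d e where U: "a\<in>U" "b\<in>U" "c\<in>U" "d\<in>U" "e\<in>U" and dist: "distinct [a,b,c,d,e]"
      using five_distinct[OF infinite_universe] by blast
    define J :: "('i,'i) cat" where "J = \<lparr>Ob = {a,b,c}, Ar = {a,b,c,d,e},
      Dom = (\<lambda>u. if u = d then a else if u = e then b else u),
      Cod = (\<lambda>u. if u = d then c else if u = e then c else u), Id = (\<lambda>u. u),
      Comp = (\<lambda>u v. if u = d \<or> u = e then u else v)\<rparr>"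
    define D :: "('i,'i,'o,'m) ftor" where "D = \<lparr>fob = (\<lambda>j. if j = a then Dom M f else if j = b then Dom M g else Cod M f),
      far = (\<lambda>u. if u = d then f else if u = e then g else if u = a then Id M (Dom M f) else if u = b then Id M (Dom M g) else Id M (Cod M f))\<rparr>"
    have cJ: "category J"
      using dist by unfold_locales (auto simp: J_def hom_def split: if_splits)
    have sm: "small_category U J"
      unfolding small_category_def using cJ U infinite_universe
      by (auto simp: J_def intro!: finite_ordLess_infinite[OF card_of_Well_order card_of_Well_order] simp: Field_card_of)
    have obs: "Dom M f \<in> Ob M" "Dom M g \<in> Ob M" "Cod M f \<in> Ob M"
      using f g Dom_closed Cod_closed by auto
    have ids: "Id M (Dom M f) \<in> hom M (Dom M f) (Dom M f)" "Id M (Dom M g) \<in> hom M (Dom M g) (Dom M g)"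
       "Id M (Cod M f) \<in> hom M (Cod M f) (Cod M f)" using obs Id_hom by auto
    have fh: "f \<in> hom M (Dom M f) (Cod M f)" and gh: "g \<in> hom M (Dom M g) (Cod M f)"
      using f g fg by (auto simp: hom_def)
    note [simp] = Id_left[OF fh] Id_right[OF fh] Id_left[OF gh] Id_right[OF gh] Id_left[OF ids(1)] Id_left[OF ids(2)] Id_left[OF ids(3)]
    have fD: "cat_functor J M D"
      apply (rule cat_functor.intro[OF cJ category_axioms], rule cat_functor_axioms.intro)
      using dist fh gh obs ids  by (auto simp: J_def D_def hom_def fg Id_left[OF fh, unfolded fg] Id_left[OF gh, unfolded fg] Id_left[OF ids(3), unfolded fg] split: if_splits)
    obtain v p where lim: "is_limit J M D v p" using small_limits sm fD unfolding has_small_limits_def by blast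
    have cone: "p a \<in> hom M v (Dom M f)" "p b \<in> hom M v (Dom M g)" "p c \<in> hom M v (Cod M f)"
       "f \<cdot>\<^bsub>M\<^esub> p a = p c" "g \<cdot>\<^bsub>M\<^esub> p b = p c"
      using lim dist unfolding is_limit_def is_cone_def by (auto simp: J_def D_def)
    have "is_pullback M f g (Span (p a) (p b))"
      unfolding is_pullback_def
    proof (intro conjI ballI)
      show "Span (p a) (p b) \<in> commuting_spans M f g"
        using cone by (auto simp: commuting_spans_def spans_def apex_def hom_def)
      fix t assume t: "t \<in> commuting_spans M f g"
      define q where "q = (\<lambda>j. if j = a then lleg t else if j = b then rleg t else f \<cdot>\<^bsub>M\<^esub> lleg t)"
      have tl: "lleg t \<in> hom M (apex M t) (Dom M f)" "rleg t \<in> hom M (apex M t) (Dom M g)" "f \<cdot>\<^bsub>M\<^esub> lleg t = g \<cdot>\<^bsub>M\<^esub> rleg t"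
        using t by (auto simp: commuting_spans_def spans_def)
      have tc: "f \<cdot>\<^bsub>M\<^esub> lleg t \<in> hom M (apex M t) (Cod M f)" using tl fh Comp_hom by blast
      have "is_cone J M D (apex M t) q"
        unfolding is_cone_def using dist tl tc Id_left[OF tl(1)] Id_left[OF tl(2)] Id_left[OF tc] Dom_closed
        by (auto simp: J_def D_def q_def apex_def hom_def)
      hence ex: "\<exists>!h. h \<in> hom M (apex M t) v \<and> (\<forall>j\<in>Ob J. p j \<cdot>\<^bsub>M\<^esub> h = q j)"
        using lim unfolding is_limit_def by blast
      have av: "apex M (Span (p a) (p b)) = v" using cone by (auto simp: apex_def hom_def)
      have "h \<in> span_mor M t (Span (p a) (p b)) \<longleftrightarrow> h \<in> hom M (apex M t) v \<and> (\<forall>j\<in>Ob J. p j \<cdot>\<^bsub>M\<^esub> h = q j)" for h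
        using dist cone Comp_assoc[OF _ cone(1) fh, of h]
        by (auto simp: span_mor_def av J_def q_def)
      thus "\<exists>!h. h \<in> span_mor M t (Span (p a) (p b))" using ex by simp
    qed
    thus ?thesis by blast
  qed
  thus ?thesis unfolding pullback_choice_def by metis
qed


section \<open>The bicategory of spans\<close>

definition one_cells :: "('o, 'm, 'x) model_scheme \<Rightarrow> 'o \<Rightarrow> 'o \<Rightarrow> 'm span set" where
  "one_cells M x y = {F \<in> spans M x y. lleg F \<in> Fib M \<and> rleg F \<in> Fib M}"

definition two_reps :: "('o, 'm, 'x) model_scheme \<Rightarrow> 'm span \<Rightarrow> 'm span \<Rightarrow> 'm span set" where
  "two_reps M F F' = {a \<in> spans_of_spans M F F'. lleg a \<in> Fib M \<inter> Weq M}"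

definition two_rel ::
  "('o, 'm, 'x) model_scheme \<Rightarrow> 'm span \<Rightarrow> 'm span \<Rightarrow> ('m span \<times> 'm span) set" where
  "two_rel M F F' =
     {(a, a'). a \<in> two_reps M F F' \<and> a' \<in> two_reps M F F' \<and> span_mor M a a' \<noteq> {}}"

text \<open>The equivalence relation on \<open>two_reps M F F'\<close> generated by \<open>two_rel M F F'\<close>.\<close>

definition two_eq ::
  "('o, 'm, 'x) model_scheme \<Rightarrow> 'm span \<Rightarrow> 'm span \<Rightarrow> ('m span \<times> 'm span) set" where
  "two_eq M F F' =
     (two_rel M F F' \<union> (two_rel M F F')\<inverse>)\<^sup>* \<inter> (two_reps M F F' \<times> two_reps M F F')"

text \<open>A 2-cell carries its source and target 1-cells: the legs of the 1-cells cannot be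
  recovered from the equivalence class.\<close>

datatype 'm two_cell = TwoCell (src: "'m span") (tgt: "'m span") (cls: "'m span set")

definition two_class ::
  "('o, 'm, 'x) model_scheme \<Rightarrow> 'm span \<Rightarrow> 'm span \<Rightarrow> 'm span \<Rightarrow> 'm two_cell" where
  "two_class M F F' a = TwoCell F F' (two_eq M F F' `` {a})"

text \<open>Operations on equivalence classes are unions over all representatives; these are single
  equivalence classes precisely when the operation is independent of the representatives.\<close>

definition vcomp ::
  "('o, 'm, 'x) model_scheme \<Rightarrow> ('m \<Rightarrow> 'm \<Rightarrow> 'm span) \<Rightarrow> 'm two_cell \<Rightarrow> 'm two_cell \<Rightarrow> 'm two_cell"
  where
  "vcomp M pb A' A = TwoCell (src A) (tgt A')
     (\<Union>a\<in>cls A. \<Union>a'\<in>cls A'. two_eq M (src A) (tgt A') `` {span_comp M pb a' a})"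

text \<open>The span \<open>f \<times>\<^sub>y g \<leftarrow> \<alpha> \<times>\<^sub>y \<beta> \<rightarrow> f' \<times>\<^sub>y g'\<close>.  The arrow
  \<open>rleg F \<cdot> lleg a\<close> from \<open>\<alpha>\<close> to \<open>y\<close> equals \<open>rleg F' \<cdot> rleg a\<close>, and likewise for \<open>\<beta>\<close>.\<close>

definition hcomp_rep ::
  "('o, 'm, 'x) cat_scheme \<Rightarrow> ('m \<Rightarrow> 'm \<Rightarrow> 'm span) \<Rightarrow>
   'm span \<Rightarrow> 'm span \<Rightarrow> 'm span \<Rightarrow> 'm span \<Rightarrow> 'm span \<Rightarrow> 'm span \<Rightarrow> 'm span" where
  "hcomp_rep C pb G G' F F' b a =
     (let p = pb (rleg F \<cdot>\<^bsub>C\<^esub> lleg a) (lleg G \<cdot>\<^bsub>C\<^esub> lleg b) in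
      Span (induced C (Span (lleg a \<cdot>\<^bsub>C\<^esub> lleg p) (lleg b \<cdot>\<^bsub>C\<^esub> rleg p)) (pb (rleg F) (lleg G)))
           (induced C (Span (rleg a \<cdot>\<^bsub>C\<^esub> lleg p) (rleg b \<cdot>\<^bsub>C\<^esub> rleg p)) (pb (rleg F') (lleg G'))))"

definition hcomp ::
  "('o, 'm, 'x) model_scheme \<Rightarrow> ('m \<Rightarrow> 'm \<Rightarrow> 'm span) \<Rightarrow> 'm two_cell \<Rightarrow> 'm two_cell \<Rightarrow> 'm two_cell"
  where
  "hcomp M pb B A =
     (let S = span_comp M pb (src B) (src A); T = span_comp M pb (tgt B) (tgt A) in
      TwoCell S T
        (\<Union>a\<in>cls A. \<Union>b\<in>cls B. two_eq M S T ``
           {hcomp_rep M pb (src B) (tgt B) (src A) (tgt A) b a}))"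

text \<open>The canonical map \<open>f \<times>\<^sub>x (g \<times>\<^sub>y h) \<rightarrow> (f \<times>\<^sub>x g) \<times>\<^sub>y h\<close>, the one
  compatible with the projections to \<open>f\<close>, \<open>g\<close> and \<open>h\<close>.\<close>

definition assoc_map ::
  "('o, 'm, 'x) cat_scheme \<Rightarrow> ('m \<Rightarrow> 'm \<Rightarrow> 'm span) \<Rightarrow> 'm span \<Rightarrow> 'm span \<Rightarrow> 'm span \<Rightarrow> 'm" where
  "assoc_map C pb F G H =
     (let gh = pb (rleg G) (lleg H);
          f_gh = pb (rleg F) (lleg G \<cdot>\<^bsub>C\<^esub> lleg gh);
          fg = pb (rleg F) (lleg G);
          fg_h = pb (rleg G \<cdot>\<^bsub>C\<^esub> rleg fg) (lleg H);
          to_fg = induced C (Span (lleg f_gh) (lleg gh \<cdot>\<^bsub>C\<^esub> rleg f_gh)) fg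
      in induced C (Span to_fg (rleg gh \<cdot>\<^bsub>C\<^esub> rleg f_gh)) fg_h)"

definition lunit_map ::
  "('o, 'm, 'x) cat_scheme \<Rightarrow> ('m \<Rightarrow> 'm \<Rightarrow> 'm span) \<Rightarrow> 'm span \<Rightarrow> 'm" where
  "lunit_map C pb F = lleg (pb (rleg F) (Id C (Cod C (rleg F))))"

definition runit_map ::
  "('o, 'm, 'x) cat_scheme \<Rightarrow> ('m \<Rightarrow> 'm \<Rightarrow> 'm span) \<Rightarrow> 'm span \<Rightarrow> 'm" where
  "runit_map C pb F = rleg (pb (Id C (Cod C (lleg F))) (lleg F))"

definition span2_hom ::
  "('o, 'm, 'x) model_scheme \<Rightarrow> ('m \<Rightarrow> 'm \<Rightarrow> 'm span) \<Rightarrow> 'o \<Rightarrow> 'o \<Rightarrow> ('m span, 'm two_cell) cat" where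
  "span2_hom M pb x y = \<lparr>
     Ob = one_cells M x y,
     Ar = {two_class M F F' a | F F' a.
             F \<in> one_cells M x y \<and> F' \<in> one_cells M x y \<and> a \<in> two_reps M F F'},
     Dom = src,
     Cod = tgt,
     Id = (\<lambda>F. two_class M F F (id_span M (apex M F))),
     Comp = vcomp M pb\<rparr>"

definition span2 ::
  "('o, 'm, 'x) model_scheme \<Rightarrow> ('m \<Rightarrow> 'm \<Rightarrow> 'm span) \<Rightarrow> ('o, 'm span, 'm two_cell) bicat" where
  "span2 M pb = \<lparr>
     Ob0 = Ob M,
     HomCat = span2_hom M pb,
     Id1 = id_span M,
     HComp = (\<lambda>x y z. \<lparr>fob = (\<lambda>(G, F). span_comp M pb G F), far = (\<lambda>(B, A). hcomp M pb B A)\<rparr>),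
     Assoc = (\<lambda>w x y z (H, G, F).
       let S = span_comp M pb (span_comp M pb H G) F; T = span_comp M pb H (span_comp M pb G F) in
       two_class M S T (Span (Id M (apex M S)) (assoc_map M pb F G H))),
     LUnit = (\<lambda>x y F.
       let S = span_comp M pb (id_span M y) F in
       two_class M S F (Span (Id M (apex M S)) (lunit_map M pb F))),
     RUnit = (\<lambda>x y F.
       let S = span_comp M pb F (id_span M x) in
       two_class M S F (Span (Id M (apex M S)) (runit_map M pb F)))\<rparr>"

end

theory Submission
  imports Defs
begin

text \<open>Two observations carry the proof.

  The first is about fibrations. By the retract argument, a map is a fibration or an acyclic
  fibration as soon as it has the right lifting property against acyclic cofibrations or against
  cofibrations, respectively. Lifting properties pass to pullbacks, and they pass to the map
  \<open>\<alpha> \<times>\<^sub>y \<beta> \<rightarrow> f \<times>\<^sub>y g\<close> induced by acyclic fibrations \<open>\<alpha> \<rightarrow> f\<close> and \<open>\<beta> \<rightarrow> g\<close> (\<open>pullback_map_AFib\<close>). So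
  all composites are again 1-cells and 2-cells.

  The second is about equivalence classes. A single morphism of spans of spans identifies two
  classes, and maps into a pullback are induced by commuting cones. Hence the class of a vertical or
  horizontal composite can be read off from any commuting cone with the required legs, not only from
  the chosen pullback, as long as its left leg is an acyclic fibration (\<open>two_class_vcomp_cone\<close>,
  \<open>two_class_hcomp_cone\<close>). To prove that two composites are equal one takes the representative of
  one of them and exhibits its apex as a cone for the other. Independence of representatives,
  associativity of vertical composition, the interchange law, and naturality of the associator and
  the unitors are all proved in this way.

  The associator and the unitors come from morphisms of spans in \<open>M\<close>. Such 2-cells compose
  vertically like the underlying morphisms, and horizontally like induced maps of pullbacks. The
  pentagon and the triangle thereby become equations between arrows into iterated pullbacks, which
  are checked on the projections.\<close>

section \<open>Composites and pullbacks\<close>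

context category
begin

text \<open>Arrows are typed below by \<^term>\<open>Ar C\<close>, \<^term>\<open>Dom C f\<close> and \<^term>\<open>Cod C f\<close> rather than by hom sets: the
  simplifier can then compute the type of a composite, and every composability condition becomes an
  equation that it solves by itself.\<close>

lemma hom_iff: "f \<in> hom C x y \<longleftrightarrow> f \<in> Ar C \<and> Dom C f = x \<and> Cod C f = y"
  by (simp add: hom_def)

lemma comp_typing [simp]:
  assumes "f \<in> Ar C" "g \<in> Ar C" "Cod C f = Dom C g"
  shows "g \<cdot> f \<in> Ar C" "Dom C (g \<cdot> f) = Dom C f" "Cod C (g \<cdot> f) = Cod C g"
  using Comp_hom[of f "Dom C f" "Cod C f" g "Cod C g"] assms by (simp_all add: hom_iff)

lemma Id_typing [simp]:
  assumes "x \<in> Ob C"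
  shows "Id C x \<in> Ar C" "Dom C (Id C x) = x" "Cod C (Id C x) = x"
  using Id_hom[OF assms] by (simp_all add: hom_iff)

lemma Id_comp [simp]: "f \<in> Ar C \<Longrightarrow> Cod C f = y \<Longrightarrow> Id C y \<cdot> f = f"
  by (metis Id_left hom_iff)

lemma comp_Id [simp]: "f \<in> Ar C \<Longrightarrow> Dom C f = x \<Longrightarrow> f \<cdot> Id C x = f"
  by (metis Id_right hom_iff)

lemma comp_assoc [simp]:
  "f \<in> Ar C \<Longrightarrow> g \<in> Ar C \<Longrightarrow> h \<in> Ar C \<Longrightarrow> Cod C f = Dom C g \<Longrightarrow> Cod C g = Dom C h
    \<Longrightarrow> (h \<cdot> g) \<cdot> f = h \<cdot> (g \<cdot> f)"
  using Comp_assoc[of f "Dom C f" "Cod C f" g "Cod C g" h "Cod C h"] by (simp add: hom_iff)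

declare Dom_closed [simp] Cod_closed [simp]

text \<open>Composites are normalised by bracketing to the right. An equation whose left-hand side is a
  composite must then also rewrite the head of a longer composite.\<close>

lemma reassoc:
  "g \<cdot> f = h \<Longrightarrow> f \<in> Ar C \<Longrightarrow> g \<in> Ar C \<Longrightarrow> Cod C f = Dom C g
    \<Longrightarrow> k \<in> Ar C \<Longrightarrow> Cod C k = Dom C f \<Longrightarrow> g \<cdot> (f \<cdot> k) = h \<cdot> k"
  by (metis comp_assoc)

lemma reassoc3:
  "g \<cdot> (f \<cdot> e) = h \<Longrightarrow> e \<in> Ar C \<Longrightarrow> f \<in> Ar C \<Longrightarrow> g \<in> Ar C \<Longrightarrow> Cod C e = Dom C f \<Longrightarrow> Cod C f = Dom C g
    \<Longrightarrow> k \<in> Ar C \<Longrightarrow> Cod C k = Dom C e \<Longrightarrow> g \<cdot> (f \<cdot> (e \<cdot> k)) = h \<cdot> k"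
  using reassoc[of g "f \<cdot> e" h k] by simp

lemma mem_span_mor:
  "u \<in> span_mor C s t \<longleftrightarrow> u \<in> Ar C \<and> Dom C u = apex C s \<and> Cod C u = apex C t \<and>
     lleg t \<cdot> u = lleg s \<and> rleg t \<cdot> u = rleg s"
  by (auto simp: span_mor_def hom_iff)

lemma mem_commuting_spans:
  "Span u v \<in> commuting_spans C f g \<longleftrightarrow> u \<in> Ar C \<and> v \<in> Ar C \<and> Dom C v = Dom C u \<and>
     Cod C u = Dom C f \<and> Cod C v = Dom C g \<and> f \<cdot> u = g \<cdot> v"
  by (auto simp: commuting_spans_def spans_def apex_def hom_iff)

lemma pullback_typing:
  assumes "is_pullback C f g (Span p q)"
  shows "p \<in> Ar C" "q \<in> Ar C" "Dom C q = Dom C p" "Cod C p = Dom C f" "Cod C q = Dom C g"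
    "f \<cdot> p = g \<cdot> q"
  using assms by (auto simp: is_pullback_def mem_commuting_spans)

lemma pullback_induced:
  assumes "is_pullback C f g (Span p q)"
    and "u \<in> Ar C" "v \<in> Ar C" "Dom C v = Dom C u" "Cod C u = Dom C f" "Cod C v = Dom C g"
      "f \<cdot> u = g \<cdot> v"
  obtains h where "h = induced C (Span u v) (Span p q)" "h \<in> Ar C" "Dom C h = Dom C u"
    "Cod C h = Dom C p" "p \<cdot> h = u" "q \<cdot> h = v"
proof -
  have "\<exists>!h. h \<in> span_mor C (Span u v) (Span p q)"
    using assms by (auto simp: is_pullback_def mem_commuting_spans)
  hence "induced C (Span u v) (Span p q) \<in> span_mor C (Span u v) (Span p q)"
    unfolding induced_def by (rule theI')
  thus thesis using that by (simp add: mem_span_mor apex_def)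
qed

text \<open>The main tool for equations between maps into a pullback: it suffices to compare the two
  projections, since both maps are induced by the same cone.\<close>

lemma pullback_jointly_monic:
  assumes pb: "is_pullback C f g (Span p q)" and "f \<in> Ar C" "g \<in> Ar C"
    and h: "h \<in> Ar C" "Cod C h = Dom C p" and k: "k \<in> Ar C" "Cod C k = Dom C p" "Dom C k = Dom C h"
    and eq: "p \<cdot> h = p \<cdot> k" "q \<cdot> h = q \<cdot> k"
  shows "h = k"
proof -
  note [simp] = pullback_typing[OF pb]
  have "f \<cdot> (p \<cdot> h) = g \<cdot> (q \<cdot> h)"
    using reassoc[OF pullback_typing(6)[OF pb], of h] assms by simp
  hence "Span (p \<cdot> h) (q \<cdot> h) \<in> commuting_spans C f g"
    using assms by (simp add: mem_commuting_spans)
  hence "\<exists>!l. l \<in> span_mor C (Span (p \<cdot> h) (q \<cdot> h)) (Span p q)"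
    using pb by (simp add: is_pullback_def)
  thus ?thesis using assms by (auto simp: mem_span_mor apex_def)
qed

lemma pullback_sym: "is_pullback C f g (Span p q) \<Longrightarrow> is_pullback C g f (Span q p)"
proof -
  assume pb: "is_pullback C f g (Span p q)"
  have "\<exists>!u. u \<in> span_mor C s (Span q p)" if s: "s \<in> commuting_spans C g f" for s
  proof -
    obtain t t' where "s = Span t t'" by (cases s)
    with s have t: "Span t t' \<in> commuting_spans C g f" by simp
    have "\<exists>!u. u \<in> span_mor C (Span t' t) (Span p q)"
      using pb t by (auto simp: is_pullback_def mem_commuting_spans)
    moreover have "u \<in> span_mor C (Span t t') (Span q p) \<longleftrightarrow> u \<in> span_mor C (Span t' t) (Span p q)" for u
      using t pullback_typing[OF pb] by (auto simp: mem_span_mor mem_commuting_spans apex_def)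
    ultimately show ?thesis by (simp add: \<open>s = Span t t'\<close>)
  qed
  moreover have "Span q p \<in> commuting_spans C g f"
    using pullback_typing[OF pb] by (simp add: mem_commuting_spans)
  ultimately show ?thesis
    unfolding is_pullback_def by blast
qed

lemma inverses_iff:
  "inverses C f g \<longleftrightarrow> f \<in> Ar C \<and> g \<in> Ar C \<and> Dom C g = Cod C f \<and> Cod C g = Dom C f \<and>
     g \<cdot> f = Id C (Dom C f) \<and> f \<cdot> g = Id C (Cod C f)"
  by (auto simp: inverses_def hom_iff)

lemma inv_of_eq:
  assumes "inverses C f g" shows "inv_of C f = g"
  unfolding inv_of_def
proof (rule the_equality)
  fix h assume "inverses C f h"
  with assms have "h \<cdot> (f \<cdot> g) = g"
    using reassoc[of h f "Id C (Dom C f)" g] by (simp add: inverses_iff)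
  with \<open>inverses C f h\<close> assms show "h = g" by (simp add: inverses_iff)
qed fact

end

section \<open>Fibrations\<close>

context model_category
begin

abbreviation AFib where "AFib \<equiv> Fib M \<inter> Weq M"

lemma Fib_Ar [simp]: "f \<in> Fib M \<Longrightarrow> f \<in> Ar M"
  using classes_Ar by auto

lemma AFib_comp: "f \<in> AFib \<Longrightarrow> g \<in> AFib \<Longrightarrow> Cod M f = Dom M g \<Longrightarrow> g \<cdot> f \<in> AFib"
  using classes_Comp by auto

lemma AFib_Id: "x \<in> Ob M \<Longrightarrow> Id M x \<in> AFib"
  using classes_Id by auto

text \<open>The retract argument: the lift in the square with top side the identity of the domain of \<open>f\<close>
  and bottom side \<open>p\<close> retracts \<open>p\<close> onto \<open>f\<close>.\<close>

lemma retract_by_lift: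
  assumes "f \<in> Ar M" "i \<in> Ar M" "p \<in> Ar M" "Cod M i = Dom M p" "p \<cdot> i = f" "lifts_against M i f"
  shows "retract_of M f p"
proof -
  have [simp]: "Dom M i = Dom M f" "Cod M p = Cod M f" using comp_typing[of i p] assms by auto
  obtain h where h: "h \<in> hom M (Dom M p) (Dom M f)" "h \<cdot> i = Id M (Dom M f)" "f \<cdot> h = p"
    using assms(6)[unfolded lifts_against_def, rule_format, of "Id M (Dom M f)" p] assms
    by (auto simp: hom_iff)
  show ?thesis unfolding retract_of_def
    by (rule conjI[OF assms(1)], rule conjI[OF assms(3)],
        rule exI[of _ i], rule exI[of _ h], rule exI[of _ "Id M (Cod M f)"],
        rule exI[of _ "Id M (Cod M f)"]) (use h assms in \<open>auto simp: hom_iff\<close>)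
qed

lemma Fib_by_lifting:
  assumes "f \<in> Ar M" "\<And>i. i \<in> Cof M \<inter> Weq M \<Longrightarrow> lifts_against M i f"
  shows "f \<in> Fib M"
proof -
  obtain i p where *: "i \<in> Cof M \<inter> Weq M" "p \<in> Fib M" "Cod M i = Dom M p" "p \<cdot> i = f"
    using factor_acyclic_cof[OF assms(1)] by blast
  hence "retract_of M f p" using retract_by_lift assms classes_Ar by blast
  thus ?thesis using retracts[of "Fib M" p f] * by blast
qed

lemma AFib_by_lifting:
  assumes "f \<in> Ar M" "\<And>i. i \<in> Cof M \<Longrightarrow> lifts_against M i f"
  shows "f \<in> AFib"
proof -
  obtain i p where *: "i \<in> Cof M" "p \<in> AFib" "Cod M i = Dom M p" "p \<cdot> i = f"
    using factor_acyclic_fib[OF assms(1)] by blast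
  hence "retract_of M f p" using retract_by_lift assms classes_Ar by blast
  thus ?thesis using retracts[of "Fib M" p f] retracts[of "Weq M" p f] * by blast
qed

lemma AFib_lifts: "p \<in> AFib \<Longrightarrow> i \<in> Cof M \<Longrightarrow> lifts_against M i p"
  using lifting by auto

text \<open>An isomorphism is a retract of the identity of its codomain.\<close>

lemma iso_AFib:
  assumes "inverses M f g" shows "f \<in> AFib"
proof -
  have *: "f \<in> Ar M" "g \<in> Ar M" "Dom M g = Cod M f" "Cod M g = Dom M f"
    "g \<cdot> f = Id M (Dom M f)" "f \<cdot> g = Id M (Cod M f)" using assms by (auto simp: inverses_iff)
  have "retract_of M f (Id M (Cod M f))" unfolding retract_of_def
    by (rule conjI[OF *(1)], rule conjI, use * in simp,
        rule exI[of _ f], rule exI[of _ g], rule exI[of _ "Id M (Cod M f)"],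
        rule exI[of _ "Id M (Cod M f)"]) (use * in \<open>auto simp: hom_iff\<close>)
  moreover have "Id M (Cod M f) \<in> AFib" using AFib_Id * by simp
  ultimately show ?thesis using retracts by blast
qed

text \<open>A lifting problem against the projection \<open>p\<close> becomes one against \<open>g\<close> after composing with the
  other projection; its solution and the bottom side of the problem together induce a map into the
  pullback. Hence fibrations and acyclic fibrations are stable under pullback.\<close>

lemma pullback_lifts:
  assumes pb: "is_pullback M f g (Span p q)" and [simp]: "f \<in> Ar M" "g \<in> Ar M" "Cod M f = Cod M g"
    and i [simp]: "i \<in> Ar M" and lift: "lifts_against M i g"
  shows "lifts_against M i p"
  unfolding lifts_against_def
proof (intro allI impI, elim conjE)
  fix u v assume "u \<in> hom M (Dom M i) (Dom M p)" "v \<in> hom M (Cod M i) (Cod M p)"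
    and pu: "p \<cdot> u = v \<cdot> i"
  note ty [simp] = pullback_typing(1-5)[OF pb]
  have [simp]: "u \<in> Ar M" "v \<in> Ar M" "Dom M u = Dom M i" "Dom M v = Cod M i" "Cod M u = Dom M p"
    "Cod M v = Dom M f" using \<open>u \<in> _\<close> \<open>v \<in> _\<close> by (auto simp: hom_iff)
  have "g \<cdot> (q \<cdot> u) = f \<cdot> (v \<cdot> i)"
    using reassoc[OF pullback_typing(6)[OF pb], of u] by (simp add: pu)
  then obtain h where "h \<in> hom M (Cod M i) (Dom M g)" and h: "h \<cdot> i = q \<cdot> u" "g \<cdot> h = f \<cdot> v"
    using lift[unfolded lifts_against_def, rule_format, of "q \<cdot> u" "f \<cdot> v"] by (auto simp: hom_iff)
  hence [simp]: "h \<in> Ar M" "Dom M h = Cod M i" "Cod M h = Dom M g" by (auto simp: hom_iff)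
  obtain k where k [simp]: "k \<in> Ar M" "Dom M k = Cod M i" "Cod M k = Dom M p"
    and pk: "p \<cdot> k = v" "q \<cdot> k = h"
    using pullback_induced[OF pb, of v h] h by auto
  have "k \<cdot> i = u"
    by (rule pullback_jointly_monic[OF pb])
      (simp_all add: reassoc[OF pk(1)] reassoc[OF pk(2)] h(1) pu)
  thus "\<exists>h. h \<in> hom M (Cod M i) (Dom M p) \<and> h \<cdot> i = u \<and> p \<cdot> h = v"
    using pk by (intro exI[of _ k]) (auto simp: hom_iff)
qed

lemma pullback_Fib:
  assumes pb: "is_pullback M f g (Span p q)" and "f \<in> Ar M" "Cod M f = Cod M g" and "g \<in> Fib M"
  shows "p \<in> Fib M"
proof (rule Fib_by_lifting)
  fix i assume "i \<in> Cof M \<inter> Weq M"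
  hence "i \<in> Ar M" "lifts_against M i g" using lifting \<open>g \<in> Fib M\<close> classes_Ar by auto
  thus "lifts_against M i p" using pullback_lifts[OF pb] assms Fib_Ar by blast
qed (rule pullback_typing(1)[OF pb])

lemma pullback_AFib:
  assumes pb: "is_pullback M f g (Span p q)" and "f \<in> Ar M" "Cod M f = Cod M g" and "g \<in> AFib"
  shows "p \<in> AFib"
proof (rule AFib_by_lifting)
  fix i assume "i \<in> Cof M"
  hence "i \<in> Ar M" "lifts_against M i g" using AFib_lifts \<open>g \<in> AFib\<close> classes_Ar by auto
  thus "lifts_against M i p" using pullback_lifts[OF pb] assms Fib_Ar by blast
qed (rule pullback_typing(1)[OF pb])

text \<open>This makes the left leg of a horizontal composite an acyclic fibration. A lifting problem
  against the map \<open>m\<close> between the pullbacks of \<open>(f a, g b)\<close> and of \<open>(f, g)\<close> splits into one against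
  \<open>a\<close> and one against \<open>b\<close>. The two lifts become equal when composed to the common base, because the
  bottom side of the problem already lands in the pullback of \<open>(f, g)\<close>, so they induce a lift.\<close>

lemma pullback_map_AFib:
  assumes P: "is_pullback M f g (Span p q)" and [simp]: "f \<in> Ar M" "g \<in> Ar M" "Cod M f = Cod M g"
    and T: "is_pullback M (f \<cdot> a) (g \<cdot> b) (Span u v)"
    and a: "a \<in> AFib" "Cod M a = Dom M f" and b: "b \<in> AFib" "Cod M b = Dom M g"
    and m [simp]: "m \<in> Ar M" "Dom M m = Dom M u" "Cod M m = Dom M p"
    and pm: "p \<cdot> m = a \<cdot> u" and qm: "q \<cdot> m = b \<cdot> v"
  shows "m \<in> AFib"
proof (rule AFib_by_lifting)
  fix i assume i: "i \<in> Cof M"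
  hence [simp]: "i \<in> Ar M" "a \<in> Ar M" "b \<in> Ar M" using classes_Ar a b by auto
  note [simp] = pullback_typing(1-5)[OF P] a(2) b(2)
  note ty [simp] = pullback_typing(1-5)[OF T, simplified]
  show "lifts_against M i m" unfolding lifts_against_def
  proof (intro allI impI, elim conjE)
    fix w z assume wz: "w \<in> hom M (Dom M i) (Dom M m)" "z \<in> hom M (Cod M i) (Cod M m)"
      and mw: "m \<cdot> w = z \<cdot> i"
    have [simp]: "w \<in> Ar M" "z \<in> Ar M" "Dom M w = Dom M i" "Dom M z = Cod M i" "Cod M w = Dom M u"
      "Cod M z = Dom M p" using wz by (auto simp: hom_iff)
    have "a \<cdot> (u \<cdot> w) = p \<cdot> (z \<cdot> i)" "b \<cdot> (v \<cdot> w) = q \<cdot> (z \<cdot> i)"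
      using reassoc[OF pm, of w] reassoc[OF qm, of w] by (simp_all add: mw)
    then obtain h k where "h \<in> hom M (Cod M i) (Dom M a)" "k \<in> hom M (Cod M i) (Dom M b)"
      and h: "h \<cdot> i = u \<cdot> w" "a \<cdot> h = p \<cdot> z" and k: "k \<cdot> i = v \<cdot> w" "b \<cdot> k = q \<cdot> z"
      using AFib_lifts[OF a(1) i, unfolded lifts_against_def, rule_format, of "u \<cdot> w" "p \<cdot> z"]
        AFib_lifts[OF b(1) i, unfolded lifts_against_def, rule_format, of "v \<cdot> w" "q \<cdot> z"]
      by (auto simp: hom_iff)
    hence [simp]: "h \<in> Ar M" "Dom M h = Cod M i" "Cod M h = Dom M a"
      "k \<in> Ar M" "Dom M k = Cod M i" "Cod M k = Dom M b" by (auto simp: hom_iff)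
    have "f \<cdot> (a \<cdot> h) = g \<cdot> (b \<cdot> k)"
      using reassoc[OF pullback_typing(6)[OF P], of z] by (simp add: h k)
    then obtain l where l [simp]: "l \<in> Ar M" "Dom M l = Cod M i" "Cod M l = Dom M u"
      and ul: "u \<cdot> l = h" "v \<cdot> l = k"
      using pullback_induced[OF T, of h k] by auto
    have "l \<cdot> i = w"
      by (rule pullback_jointly_monic[OF T])
        (simp_all add: reassoc[OF ul(1)] reassoc[OF ul(2)] h(1) k(1))
    moreover have "m \<cdot> l = z"
      by (rule pullback_jointly_monic[OF P])
        (simp_all add: reassoc[OF pm] reassoc[OF qm] ul h(2) k(2))
    ultimately show "\<exists>h. h \<in> hom M (Cod M i) (Dom M m) \<and> h \<cdot> i = w \<and> m \<cdot> h = z"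
      by (intro exI[of _ l]) (auto simp: hom_iff)
  qed
qed simp

end

section \<open>Product categories\<close>

lemma mem_hom_prod_cat:
  "p \<in> hom (prod_cat A B) s t \<longleftrightarrow> fst p \<in> hom A (fst s) (fst t) \<and> snd p \<in> hom B (snd s) (snd t)"
  by (auto simp: hom_def prod_cat_def split: prod.splits)

lemma category_prod_cat:
  assumes "category A" "category B" shows "category (prod_cat A B)"
proof -
  interpret A: category A by fact
  interpret B: category B by fact
  show ?thesis
  proof
    show "f \<in> Ar (prod_cat A B) \<Longrightarrow> Dom (prod_cat A B) f \<in> Ob (prod_cat A B)" for f
      by (auto simp: prod_cat_def)
    show "f \<in> Ar (prod_cat A B) \<Longrightarrow> Cod (prod_cat A B) f \<in> Ob (prod_cat A B)" for f
      by (auto simp: prod_cat_def)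
  next
    fix x assume "x \<in> Ob (prod_cat A B)"
    thus "Id (prod_cat A B) x \<in> hom (prod_cat A B) x x"
      by (auto simp: mem_hom_prod_cat) (auto simp: prod_cat_def A.Id_hom B.Id_hom)
  next
    fix f g x y z assume "f \<in> hom (prod_cat A B) x y" "g \<in> hom (prod_cat A B) y z"
    thus "Comp (prod_cat A B) g f \<in> hom (prod_cat A B) x z"
      by (auto simp: mem_hom_prod_cat) (auto simp: prod_cat_def split: prod.splits intro: A.Comp_hom B.Comp_hom)
  next
    fix f x y assume "f \<in> hom (prod_cat A B) x y"
    hence "fst f \<in> hom A (fst x) (fst y)" "snd f \<in> hom B (snd x) (snd y)" by (auto simp: mem_hom_prod_cat)
    thus "Comp (prod_cat A B) (Id (prod_cat A B) y) f = f" "Comp (prod_cat A B) f (Id (prod_cat A B) x) = f"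
      by (auto simp: prod_cat_def A.Id_left A.Id_right B.Id_left B.Id_right split: prod.splits)
  next
    fix f g h w x y z
    assume "f \<in> hom (prod_cat A B) w x" "g \<in> hom (prod_cat A B) x y" "h \<in> hom (prod_cat A B) y z"
    thus "Comp (prod_cat A B) (Comp (prod_cat A B) h g) f = Comp (prod_cat A B) h (Comp (prod_cat A B) g f)"
      unfolding mem_hom_prod_cat
      by (auto simp: prod_cat_def split: prod.splits intro: A.Comp_assoc B.Comp_assoc)
  qed
qed

lemma prod_cat_simps [simp]:
  "Ob (prod_cat A B) = Ob A \<times> Ob B" "Comp (prod_cat A B) (f', g') (f, g) = (Comp A f' f, Comp B g' g)"
  "Id (prod_cat A B) (x, y) = (Id A x, Id B y)"
  by (simp_all add: prod_cat_def)

section \<open>Two-cells\<close>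

lemma UN_eq_const: "A \<noteq> {} \<Longrightarrow> (\<And>a. a \<in> A \<Longrightarrow> f a = c) \<Longrightarrow> (\<Union>a\<in>A. f a) = c"
  by auto

lemma two_class_inject: "two_class M F F' a = two_class M F F' b \<longleftrightarrow> two_eq M F F' `` {a} = two_eq M F F' `` {b}"
  by (simp add: two_class_def)

lemma two_class_sel [simp]:
  "src (two_class M F F' a) = F" "tgt (two_class M F F' a) = F'"
  "cls (two_class M F F' a) = two_eq M F F' `` {a}"
  by (simp_all add: two_class_def)

lemma two_eq_in_reps: "(a, b) \<in> two_eq M F F' \<Longrightarrow> a \<in> two_reps M F F' \<and> b \<in> two_reps M F F'"
  by (simp add: two_eq_def)

lemma two_eq_refl: "a \<in> two_reps M F F' \<Longrightarrow> (a, a) \<in> two_eq M F F'"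
  by (simp add: two_eq_def)

lemma equiv_two_eq: "equiv (two_reps M F F') (two_eq M F F')"
proof (rule equivI)
  show "two_eq M F F' \<subseteq> two_reps M F F' \<times> two_reps M F F'" by (auto simp: two_eq_def)
  show "refl_on (two_reps M F F') (two_eq M F F')"
    by (auto simp: refl_on_def two_eq_def)
  have "sym ((two_rel M F F' \<union> (two_rel M F F')\<inverse>)\<^sup>*)"
    by (rule sym_rtrancl) (rule sym_Un_converse)
  thus "sym (two_eq M F F')" by (auto simp: sym_def two_eq_def)
  show "trans (two_eq M F F')" by (auto simp: trans_def two_eq_def)
qed

lemma two_eq_invariant:
  assumes "(a, b) \<in> two_eq M F F'"
    and inv: "\<And>a b. (a, b) \<in> two_rel M F F' \<Longrightarrow> g a = g b"
  shows "g a = g b"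
proof -
  have "(a, b) \<in> (two_rel M F F' \<union> (two_rel M F F')\<inverse>)\<^sup>*" using assms(1) by (simp add: two_eq_def)
  thus ?thesis by induction (use inv in fastforce)+
qed

text \<open>One morphism of representatives always suffices below to identify two given classes; longer
  zigzags only occur between the representatives of one class.\<close>

lemma two_class_eqI:
  assumes "a \<in> two_reps M F F'" "b \<in> two_reps M F F'" "\<theta> \<in> span_mor M a b"
  shows "two_class M F F' a = two_class M F F' b"
proof -
  have "(a, b) \<in> two_eq M F F'" using assms by (auto simp: two_eq_def two_rel_def)
  thus ?thesis by (simp add: two_class_inject equiv_class_eq[OF equiv_two_eq])
qed

locale model_category_with_pullbacks = model_category M U
  for M :: "('o, 'm, 'x) model_scheme" (structure) and U :: "'i set" +
  fixes pb :: "'m \<Rightarrow> 'm \<Rightarrow> 'm span"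
  assumes choice: "pullback_choice M pb"
begin

lemma pb_pullback:
  assumes "f \<in> Ar M" "g \<in> Ar M" "Cod M f = Cod M g"
  obtains p q where "pb f g = Span p q" "is_pullback M f g (Span p q)"
proof -
  have "is_pullback M f g (pb f g)" using assms choice by (simp add: pullback_choice_def)
  thus thesis using that by (cases "pb f g") simp
qed

lemma one_cell_typing:
  assumes "F \<in> one_cells M x y"
  shows "lleg F \<in> Ar M" "rleg F \<in> Ar M" "Dom M (rleg F) = Dom M (lleg F)" "Cod M (lleg F) = x"
    "Cod M (rleg F) = y" "apex M F = Dom M (lleg F)" "lleg F \<in> Fib M" "rleg F \<in> Fib M"
  using assms by (auto simp: one_cells_def spans_def apex_def hom_iff)

lemma one_cell_boundary: "F \<in> one_cells M x y \<Longrightarrow> x \<in> Ob M \<and> y \<in> Ob M"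
  using Cod_closed[of "lleg F"] Cod_closed[of "rleg F"] by (simp add: one_cell_typing)

lemma mem_one_cells:
  "Span l r \<in> one_cells M x y \<longleftrightarrow> l \<in> Fib M \<and> r \<in> Fib M \<and> Dom M r = Dom M l \<and> Cod M l = x \<and> Cod M r = y"
  by (auto simp: one_cells_def spans_def apex_def hom_iff)

lemma two_rep_typing:
  assumes "a \<in> two_reps M F F'"
  shows "lleg a \<in> Ar M" "rleg a \<in> Ar M" "Dom M (rleg a) = Dom M (lleg a)"
    "Cod M (lleg a) = apex M F" "Cod M (rleg a) = apex M F'" "apex M a = Dom M (lleg a)"
  using assms by (auto simp: two_reps_def spans_of_spans_def spans_def apex_def hom_iff)

lemma two_rep_eqs:
  assumes "a \<in> two_reps M F F'"
  shows "lleg F \<cdot> lleg a = lleg F' \<cdot> rleg a" "rleg F \<cdot> lleg a = rleg F' \<cdot> rleg a" "lleg a \<in> AFib"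
  using assms by (auto simp: two_reps_def spans_of_spans_def)

lemma mem_two_reps:
  "Span l r \<in> two_reps M F F' \<longleftrightarrow> l \<in> AFib \<and> r \<in> Ar M \<and> Dom M r = Dom M l \<and>
     Cod M l = apex M F \<and> Cod M r = apex M F' \<and> lleg F \<cdot> l = lleg F' \<cdot> r \<and> rleg F \<cdot> l = rleg F' \<cdot> r"
  by (auto simp: two_reps_def spans_of_spans_def spans_def apex_def hom_iff)

section \<open>Vertical composition\<close>

lemma span_comp_two_reps:
  assumes F: "F \<in> one_cells M x y" "F' \<in> one_cells M x y" "F'' \<in> one_cells M x y"
    and a: "a \<in> two_reps M F F'" and a': "a' \<in> two_reps M F' F''"
    and pq: "pb (rleg a) (lleg a') = Span p q"
  shows "is_pullback M (rleg a) (lleg a') (Span p q)"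
    and "span_comp M pb a' a = Span (lleg a \<cdot> p) (rleg a' \<cdot> q)"
    and "Span (lleg a \<cdot> p) (rleg a' \<cdot> q) \<in> two_reps M F F''"
proof -
  note [simp] = F[THEN one_cell_typing(1)] F[THEN one_cell_typing(2)] F[THEN one_cell_typing(3)]
    F[THEN one_cell_typing(4)] F[THEN one_cell_typing(5)] F[THEN one_cell_typing(6)]
    two_rep_typing[OF a] two_rep_typing[OF a']
  show P: "is_pullback M (rleg a) (lleg a') (Span p q)"
    by (rule pb_pullback[of "rleg a" "lleg a'"]) (simp_all add: pq)
  note [simp] = pullback_typing(1-5)[OF P]
  show "span_comp M pb a' a = Span (lleg a \<cdot> p) (rleg a' \<cdot> q)"
    by (simp add: span_comp_def pq)
  have "p \<in> AFib" using pullback_AFib[OF P] two_rep_eqs[OF a'] by simp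
  hence "lleg a \<cdot> p \<in> AFib" using two_rep_eqs[OF a] by (intro AFib_comp) simp_all
  moreover have "lleg F \<cdot> (lleg a \<cdot> p) = lleg F'' \<cdot> (rleg a' \<cdot> q)"
    by (simp add: reassoc[OF two_rep_eqs(1)[OF a]] pullback_typing(6)[OF P] reassoc[OF two_rep_eqs(1)[OF a']])
  moreover have "rleg F \<cdot> (lleg a \<cdot> p) = rleg F'' \<cdot> (rleg a' \<cdot> q)"
    by (simp add: reassoc[OF two_rep_eqs(2)[OF a]] pullback_typing(6)[OF P] reassoc[OF two_rep_eqs(2)[OF a']])
  ultimately show "Span (lleg a \<cdot> p) (rleg a' \<cdot> q) \<in> two_reps M F F''"
    by (simp add: mem_two_reps)
qed

text \<open>The pullback in the definition of vertical composition may be replaced by any commuting cone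
  \<open>(u, v)\<close> whose left leg down to \<open>f\<close> is an acyclic fibration: the map that the cone induces into
  the pullback is a morphism of spans of spans. This turns equations of composites into the search
  for a cone.\<close>

lemma two_class_vcomp_cone:
  assumes F: "F \<in> one_cells M x y" "F' \<in> one_cells M x y" "F'' \<in> one_cells M x y"
    and a: "a \<in> two_reps M F F'" and a': "a' \<in> two_reps M F' F''"
    and u [simp]: "u \<in> Ar M" "v \<in> Ar M" "Dom M v = Dom M u" "Cod M u = Dom M (lleg a)"
      "Cod M v = Dom M (lleg a')"
    and eq: "rleg a \<cdot> u = lleg a' \<cdot> v" and AF: "lleg a \<cdot> u \<in> AFib"
  shows "two_class M F F'' (span_comp M pb a' a) = two_class M F F'' (Span (lleg a \<cdot> u) (rleg a' \<cdot> v))"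
proof -
  note [simp] = F[THEN one_cell_typing(1)] F[THEN one_cell_typing(2)] F[THEN one_cell_typing(3)]
    F[THEN one_cell_typing(4)] F[THEN one_cell_typing(5)] F[THEN one_cell_typing(6)]
    two_rep_typing[OF a] two_rep_typing[OF a']
  obtain p q where pq: "pb (rleg a) (lleg a') = Span p q" by (cases "pb (rleg a) (lleg a')")
  note * = span_comp_two_reps[OF F a a' pq]
  note [simp] = pullback_typing(1-5)[OF *(1)]
  obtain h where [simp]: "h \<in> Ar M" "Dom M h = Dom M u" "Cod M h = Dom M p" and h: "p \<cdot> h = u" "q \<cdot> h = v"
    by (rule pullback_induced[OF *(1), of u v]) (simp_all add: eq)
  have "lleg F \<cdot> (lleg a \<cdot> u) = lleg F'' \<cdot> (rleg a' \<cdot> v)"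
    "rleg F \<cdot> (lleg a \<cdot> u) = rleg F'' \<cdot> (rleg a' \<cdot> v)"
    by (simp_all add: reassoc[OF two_rep_eqs(1)[OF a]] eq reassoc[OF two_rep_eqs(1)[OF a']]
        reassoc[OF two_rep_eqs(2)[OF a]] reassoc[OF two_rep_eqs(2)[OF a']])
  hence "Span (lleg a \<cdot> u) (rleg a' \<cdot> v) \<in> two_reps M F F''"
    using AF by (simp add: mem_two_reps)
  moreover have "h \<in> span_mor M (Span (lleg a \<cdot> u) (rleg a' \<cdot> v)) (Span (lleg a \<cdot> p) (rleg a' \<cdot> q))"
    by (simp add: mem_span_mor apex_def h)
  ultimately show ?thesis using two_class_eqI[OF _ *(3)] *(2) by simp
qed

text \<open>Replacing \<open>a\<close> along \<open>\<theta> : a \<rightarrow> b\<close> turns the pullback for \<open>a\<close> into a commuting cone for \<open>b\<close>, with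
  the same outer legs; likewise in the other argument.\<close>

lemma vcomp_two_class:
  assumes F: "F \<in> one_cells M x y" "F' \<in> one_cells M x y" "F'' \<in> one_cells M x y"
    and a: "a \<in> two_reps M F F'" and a': "a' \<in> two_reps M F' F''"
  shows "vcomp M pb (two_class M F' F'' a') (two_class M F F' a) = two_class M F F'' (span_comp M pb a' a)"
proof -
  have left: "two_class M F F'' (span_comp M pb c' c) = two_class M F F'' (span_comp M pb c' d)"
    if cd: "(c, d) \<in> two_rel M F F'" and c': "c' \<in> two_reps M F' F''" for c d c'
  proof -
    from cd obtain \<theta> where c: "c \<in> two_reps M F F'" and d: "d \<in> two_reps M F F'"
      and \<theta>: "\<theta> \<in> span_mor M c d" by (auto simp: two_rel_def)
    note [simp] = two_rep_typing[OF c] two_rep_typing[OF d] two_rep_typing[OF c']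
    obtain p q where pq: "pb (rleg c) (lleg c') = Span p q" by (cases "pb (rleg c) (lleg c')")
    note * = span_comp_two_reps[OF F c c' pq]
    note P [simp] = pullback_typing[OF *(1)]
    have [simp]: "\<theta> \<in> Ar M" "Dom M \<theta> = Dom M (lleg c)" "Cod M \<theta> = Dom M (lleg d)"
      and t: "lleg d \<cdot> \<theta> = lleg c" "rleg d \<cdot> \<theta> = rleg c" using \<theta> by (auto simp: mem_span_mor)
    have "lleg c \<cdot> p \<in> AFib" using *(3) by (simp add: mem_two_reps)
    thus ?thesis
      using two_class_vcomp_cone[OF F d c', of "\<theta> \<cdot> p" q] reassoc[OF t(1), of p] reassoc[OF t(2), of p]
      by (simp add: *(2))
  qed
  have right: "two_class M F F'' (span_comp M pb c' c) = two_class M F F'' (span_comp M pb d' c)"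
    if cd: "(c', d') \<in> two_rel M F' F''" and c: "c \<in> two_reps M F F'" for c c' d'
  proof -
    from cd obtain \<theta> where c': "c' \<in> two_reps M F' F''" and d': "d' \<in> two_reps M F' F''"
      and \<theta>: "\<theta> \<in> span_mor M c' d'" by (auto simp: two_rel_def)
    note [simp] = two_rep_typing[OF c] two_rep_typing[OF d'] two_rep_typing[OF c']
    obtain p q where pq: "pb (rleg c) (lleg c') = Span p q" by (cases "pb (rleg c) (lleg c')")
    note * = span_comp_two_reps[OF F c c' pq]
    note P [simp] = pullback_typing[OF *(1)]
    have [simp]: "\<theta> \<in> Ar M" "Dom M \<theta> = Dom M (lleg c')" "Cod M \<theta> = Dom M (lleg d')"
      and t: "lleg d' \<cdot> \<theta> = lleg c'" "rleg d' \<cdot> \<theta> = rleg c'" using \<theta> by (auto simp: mem_span_mor)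
    have "lleg c \<cdot> p \<in> AFib" using *(3) by (simp add: mem_two_reps)
    thus ?thesis
      using two_class_vcomp_cone[OF F c d', of p "\<theta> \<cdot> q"] reassoc[OF t(1), of q] reassoc[OF t(2), of q]
      by (simp add: *(2))
  qed
  have indep: "two_eq M F F'' `` {span_comp M pb b' b} = two_eq M F F'' `` {span_comp M pb a' a}"
    if "(a, b) \<in> two_eq M F F'" "(a', b') \<in> two_eq M F' F''" for b b'
  proof -
    have "two_class M F F'' (span_comp M pb a' a) = two_class M F F'' (span_comp M pb a' b)"
      using that(1)
      by (rule two_eq_invariant[where g = "\<lambda>c. two_class M F F'' (span_comp M pb a' c)"]) (rule left[OF _ a'])
    also have "\<dots> = two_class M F F'' (span_comp M pb b' b)"
      using that(2)
      by (rule two_eq_invariant[where g = "\<lambda>c. two_class M F F'' (span_comp M pb c b)"])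
        (rule right[OF _ two_eq_in_reps[OF that(1), THEN conjunct2]])
    finally show ?thesis by (simp add: two_class_inject)
  qed
  have "(\<Union>c\<in>two_eq M F F' `` {a}. \<Union>c'\<in>two_eq M F' F'' `` {a'}. two_eq M F F'' `` {span_comp M pb c' c})
      = two_eq M F F'' `` {span_comp M pb a' a}"
    by (intro UN_eq_const indep) (use two_eq_refl[OF a] two_eq_refl[OF a'] in blast)+
  thus ?thesis by (simp add: vcomp_def) (simp add: two_class_def)
qed

section \<open>Horizontal composition\<close>

lemma span_comp_one_cells:
  assumes F: "F \<in> one_cells M x y" and G: "G \<in> one_cells M y z"
    and pq: "pb (rleg F) (lleg G) = Span p q"
  shows "is_pullback M (rleg F) (lleg G) (Span p q)"
    and "span_comp M pb G F = Span (lleg F \<cdot> p) (rleg G \<cdot> q)"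
    and "Span (lleg F \<cdot> p) (rleg G \<cdot> q) \<in> one_cells M x z"
    and "apex M (span_comp M pb G F) = Dom M p"
proof -
  note [simp] = one_cell_typing[OF F] one_cell_typing[OF G]
  show P: "is_pullback M (rleg F) (lleg G) (Span p q)"
    by (rule pb_pullback[of "rleg F" "lleg G"]) (simp_all add: pq)
  note [simp] = pullback_typing(1-5)[OF P]
  show *: "span_comp M pb G F = Span (lleg F \<cdot> p) (rleg G \<cdot> q)"
    by (simp add: span_comp_def pq)
  show "apex M (span_comp M pb G F) = Dom M p" by (simp add: * apex_def)
  have "p \<in> Fib M" by (rule pullback_Fib[OF P]) simp_all
  moreover have "q \<in> Fib M" by (rule pullback_Fib[OF pullback_sym[OF P]]) simp_all
  ultimately show "Span (lleg F \<cdot> p) (rleg G \<cdot> q) \<in> one_cells M x z"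
    by (auto simp: mem_one_cells intro!: classes_Comp[of "Fib M"])
qed

lemma span_comp_in_one_cells:
  "F \<in> one_cells M x y \<Longrightarrow> G \<in> one_cells M y z \<Longrightarrow> span_comp M pb G F \<in> one_cells M x z"
  by (cases "pb (rleg F) (lleg G)") (simp add: span_comp_one_cells)

lemma product_map_two_rep:
  assumes F: "F \<in> one_cells M x y" "F' \<in> one_cells M x y" and G: "G \<in> one_cells M y z" "G' \<in> one_cells M y z"
    and a: "a \<in> two_reps M F F'" and b: "b \<in> two_reps M G G'"
    and pq: "pb (rleg F) (lleg G) = Span p q" and pq': "pb (rleg F') (lleg G') = Span p' q'"
    and u [simp]: "u \<in> Ar M" "v \<in> Ar M" "Dom M v = Dom M u" "Cod M u = Dom M (lleg a)"
        "Cod M v = Dom M (lleg b)"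
    and m [simp]: "m \<in> AFib" "Dom M m = Dom M u" "Cod M m = Dom M p"
        and m_eq: "p \<cdot> m = lleg a \<cdot> u" "q \<cdot> m = lleg b \<cdot> v"
    and n [simp]: "n \<in> Ar M" "Dom M n = Dom M u" "Cod M n = Dom M p'"
        and n_eq: "p' \<cdot> n = rleg a \<cdot> u" "q' \<cdot> n = rleg b \<cdot> v"
  shows "Span m n \<in> two_reps M (span_comp M pb G F) (span_comp M pb G' F')"
proof -
  note [simp] = one_cell_typing[OF F(1)] one_cell_typing[OF F(2)] one_cell_typing[OF G(1)]
      one_cell_typing[OF G(2)]
    two_rep_typing[OF a] two_rep_typing[OF b]
  note P = span_comp_one_cells[OF F(1) G(1) pq] and P' = span_comp_one_cells[OF F(2) G(2) pq']
  note [simp] = pullback_typing(1-5)[OF P(1)] pullback_typing(1-5)[OF P'(1)] P(4) P'(4)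
  have [simp]: "m \<in> Ar M" using m(1) by simp
  show ?thesis
    by (simp add: mem_two_reps m[simplified])
        (simp add: P(2) P'(2) m_eq n_eq reassoc[OF two_rep_eqs(1)[OF a]] reassoc[OF two_rep_eqs(2)[OF b]])
qed

text \<open>The representative of a horizontal composite, described by the projections that determine its
  legs. Below it is used only through these equations.\<close>

lemma hcomp_rep_cases:
  assumes F: "F \<in> one_cells M x y" "F' \<in> one_cells M x y" and G: "G \<in> one_cells M y z" "G' \<in> one_cells M y z"
    and a: "a \<in> two_reps M F F'" and b: "b \<in> two_reps M G G'"
    and pq: "pb (rleg F) (lleg G) = Span p q" and pq': "pb (rleg F') (lleg G') = Span p' q'"
  obtains u v m n where
    "is_pullback M (rleg F \<cdot> lleg a) (lleg G \<cdot> lleg b) (Span u v)"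
    "hcomp_rep M pb G G' F F' b a = Span m n"
    "Span m n \<in> two_reps M (span_comp M pb G F) (span_comp M pb G' F')"
    "u \<in> Ar M" "v \<in> Ar M" "Dom M v = Dom M u" "Cod M u = Dom M (lleg a)" "Cod M v = Dom M (lleg b)"
    "m \<in> Ar M" "Dom M m = Dom M u" "Cod M m = Dom M p" "n \<in> Ar M" "Dom M n = Dom M u" "Cod M n = Dom M p'"
    "m \<in> AFib"
    "p \<cdot> m = lleg a \<cdot> u" "q \<cdot> m = lleg b \<cdot> v" "p' \<cdot> n = rleg a \<cdot> u" "q' \<cdot> n = rleg b \<cdot> v"
proof -
  note [simp] = one_cell_typing[OF F(1)] one_cell_typing[OF F(2)] one_cell_typing[OF G(1)]
      one_cell_typing[OF G(2)]
    two_rep_typing[OF a] two_rep_typing[OF b]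
  note P = span_comp_one_cells[OF F(1) G(1) pq] and P' = span_comp_one_cells[OF F(2) G(2) pq']
  note [simp] = pullback_typing(1-5)[OF P(1)] pullback_typing(1-5)[OF P'(1)] P(4) P'(4)
  obtain u v where uv: "pb (rleg F \<cdot> lleg a) (lleg G \<cdot> lleg b) = Span u v"
    and T: "is_pullback M (rleg F \<cdot> lleg a) (lleg G \<cdot> lleg b) (Span u v)"
    by (rule pb_pullback[of "rleg F \<cdot> lleg a" "lleg G \<cdot> lleg b"]) simp_all
  note ty [simp] = pullback_typing[OF T, simplified]
  obtain m where m: "m = induced M (Span (lleg a \<cdot> u) (lleg b \<cdot> v)) (Span p q)"
    and m_ty [simp]: "m \<in> Ar M" "Dom M m = Dom M u" "Cod M m = Dom M p"
        and m_eq: "p \<cdot> m = lleg a \<cdot> u" "q \<cdot> m = lleg b \<cdot> v"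
    by (rule pullback_induced[OF P(1), of "lleg a \<cdot> u" "lleg b \<cdot> v"]) simp_all
  have "rleg F' \<cdot> (rleg a \<cdot> u) = lleg G' \<cdot> (rleg b \<cdot> v)"
    using reassoc[OF two_rep_eqs(2)[OF a], of u] reassoc[OF two_rep_eqs(1)[OF b], of v] by simp
  then obtain n where n: "n = induced M (Span (rleg a \<cdot> u) (rleg b \<cdot> v)) (Span p' q')"
    and n_ty [simp]: "n \<in> Ar M" "Dom M n = Dom M u" "Cod M n = Dom M p'"
        and n_eq: "p' \<cdot> n = rleg a \<cdot> u" "q' \<cdot> n = rleg b \<cdot> v"
    using pullback_induced[OF P'(1), of "rleg a \<cdot> u" "rleg b \<cdot> v"] by (auto simp del: ty(6))
  have mA: "m \<in> AFib"
    by (rule pullback_map_AFib[OF P(1) _ _ _ T]) (use two_rep_eqs[OF a] two_rep_eqs[OF b] m_eq in simp_all)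
  show thesis
    by (rule that[OF T _ product_map_two_rep[OF F G a b pq pq' _ _ _ _ _ mA _ _ m_eq _ _ _ n_eq]])
      (simp_all add: m_eq n_eq mA[simplified] hcomp_rep_def uv pq pq' m[symmetric] n[symmetric] del: ty(6))
qed

text \<open>As for vertical composition, a cone \<open>(u, v)\<close> over the two given spans of spans may replace the
  pullback, provided that the resulting left leg \<open>m\<close> is an acyclic fibration. Commutativity of the
  cone is implied: \<open>m\<close> maps into a pullback over the common base.\<close>

lemma two_class_hcomp_cone:
  assumes F: "F \<in> one_cells M x y" "F' \<in> one_cells M x y" and G: "G \<in> one_cells M y z" "G' \<in> one_cells M y z"
    and a: "a \<in> two_reps M F F'" and b: "b \<in> two_reps M G G'"
    and pq: "pb (rleg F) (lleg G) = Span p q" and pq': "pb (rleg F') (lleg G') = Span p' q'"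
    and u [simp]: "u \<in> Ar M" "v \<in> Ar M" "Dom M v = Dom M u" "Cod M u = Dom M (lleg a)"
        "Cod M v = Dom M (lleg b)"
    and m [simp]: "m \<in> AFib" "Dom M m = Dom M u" "Cod M m = Dom M p"
        and m_eq: "p \<cdot> m = lleg a \<cdot> u" "q \<cdot> m = lleg b \<cdot> v"
    and n [simp]: "n \<in> Ar M" "Dom M n = Dom M u" "Cod M n = Dom M p'"
        and n_eq: "p' \<cdot> n = rleg a \<cdot> u" "q' \<cdot> n = rleg b \<cdot> v"
  shows "two_class M (span_comp M pb G F) (span_comp M pb G' F') (hcomp_rep M pb G G' F F' b a)
    = two_class M (span_comp M pb G F) (span_comp M pb G' F') (Span m n)"
proof -
  note [simp] = one_cell_typing[OF F(1)] one_cell_typing[OF F(2)] one_cell_typing[OF G(1)]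
      one_cell_typing[OF G(2)]
    two_rep_typing[OF a] two_rep_typing[OF b]
  note P = span_comp_one_cells[OF F(1) G(1) pq] and P' = span_comp_one_cells[OF F(2) G(2) pq']
  note [simp] = pullback_typing(1-5)[OF P(1)] pullback_typing(1-5)[OF P'(1)] P(4) P'(4)
  have [simp]: "m \<in> Ar M" using m(1) by simp
  obtain u0 v0 m0 n0 where T: "is_pullback M (rleg F \<cdot> lleg a) (lleg G \<cdot> lleg b) (Span u0 v0)"
    and rep: "hcomp_rep M pb G G' F F' b a = Span m0 n0"
    and two_rep: "Span m0 n0 \<in> two_reps M (span_comp M pb G F) (span_comp M pb G' F')"
    and [simp]: "u0 \<in> Ar M" "v0 \<in> Ar M" "Dom M v0 = Dom M u0" "Cod M u0 = Dom M (lleg a)"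
        "Cod M v0 = Dom M (lleg b)"
    "m0 \<in> Ar M" "Dom M m0 = Dom M u0" "Cod M m0 = Dom M p" "n0 \<in> Ar M" "Dom M n0 = Dom M u0"
        "Cod M n0 = Dom M p'"
    and m0: "p \<cdot> m0 = lleg a \<cdot> u0" "q \<cdot> m0 = lleg b \<cdot> v0"
        and n0: "p' \<cdot> n0 = rleg a \<cdot> u0" "q' \<cdot> n0 = rleg b \<cdot> v0"
    by (rule hcomp_rep_cases[OF F G a b pq pq'])
  have "rleg F \<cdot> (lleg a \<cdot> u) = lleg G \<cdot> (lleg b \<cdot> v)"
    using reassoc[OF pullback_typing(6)[OF P(1)], of m] by (simp add: m_eq)
  then obtain h where [simp]: "h \<in> Ar M" "Dom M h = Dom M u" "Cod M h = Dom M u0"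
      and h: "u0 \<cdot> h = u" "v0 \<cdot> h = v"
    using pullback_induced[OF T, of u v] by auto
  have "m0 \<cdot> h = m"
    by (rule pullback_jointly_monic[OF P(1)]) (simp_all add: reassoc[OF m0(1)] reassoc[OF m0(2)] h m_eq)
  moreover have "n0 \<cdot> h = n"
    by (rule pullback_jointly_monic[OF P'(1)]) (simp_all add: reassoc[OF n0(1)] reassoc[OF n0(2)] h n_eq)
  ultimately have "h \<in> span_mor M (Span m n) (Span m0 n0)" by (simp add: mem_span_mor apex_def)
  thus ?thesis
    unfolding rep
    using two_class_eqI[OF product_map_two_rep[OF F G a b pq pq' u m m_eq n n_eq] two_rep] by simp
qed

text \<open>Morphisms \<open>\<theta>\<close> and \<open>\<eta>\<close> of representatives carry the pullback for the old pair to a cone over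
  the new pair with the same legs.\<close>

lemma hcomp_two_class:
  assumes F: "F \<in> one_cells M x y" "F' \<in> one_cells M x y" and G: "G \<in> one_cells M y z" "G' \<in> one_cells M y z"
    and a: "a \<in> two_reps M F F'" and b: "b \<in> two_reps M G G'"
  shows "hcomp M pb (two_class M G G' b) (two_class M F F' a)
    = two_class M (span_comp M pb G F) (span_comp M pb G' F') (hcomp_rep M pb G G' F F' b a)"
proof -
  let ?S = "span_comp M pb G F" and ?T = "span_comp M pb G' F'"
  let ?h = "hcomp_rep M pb G G' F F'"
  obtain p q where pq: "pb (rleg F) (lleg G) = Span p q" by (cases "pb (rleg F) (lleg G)")
  obtain p' q' where pq': "pb (rleg F') (lleg G') = Span p' q'" by (cases "pb (rleg F') (lleg G')")
  have invariant: "two_class M ?S ?T (?h d c) = two_class M ?S ?T (?h d' c')"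
    if c: "c \<in> two_reps M F F'" and c': "c' \<in> two_reps M F F'" and d: "d \<in> two_reps M G G'"
        and d': "d' \<in> two_reps M G G'"
      and \<theta>: "\<theta> \<in> span_mor M c c'" and \<eta>: "\<eta> \<in> span_mor M d d'" for c c' d d' \<theta> \<eta>
  proof -
    note [simp] = two_rep_typing[OF c] two_rep_typing[OF c'] two_rep_typing[OF d] two_rep_typing[OF d']
    have [simp]: "\<theta> \<in> Ar M" "Dom M \<theta> = Dom M (lleg c)" "Cod M \<theta> = Dom M (lleg c')"
      "\<eta> \<in> Ar M" "Dom M \<eta> = Dom M (lleg d)" "Cod M \<eta> = Dom M (lleg d')"
      and t: "lleg c' \<cdot> \<theta> = lleg c" "rleg c' \<cdot> \<theta> = rleg c" "lleg d' \<cdot> \<eta> = lleg d" "rleg d' \<cdot> \<eta> = rleg d"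
      using \<theta> \<eta> by (auto simp: mem_span_mor)
    obtain u v m n where rep: "?h d c = Span m n"
      and [simp]: "u \<in> Ar M" "v \<in> Ar M" "Dom M v = Dom M u" "Cod M u = Dom M (lleg c)"
          "Cod M v = Dom M (lleg d)"
      "m \<in> Ar M" "Dom M m = Dom M u" "Cod M m = Dom M p" "n \<in> Ar M" "Dom M n = Dom M u" "Cod M n = Dom M p'"
      and mA: "m \<in> AFib"
      and m_eq: "p \<cdot> m = lleg c \<cdot> u" "q \<cdot> m = lleg d \<cdot> v" and n_eq: "p' \<cdot> n = rleg c \<cdot> u" "q' \<cdot> n = rleg d \<cdot> v"
      by (rule hcomp_rep_cases[OF F G c d pq pq'])
    show ?thesis unfolding rep
      by (rule two_class_hcomp_cone[OF F G c' d' pq pq', of "\<theta> \<cdot> u" "\<eta> \<cdot> v", symmetric])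
        (simp_all add: mA[simplified] m_eq n_eq reassoc[OF t(1)] reassoc[OF t(2)] reassoc[OF t(3)]
            reassoc[OF t(4)])
  qed
  have id: "Id M (apex M c) \<in> span_mor M c c" if "c \<in> two_reps M K L" for c K L
    using two_rep_typing[OF that] by (simp add: mem_span_mor)
  have indep: "two_eq M ?S ?T `` {?h d c} = two_eq M ?S ?T `` {?h b a}"
    if "(a, c) \<in> two_eq M F F'" "(b, d) \<in> two_eq M G G'" for c d
  proof -
    have "two_class M ?S ?T (?h b a) = two_class M ?S ?T (?h b c)"
      using that(1)
      by (rule two_eq_invariant[where g = "\<lambda>c. two_class M ?S ?T (?h b c)"])
        (auto simp: two_rel_def intro: invariant[OF _ _ b b _ id[OF b]])
    also have "\<dots> = two_class M ?S ?T (?h d c)"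
      using two_eq_in_reps[OF that(1)]
      by (intro two_eq_invariant[OF that(2), where g = "\<lambda>d. two_class M ?S ?T (?h d c)"])
        (auto simp: two_rel_def intro: invariant[OF _ _ _ _ id])
    finally show ?thesis by (simp add: two_class_inject)
  qed
  have "(\<Union>c\<in>two_eq M F F' `` {a}. \<Union>d\<in>two_eq M G G' `` {b}. two_eq M ?S ?T `` {?h d c})
      = two_eq M ?S ?T `` {?h b a}"
    by (intro UN_eq_const indep) (use two_eq_refl[OF a] two_eq_refl[OF b] in blast)+
  thus ?thesis by (simp add: hcomp_def Let_def) (simp add: two_class_def)
qed

section \<open>Strict two-cells\<close>

abbreviation vc (infixl "\<bullet>" 65) where "A' \<bullet> A \<equiv> vcomp M pb A' A"
abbreviation hc (infixl "\<star>" 75) where "B \<star> A \<equiv> hcomp M pb B A"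
abbreviation comp1 (infixl "\<odot>" 80) where "G \<odot> F \<equiv> span_comp M pb G F"
abbreviation hcat where "hcat x y \<equiv> span2_hom M pb x y"

text \<open>A morphism of spans \<open>m : F \<rightarrow> F'\<close> in \<open>M\<close>, regarded as a 2-cell with identity left leg. The
  associator, the unitors and the identity 2-cells are of this kind. Such cells compose vertically
  as the underlying morphisms do, and horizontally by the induced maps of pullbacks, so the
  coherence equations reduce to equations between arrows of \<open>M\<close>.\<close>

definition strict where "strict F F' m = two_class M F F' (Span (Id M (apex M F)) m)"

lemma strict_rep:
  assumes F: "F \<in> one_cells M x y" "F' \<in> one_cells M x y" and m: "m \<in> span_mor M F F'"
  shows "Span (Id M (apex M F)) m \<in> two_reps M F F'"
proof -
  note [simp] = one_cell_typing[OF F(1)] one_cell_typing[OF F(2)]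
  show ?thesis using m AFib_Id[of "Dom M (lleg F)"] by (simp add: mem_two_reps mem_span_mor)
qed

lemma Id_span_mor: "F \<in> one_cells M x y \<Longrightarrow> Id M (apex M F) \<in> span_mor M F F"
  by (simp add: mem_span_mor one_cell_typing)

lemma span_mor_comp:
  assumes F: "F \<in> one_cells M x y" "F' \<in> one_cells M x y" "F'' \<in> one_cells M x y"
    and m: "m \<in> span_mor M F F'" and m': "m' \<in> span_mor M F' F''"
  shows "m' \<cdot> m \<in> span_mor M F F''"
proof -
  note [simp] = one_cell_typing[OF F(1)] one_cell_typing[OF F(2)] one_cell_typing[OF F(3)]
  have *: "m \<in> Ar M" "m' \<in> Ar M" "Dom M m = apex M F" "Cod M m = apex M F'" "Dom M m' = apex M F'"
      "Cod M m' = apex M F''"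
    "lleg F' \<cdot> m = lleg F" "rleg F' \<cdot> m = rleg F" "lleg F'' \<cdot> m' = lleg F'" "rleg F'' \<cdot> m' = rleg F'"
    using m m' by (simp_all add: mem_span_mor)
  show ?thesis using * reassoc[OF *(9), of m] reassoc[OF *(10), of m] by (simp add: mem_span_mor)
qed

lemma strict_vcomp:
  assumes F: "F \<in> one_cells M x y" "F' \<in> one_cells M x y" "F'' \<in> one_cells M x y"
    and a: "a \<in> two_reps M F F'" and m: "m \<in> span_mor M F' F''"
  shows "strict F' F'' m \<bullet> two_class M F F' a = two_class M F F'' (Span (lleg a) (m \<cdot> rleg a))"
proof -
  note [simp] = one_cell_typing[OF F(1)] one_cell_typing[OF F(2)] one_cell_typing[OF F(3)] two_rep_typing[OF a]
  have [simp]: "m \<in> Ar M" "Dom M m = Dom M (lleg F')" "Cod M m = Dom M (lleg F'')" using m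
      by (simp_all add: mem_span_mor)
  note rep = strict_rep[OF F(2,3) m]
  show ?thesis unfolding strict_def vcomp_two_class[OF F a rep]
    using two_class_vcomp_cone[OF F a rep, of "Id M (Dom M (lleg a))" "rleg a"] two_rep_eqs(3)[OF a] by simp
qed

lemma strict_vcomp_strict:
  assumes F: "F \<in> one_cells M x y" "F' \<in> one_cells M x y" "F'' \<in> one_cells M x y"
    and m: "m \<in> span_mor M F F'" and m': "m' \<in> span_mor M F' F''"
  shows "strict F' F'' m' \<bullet> strict F F' m = strict F F'' (m' \<cdot> m)"
  unfolding strict_def[of F F'] using strict_vcomp[OF F strict_rep[OF F(1,2) m] m'] by (simp add: strict_def)

text \<open>If \<open>m\<close> is invertible, then its inverse is itself a morphism of spans of spans between the
  representative with left leg the inverse and right leg the identity and the one with right leg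
  \<open>m\<close>.\<close>

lemma strict_inverse:
  assumes F: "F \<in> one_cells M x y" "F' \<in> one_cells M x y"
    and m: "m \<in> span_mor M F F'" and inv: "inverses M m n"
  shows "n \<in> span_mor M F' F"
    and "strict F F' m = two_class M F F' (Span n (Id M (apex M F')))"
proof -
  note [simp] = one_cell_typing[OF F(1)] one_cell_typing[OF F(2)]
  have *: "m \<in> Ar M" "Dom M m = Dom M (lleg F)" "Cod M m = Dom M (lleg F')"
    "lleg F' \<cdot> m = lleg F" "rleg F' \<cdot> m = rleg F"
    "n \<in> Ar M" "Dom M n = Dom M (lleg F')" "Cod M n = Dom M (lleg F)"
    "n \<cdot> m = Id M (Dom M (lleg F))" "m \<cdot> n = Id M (Dom M (lleg F'))"
    using m inv by (auto simp: mem_span_mor inverses_iff)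
  note [simp] = *(1-3) *(6-8)
  have n: "lleg F \<cdot> n = lleg F'" "rleg F \<cdot> n = rleg F'"
    using reassoc[OF *(4), of n, symmetric] reassoc[OF *(5), of n, symmetric] by (simp_all add: *(10))
  thus "n \<in> span_mor M F' F" by (simp add: mem_span_mor)
  have "inverses M n m" using * by (simp add: inverses_iff)
  hence "n \<in> AFib" by (rule iso_AFib)
  hence "Span n (Id M (apex M F')) \<in> two_reps M F F'" by (simp add: mem_two_reps n)
  moreover have "n \<in> span_mor M (Span n (Id M (apex M F'))) (Span (Id M (apex M F)) m)"
    using * by (simp add: mem_span_mor apex_def)
  ultimately show "strict F F' m = two_class M F F' (Span n (Id M (apex M F')))"
    unfolding strict_def by (rule two_class_eqI[OF _ strict_rep[OF F m], symmetric])
qed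

text \<open>The chosen pullback \<open>f \<times> g\<close> of the source 1-cells, with its identity as left leg, is an
  admissible cone, because the left legs of both cells are identities.\<close>

lemma hcomp_strict:
  assumes F: "F \<in> one_cells M x y" "F' \<in> one_cells M x y" and G: "G \<in> one_cells M y z" "G' \<in> one_cells M y z"
    and m: "m \<in> span_mor M F F'" and n: "n \<in> span_mor M G G'"
    and pq: "pb (rleg F) (lleg G) = Span p q" and pq': "pb (rleg F') (lleg G') = Span p' q'"
  obtains k where "k \<in> Ar M" "Dom M k = Dom M p" "Cod M k = Dom M p'" "p' \<cdot> k = m \<cdot> p" "q' \<cdot> k = n \<cdot> q"
    "k \<in> span_mor M (G \<odot> F) (G' \<odot> F')" "strict G G' n \<star> strict F F' m = strict (G \<odot> F) (G' \<odot> F') k"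
proof -
  note [simp] = one_cell_typing[OF F(1)] one_cell_typing[OF F(2)] one_cell_typing[OF G(1)]
      one_cell_typing[OF G(2)]
  note P = span_comp_one_cells[OF F(1) G(1) pq] and P' = span_comp_one_cells[OF F(2) G(2) pq']
  note [simp] = pullback_typing(1-5)[OF P(1)] pullback_typing(1-5)[OF P'(1)] P(4) P'(4)
  have *: "m \<in> Ar M" "Dom M m = Dom M (lleg F)" "Cod M m = Dom M (lleg F')"
    "lleg F' \<cdot> m = lleg F" "rleg F' \<cdot> m = rleg F"
    "n \<in> Ar M" "Dom M n = Dom M (lleg G)" "Cod M n = Dom M (lleg G')"
    "lleg G' \<cdot> n = lleg G" "rleg G' \<cdot> n = rleg G"
    using m n by (auto simp: mem_span_mor)
  note [simp] = *(1-3) *(6-8)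
  have "rleg F' \<cdot> (m \<cdot> p) = lleg G' \<cdot> (n \<cdot> q)"
    using pullback_typing(6)[OF P(1)] by (simp add: reassoc[OF *(5)] reassoc[OF *(9)])
  then obtain k where [simp]: "k \<in> Ar M" "Dom M k = Dom M p" "Cod M k = Dom M p'"
    and k: "p' \<cdot> k = m \<cdot> p" "q' \<cdot> k = n \<cdot> q"
    using pullback_induced[OF P'(1), of "m \<cdot> p" "n \<cdot> q"] by auto
  have "k \<in> span_mor M (G \<odot> F) (G' \<odot> F')"
    by (simp add: mem_span_mor) (simp add: P(2) P'(2) k reassoc[OF *(4)] reassoc[OF *(10)])
  moreover have "strict G G' n \<star> strict F F' m = strict (G \<odot> F) (G' \<odot> F') k"
    unfolding strict_def hcomp_two_class[OF F G strict_rep[OF F m] strict_rep[OF G n]]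
    by (rule two_class_hcomp_cone[OF F G strict_rep[OF F m] strict_rep[OF G n] pq pq', of p q])
      (use AFib_Id[of "Dom M p"] in \<open>simp_all add: k\<close>)
  ultimately show thesis by (intro that[of k]) (simp_all add: k)
qed

lemma Id_strict: "two_class M F F (id_span M (apex M F)) = strict F F (Id M (apex M F))"
  by (simp add: strict_def id_span_def)

section \<open>The Hom categories\<close>

lemma mem_hom_hcat:
  "A \<in> hom (hcat x y) F F' \<longleftrightarrow> F \<in> one_cells M x y \<and> F' \<in> one_cells M x y \<and> (\<exists>a\<in>two_reps M F F'. A
      = two_class M F F' a)"
  by (auto simp: hom_def span2_hom_def)

lemma hcat_simps [simp]:
  "Ob (hcat x y) = one_cells M x y" "Comp (hcat x y) = vcomp M pb" "Dom (hcat x y) = src" "Cod (hcat x y) = tgt"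
  "cat.Id (hcat x y) F = strict F F (Id M (apex M F))"
  by (simp_all add: span2_hom_def Id_strict)

lemma strict_in_hom:
  "F \<in> one_cells M x y \<Longrightarrow> F' \<in> one_cells M x y \<Longrightarrow> m \<in> span_mor M F F' \<Longrightarrow> strict F F' m \<in> hom (hcat x y) F F'"
  unfolding mem_hom_hcat strict_def using strict_rep by blast

lemma vcomp_in_hom:
  assumes A: "A \<in> hom (hcat x y) F F'" and A': "A' \<in> hom (hcat x y) F' F''"
  shows "A' \<bullet> A \<in> hom (hcat x y) F F''"
proof -
  obtain a a' where a: "a \<in> two_reps M F F'" "A = two_class M F F' a"
      and a': "a' \<in> two_reps M F' F''" "A' = two_class M F' F'' a'"
    and F: "F \<in> one_cells M x y" "F' \<in> one_cells M x y" "F'' \<in> one_cells M x y"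
    using A A' unfolding mem_hom_hcat by blast
  have "span_comp M pb a' a \<in> two_reps M F F''"
    by (cases "pb (rleg a) (lleg a')") (simp add: span_comp_two_reps[OF F a(1) a'(1)])
  thus ?thesis unfolding mem_hom_hcat a(2) a'(2) vcomp_two_class[OF F a(1) a'(1)] using F by blast
qed

lemma vcomp_assoc:
  assumes A: "A \<in> hom (hcat x y) F F'" and B: "B \<in> hom (hcat x y) F' F''" and C: "C \<in> hom (hcat x y) F'' F'''"
  shows "C \<bullet> B \<bullet> A = C \<bullet> (B \<bullet> A)"
proof -
  obtain a b c where a: "a \<in> two_reps M F F'" "A = two_class M F F' a"
      and b: "b \<in> two_reps M F' F''" "B = two_class M F' F'' b"
    and c: "c \<in> two_reps M F'' F'''" "C = two_class M F'' F''' c"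
    and F: "F \<in> one_cells M x y" "F' \<in> one_cells M x y" "F'' \<in> one_cells M x y" "F''' \<in> one_cells M x y"
    using A B C unfolding mem_hom_hcat by blast
  note [simp] = one_cell_typing[OF F(1)] one_cell_typing[OF F(2)] one_cell_typing[OF F(3)]
      one_cell_typing[OF F(4)]
    two_rep_typing[OF a(1)] two_rep_typing[OF b(1)] two_rep_typing[OF c(1)]
  obtain p q where pq: "pb (rleg a) (lleg b) = Span p q" by (cases "pb (rleg a) (lleg b)")
  note ab = span_comp_two_reps[OF F(1-3) a(1) b(1) pq]
  note [simp] = pullback_typing(1-5)[OF ab(1)]
  obtain r s where rs: "pb (rleg b) (lleg c) = Span r s" by (cases "pb (rleg b) (lleg c)")
  note bc = span_comp_two_reps[OF F(2-4) b(1) c(1) rs]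
  note [simp] = pullback_typing(1-5)[OF bc(1)]
  let ?ab = "Span (lleg a \<cdot> p) (rleg b \<cdot> q)" and ?bc = "Span (lleg b \<cdot> r) (rleg c \<cdot> s)"
  obtain t u where tu: "pb (rleg ?ab) (lleg c) = Span t u" by (cases "pb (rleg ?ab) (lleg c)")
  note abc = span_comp_two_reps[OF F(1,3,4) ab(3) c(1) tu]
  note T [simp] = pullback_typing(1-5)[OF abc(1), simplified]
  \<comment> \<open>The apex of the iterated composite bracketed to the right carries a cone over the other bracketing.\<close>
  have "rleg b \<cdot> (q \<cdot> t) = lleg c \<cdot> u" using pullback_typing(6)[OF abc(1)] by simp
  then obtain h where [simp]: "h \<in> Ar M" "Dom M h = Dom M t" "Cod M h = Dom M r"
      and h: "r \<cdot> h = q \<cdot> t" "s \<cdot> h = u"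
    using pullback_induced[OF bc(1), of "q \<cdot> t" u] by auto
  have AF: "lleg a \<cdot> (p \<cdot> t) \<in> AFib" using abc(3) by (simp add: mem_two_reps)
  have "C \<bullet> (B \<bullet> A) = two_class M F F''' (Span (lleg a \<cdot> (p \<cdot> t)) (rleg c \<cdot> u))"
    using abc(2)
        by (simp add: a b c vcomp_two_class[OF F(1-3) a(1) b(1)] ab(2) vcomp_two_class[OF F(1,3,4) ab(3) c(1)])
  also have "\<dots> = two_class M F F''' (span_comp M pb ?bc a)"
    using two_class_vcomp_cone[OF F(1,2,4) a(1) bc(3), of "p \<cdot> t" h] AF
    by (simp add: h reassoc[OF h(1)] reassoc[OF pullback_typing(6)[OF ab(1)]])
  also have "\<dots> = C \<bullet> B \<bullet> A"
    by (simp add: a b c vcomp_two_class[OF F(2-4) b(1) c(1)] bc(2) vcomp_two_class[OF F(1,2,4) a(1) bc(3)])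
  finally show ?thesis by simp
qed

lemma vcomp_Id:
  assumes A: "A \<in> hom (hcat x y) F F'"
  shows "strict F' F' (Id M (apex M F')) \<bullet> A = A" "A \<bullet> strict F F (Id M (apex M F)) = A"
proof -
  obtain a where a: "a \<in> two_reps M F F'" "A = two_class M F F' a"
    and F: "F \<in> one_cells M x y" "F' \<in> one_cells M x y"
    using A unfolding mem_hom_hcat by blast
  note [simp] = one_cell_typing[OF F(1)] one_cell_typing[OF F(2)] two_rep_typing[OF a(1)]
  have [simp]: "Span (lleg a) (rleg a) = a" by (cases a) simp
  show "strict F' F' (Id M (apex M F')) \<bullet> A = A"
    using strict_vcomp[OF F(1,2,2) a(1) Id_span_mor[OF F(2)]] a(2) by simp
  note rep = strict_rep[OF F(1,1) Id_span_mor[OF F(1)]]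
  show "A \<bullet> strict F F (Id M (apex M F)) = A"
    using two_class_vcomp_cone[OF F(1,1,2) rep a(1), of "lleg a" "Id M (Dom M (lleg a))"]
        two_rep_eqs(3)[OF a(1)]
    by (simp add: strict_def a(2) vcomp_two_class[OF F(1,1,2) rep a(1), simplified])
qed

lemma category_hcat: "category (hcat x y)"
proof
  show "f \<in> Ar (hcat x y) \<Longrightarrow> Dom (hcat x y) f \<in> Ob (hcat x y)" for f by (auto simp: span2_hom_def)
  show "f \<in> Ar (hcat x y) \<Longrightarrow> Cod (hcat x y) f \<in> Ob (hcat x y)" for f by (auto simp: span2_hom_def)
qed (simp_all add: strict_in_hom Id_span_mor vcomp_in_hom vcomp_Id vcomp_assoc)

section \<open>Horizontal composition is functorial\<close>

lemma hcomp_in_hom: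
  assumes A: "A \<in> hom (hcat x y) F F'" and B: "B \<in> hom (hcat y z) G G'"
  shows "B \<star> A \<in> hom (hcat x z) (G \<odot> F) (G' \<odot> F')"
proof -
  obtain a b where a: "a \<in> two_reps M F F'" "A = two_class M F F' a"
      and b: "b \<in> two_reps M G G'" "B = two_class M G G' b"
    and F: "F \<in> one_cells M x y" "F' \<in> one_cells M x y" and G: "G \<in> one_cells M y z" "G' \<in> one_cells M y z"
    using A B unfolding mem_hom_hcat by blast
  obtain p q where pq: "pb (rleg F) (lleg G) = Span p q" by (cases "pb (rleg F) (lleg G)")
  obtain p' q' where pq': "pb (rleg F') (lleg G') = Span p' q'" by (cases "pb (rleg F') (lleg G')")
  have "hcomp_rep M pb G G' F F' b a \<in> two_reps M (G \<odot> F) (G' \<odot> F')"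
    by (rule hcomp_rep_cases[OF F G a(1) b(1) pq pq']) simp
  thus ?thesis
    unfolding mem_hom_hcat a(2) b(2) hcomp_two_class[OF F G a(1) b(1)]
    using span_comp_in_one_cells F G by blast
qed

lemma hcomp_Id:
  assumes F: "F \<in> one_cells M x y" and G: "G \<in> one_cells M y z"
  shows "strict G G (Id M (apex M G)) \<star> strict F F (Id M (apex M F))
      = strict (G \<odot> F) (G \<odot> F) (Id M (apex M (G \<odot> F)))"
proof -
  note [simp] = one_cell_typing[OF F] one_cell_typing[OF G]
  obtain p q where pq: "pb (rleg F) (lleg G) = Span p q" by (cases "pb (rleg F) (lleg G)")
  note P = span_comp_one_cells[OF F G pq]
  note [simp] = pullback_typing(1-5)[OF P(1)]
  obtain k where [simp]: "k \<in> Ar M" "Dom M k = Dom M p" "Cod M k = Dom M p"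
    and k: "p \<cdot> k = Id M (apex M F) \<cdot> p" "q \<cdot> k = Id M (apex M G) \<cdot> q"
    and eq: "strict G G (Id M (apex M G)) \<star> strict F F (Id M (apex M F)) = strict (G \<odot> F) (G \<odot> F) k"
    by (rule hcomp_strict[OF F F G G Id_span_mor[OF F] Id_span_mor[OF G] pq pq])
  have "k = Id M (Dom M p)"
    by (rule pullback_jointly_monic[OF P(1)]) (use k in simp_all)
  thus ?thesis using eq P(4) by simp
qed

text \<open>The apex of the composite on the left, with projections \<open>U\<close> and \<open>V\<close> to the vertical
  composites, carries maps \<open>h\<close> and \<open>h'\<close> to the apexes of the two horizontal composites on the right.
  They form a cone for their vertical composition, and the resulting span of spans is equal to the
  representative of the left side.\<close>

lemma interchange:
  assumes A: "A \<in> hom (hcat x y) F F'" and A': "A' \<in> hom (hcat x y) F' F''"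
    and B: "B \<in> hom (hcat y z) G G'" and B': "B' \<in> hom (hcat y z) G' G''"
  shows "(B' \<bullet> B) \<star> (A' \<bullet> A) = (B' \<star> A') \<bullet> (B \<star> A)"
proof -
  obtain a a' b b' where a: "a \<in> two_reps M F F'" "A = two_class M F F' a"
      and b: "b \<in> two_reps M G G'" "B = two_class M G G' b"
    and a': "a' \<in> two_reps M F' F''" "A' = two_class M F' F'' a'"
        and b': "b' \<in> two_reps M G' G''" "B' = two_class M G' G'' b'"
    and F: "F \<in> one_cells M x y" "F' \<in> one_cells M x y" "F'' \<in> one_cells M x y"
    and G: "G \<in> one_cells M y z" "G' \<in> one_cells M y z" "G'' \<in> one_cells M y z"
    using assms unfolding mem_hom_hcat by blast
  note [simp] = one_cell_typing[OF F(1)] one_cell_typing[OF F(2)] one_cell_typing[OF F(3)]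
    one_cell_typing[OF G(1)] one_cell_typing[OF G(2)] one_cell_typing[OF G(3)]
    two_rep_typing[OF a(1)] two_rep_typing[OF a'(1)] two_rep_typing[OF b(1)] two_rep_typing[OF b'(1)]
  obtain p q where pq: "pb (rleg F) (lleg G) = Span p q" by (cases "pb (rleg F) (lleg G)")
  obtain p' q' where pq': "pb (rleg F') (lleg G') = Span p' q'" by (cases "pb (rleg F') (lleg G')")
  obtain p'' q'' where pq'': "pb (rleg F'') (lleg G'') = Span p'' q''" by (cases "pb (rleg F'') (lleg G'')")
  note P = span_comp_one_cells[OF F(1) G(1) pq] and P' = span_comp_one_cells[OF F(2) G(2) pq']
    and P'' = span_comp_one_cells[OF F(3) G(3) pq'']
  note [simp] = pullback_typing(1-5)[OF P(1)] pullback_typing(1-5)[OF P'(1)] pullback_typing(1-5)[OF P''(1)]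
      P(4) P'(4) P''(4)
  obtain c c' where cc': "pb (rleg a) (lleg a') = Span c c'" by (cases "pb (rleg a) (lleg a')")
  obtain d d' where dd': "pb (rleg b) (lleg b') = Span d d'" by (cases "pb (rleg b) (lleg b')")
  note C = span_comp_two_reps[OF F a(1) a'(1) cc'] and D = span_comp_two_reps[OF G b(1) b'(1) dd']
  note [simp] = pullback_typing(1-5)[OF C(1)] pullback_typing(1-5)[OF D(1)]
  note C6 = pullback_typing(6)[OF C(1)] and D6 = pullback_typing(6)[OF D(1)]
  obtain u v m n where T: "is_pullback M (rleg F \<cdot> lleg a) (lleg G \<cdot> lleg b) (Span u v)"
    and rep: "hcomp_rep M pb G G' F F' b a = Span m n"
    and two_rep: "Span m n \<in> two_reps M (G \<odot> F) (G' \<odot> F')"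
    and [simp]: "u \<in> Ar M" "v \<in> Ar M" "Dom M v = Dom M u" "Cod M u = Dom M (lleg a)" "Cod M v = Dom M (lleg b)"
      "m \<in> Ar M" "Dom M m = Dom M u" "Cod M m = Dom M p" "n \<in> Ar M" "Dom M n = Dom M u" "Cod M n = Dom M p'"
    and m: "p \<cdot> m = lleg a \<cdot> u" "q \<cdot> m = lleg b \<cdot> v" and n: "p' \<cdot> n = rleg a \<cdot> u" "q' \<cdot> n = rleg b \<cdot> v"
    by (rule hcomp_rep_cases[OF F(1,2) G(1,2) a(1) b(1) pq pq'])
  obtain u' v' m' n' where T': "is_pullback M (rleg F' \<cdot> lleg a') (lleg G' \<cdot> lleg b') (Span u' v')"
    and rep': "hcomp_rep M pb G' G'' F' F'' b' a' = Span m' n'"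
    and two_rep': "Span m' n' \<in> two_reps M (G' \<odot> F') (G'' \<odot> F'')"
    and [simp]: "u' \<in> Ar M" "v' \<in> Ar M" "Dom M v' = Dom M u'" "Cod M u' = Dom M (lleg a')"
        "Cod M v' = Dom M (lleg b')"
      "m' \<in> Ar M" "Dom M m' = Dom M u'" "Cod M m' = Dom M p'" "n' \<in> Ar M" "Dom M n' = Dom M u'"
          "Cod M n' = Dom M p''"
    and m': "p' \<cdot> m' = lleg a' \<cdot> u'" "q' \<cdot> m' = lleg b' \<cdot> v'"
        and n': "p'' \<cdot> n' = rleg a' \<cdot> u'" "q'' \<cdot> n' = rleg b' \<cdot> v'"
    by (rule hcomp_rep_cases[OF F(2,3) G(2,3) a'(1) b'(1) pq' pq''])
  obtain U V m0 n0 where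
      T0: "is_pullback M (rleg F \<cdot> lleg (Span (lleg a \<cdot> c) (rleg a' \<cdot> c'))) (lleg G \<cdot> lleg (Span (lleg b \<cdot> d) (rleg b' \<cdot> d'))) (Span U V)"
    and rep0: "hcomp_rep M pb G G'' F F'' (Span (lleg b \<cdot> d) (rleg b' \<cdot> d')) (Span (lleg a \<cdot> c) (rleg a' \<cdot> c'))
        = Span m0 n0"
    and m0A: "m0 \<in> AFib"
    and ty0: "U \<in> Ar M" "V \<in> Ar M" "Dom M V = Dom M U"
        "Cod M U = Dom M (lleg (Span (lleg a \<cdot> c) (rleg a' \<cdot> c')))"
        "Cod M V = Dom M (lleg (Span (lleg b \<cdot> d) (rleg b' \<cdot> d')))"
      "m0 \<in> Ar M" "Dom M m0 = Dom M U" "Cod M m0 = Dom M p" "n0 \<in> Ar M" "Dom M n0 = Dom M U"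
          "Cod M n0 = Dom M p''"
    and mn0: "p \<cdot> m0 = lleg (Span (lleg a \<cdot> c) (rleg a' \<cdot> c')) \<cdot> U"
        "q \<cdot> m0 = lleg (Span (lleg b \<cdot> d) (rleg b' \<cdot> d')) \<cdot> V"
      "p'' \<cdot> n0 = rleg (Span (lleg a \<cdot> c) (rleg a' \<cdot> c')) \<cdot> U"
          "q'' \<cdot> n0 = rleg (Span (lleg b \<cdot> d) (rleg b' \<cdot> d')) \<cdot> V"
    by (rule hcomp_rep_cases[OF F(1,3) G(1,3) C(3) D(3) pq pq''])
  note [simp] = ty0[simplified]
  note mn0' = mn0[simplified]
  have e: "rleg F \<cdot> (lleg a \<cdot> (c \<cdot> U)) = lleg G \<cdot> (lleg b \<cdot> (d \<cdot> V))"
    using pullback_typing(6)[OF T0] by simp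
  then obtain h where [simp]: "h \<in> Ar M" "Dom M h = Dom M U" "Cod M h = Dom M u"
      and h: "u \<cdot> h = c \<cdot> U" "v \<cdot> h = d \<cdot> V"
    using pullback_induced[OF T, of "c \<cdot> U" "d \<cdot> V"] by auto
  have "rleg F' \<cdot> (lleg a' \<cdot> (c' \<cdot> U)) = lleg G' \<cdot> (lleg b' \<cdot> (d' \<cdot> V))"
    using e by (simp add: reassoc[OF two_rep_eqs(2)[OF a(1)]] reassoc[OF C6] reassoc[OF two_rep_eqs(1)[OF b(1)]]
        reassoc[OF D6])
  then obtain h' where [simp]: "h' \<in> Ar M" "Dom M h' = Dom M U" "Cod M h' = Dom M u'"
      and h': "u' \<cdot> h' = c' \<cdot> U" "v' \<cdot> h' = d' \<cdot> V"
    using pullback_induced[OF T', of "c' \<cdot> U" "d' \<cdot> V"] by auto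
  have 1: "n \<cdot> h = m' \<cdot> h'"
    by (rule pullback_jointly_monic[OF P'(1)])
      (simp_all add: reassoc[OF n(1)] reassoc[OF n(2)] reassoc[OF m'(1)] reassoc[OF m'(2)] h h' reassoc[OF C6]
          reassoc[OF D6])
  have 2: "m \<cdot> h = m0"
    by (rule pullback_jointly_monic[OF P(1)])
      (simp_all add: reassoc[OF m(1)] reassoc[OF m(2)] h mn0')
  have 3: "n' \<cdot> h' = n0"
    by (rule pullback_jointly_monic[OF P''(1)])
      (simp_all add: reassoc[OF n'(1)] reassoc[OF n'(2)] h' mn0')
  note O = span_comp_in_one_cells[OF F(1) G(1)] span_comp_in_one_cells[OF F(2) G(2)]
      span_comp_in_one_cells[OF F(3) G(3)]
  have "(B' \<bullet> B) \<star> (A' \<bullet> A) = two_class M (G \<odot> F) (G'' \<odot> F'') (Span m0 n0)"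
    by (simp add: a(2) a'(2) b(2) b'(2) vcomp_two_class[OF F a(1) a'(1)] vcomp_two_class[OF G b(1) b'(1)] C(2) D(2)
        hcomp_two_class[OF F(1,3) G(1,3) C(3) D(3)] rep0)
  also have "\<dots> = two_class M (G \<odot> F) (G'' \<odot> F'') (span_comp M pb (Span m' n') (Span m n))"
    using two_class_vcomp_cone[OF O two_rep two_rep', of h h'] m0A by (simp add: 1 2 3)
  also have "\<dots> = (B' \<star> A') \<bullet> (B \<star> A)"
    by (simp add: a(2) a'(2) b(2) b'(2) hcomp_two_class[OF F(1,2) G(1,2) a(1) b(1)]
        hcomp_two_class[OF F(2,3) G(2,3) a'(1) b'(1)] rep rep' vcomp_two_class[OF O two_rep two_rep'])
  finally show ?thesis .
qed

section \<open>The associator\<close>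

text \<open>The definition of the canonical map, with its two outer pullbacks written as pullbacks of the
  legs of composite 1-cells. In this form a composite 1-cell can be treated as an arbitrary one, and
  the associators of the pentagon become instances of a single description.\<close>

lemma assoc_map_induced:
  "assoc_map M pb F G H = induced M (Span (induced M
      (Span (lleg (pb (rleg F) (lleg (H \<odot> G))))
         (lleg (pb (rleg G) (lleg H)) \<cdot> rleg (pb (rleg F) (lleg (H \<odot> G))))) (pb (rleg F) (lleg G)))
      (rleg (pb (rleg G) (lleg H)) \<cdot> rleg (pb (rleg F) (lleg (H \<odot> G))))) (pb (rleg (G \<odot> F)) (lleg H))"
  by (simp add: assoc_map_def span_comp_def Let_def)

text \<open>The canonical map \<open>f \<times> (g \<times> h) \<rightarrow> (f \<times> g) \<times> h\<close> through its components, where \<open>p, q\<close> are the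
  projections of \<open>f \<times> g\<close>, \<open>r, s\<close> those of \<open>g \<times> h\<close>, \<open>t, t'\<close> those of \<open>f \<times> (g \<times> h)\<close> and \<open>k, k'\<close> those
  of \<open>(f \<times> g) \<times> h\<close>.\<close>

lemma assoc_map_properties:
  assumes F: "F \<in> one_cells M w x" and G: "G \<in> one_cells M x y" and H: "H \<in> one_cells M y z"
    and pq: "pb (rleg F) (lleg G) = Span p q" and rs: "pb (rleg G) (lleg H) = Span r s"
    and tt: "pb (rleg F) (lleg (H \<odot> G)) = Span t t'" and kk: "pb (rleg (G \<odot> F)) (lleg H) = Span k k'"
  defines "\<alpha> \<equiv> assoc_map M pb F G H"
  shows "\<alpha> \<in> Ar M" "Dom M \<alpha> = Dom M t" "Cod M \<alpha> = Dom M k"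
    "p \<cdot> (k \<cdot> \<alpha>) = t" "q \<cdot> (k \<cdot> \<alpha>) = r \<cdot> t'" "k' \<cdot> \<alpha> = s \<cdot> t'"
    "\<alpha> \<in> span_mor M ((H \<odot> G) \<odot> F) (H \<odot> (G \<odot> F))" "\<exists>\<beta>. inverses M \<alpha> \<beta>"
proof -
  note P = span_comp_one_cells[OF F G pq] and R = span_comp_one_cells[OF G H rs]
  have GF: "G \<odot> F \<in> one_cells M w y" and HG: "H \<odot> G \<in> one_cells M x z"
    using span_comp_in_one_cells F G H by auto
  note T = span_comp_one_cells[OF F HG tt] and K = span_comp_one_cells[OF GF H kk]
  note [simp] = one_cell_typing[OF F] one_cell_typing[OF G] one_cell_typing[OF H]
    one_cell_typing(1-5,7-8)[OF GF] one_cell_typing(1-5,7-8)[OF HG]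
  have [simp]: "Dom M (lleg (G \<odot> F)) = Dom M p" "Dom M (lleg (H \<odot> G)) = Dom M r"
    using P(4) R(4) one_cell_typing(6)[OF GF] one_cell_typing(6)[OF HG] by auto
  note [simp] = pullback_typing(1-5)[OF P(1)] pullback_typing(1-5)[OF R(1)]
    pullback_typing(1-5)[OF T(1)] pullback_typing(1-5)[OF K(1)] P(4) R(4) T(4) K(4)
  have P6: "rleg F \<cdot> p = lleg G \<cdot> q" and R6: "rleg G \<cdot> r = lleg H \<cdot> s"
    and T6: "rleg F \<cdot> t = lleg G \<cdot> (r \<cdot> t')" and K6: "rleg G \<cdot> (q \<cdot> k) = lleg H \<cdot> k'"
    using pullback_typing(6)[OF P(1)] pullback_typing(6)[OF R(1)] pullback_typing(6)[OF T(1)]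
        pullback_typing(6)[OF K(1)]
    by (simp_all add: P(2) R(2))
  obtain e where e_def: "e = induced M (Span t (r \<cdot> t')) (Span p q)"
    and [simp]: "e \<in> Ar M" "Dom M e = Dom M t" "Cod M e = Dom M p" and e: "p \<cdot> e = t" "q \<cdot> e = r \<cdot> t'"
    by (rule pullback_induced[OF P(1), of t "r \<cdot> t'"]) (simp_all add: T6)
  have "rleg (G \<odot> F) \<cdot> e = lleg H \<cdot> (s \<cdot> t')"
    by (simp add: P(2) e reassoc[OF R6])
  then obtain a where a_def: "a = induced M (Span e (s \<cdot> t')) (Span k k')"
    and [simp]: "a \<in> Ar M" "Dom M a = Dom M t" "Cod M a = Dom M k" and a: "k \<cdot> a = e" "k' \<cdot> a = s \<cdot> t'"
    using pullback_induced[OF K(1), of e "s \<cdot> t'"] by auto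
  have \<alpha>: "\<alpha> = a"
    by (simp add: \<alpha>_def assoc_map_induced pq rs tt kk a_def e_def)
  show "\<alpha> \<in> Ar M" "Dom M \<alpha> = Dom M t" "Cod M \<alpha> = Dom M k"
    "p \<cdot> (k \<cdot> \<alpha>) = t" "q \<cdot> (k \<cdot> \<alpha>) = r \<cdot> t'" "k' \<cdot> \<alpha> = s \<cdot> t'"
    by (simp_all add: \<alpha> a e)
  show "\<alpha> \<in> span_mor M ((H \<odot> G) \<odot> F) (H \<odot> (G \<odot> F))"
    by (simp add: mem_span_mor \<alpha>, simp only: T(2) K(2), simp add: P(2) R(2) a e)
  \<comment> \<open>The inverse is induced twice in the same way, starting from the other bracketing.\<close>
  obtain c where [simp]: "c \<in> Ar M" "Dom M c = Dom M k" "Cod M c = Dom M r" and c: "r \<cdot> c = q \<cdot> k" "s \<cdot> c = k'"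
    by (rule pullback_induced[OF R(1), of "q \<cdot> k" k']) (simp_all add: K6)
  have "rleg F \<cdot> (p \<cdot> k) = lleg (H \<odot> G) \<cdot> c"
    by (simp add: R(2) c reassoc[OF P6])
  then obtain b where [simp]: "b \<in> Ar M" "Dom M b = Dom M k" "Cod M b = Dom M t"
      and b: "t \<cdot> b = p \<cdot> k" "t' \<cdot> b = c"
    using pullback_induced[OF T(1), of "p \<cdot> k" c] by auto
  have t'ba: "t' \<cdot> (b \<cdot> a) = t'"
    by (rule pullback_jointly_monic[OF R(1)])
      (simp_all add: reassoc[OF b(2)] reassoc[OF c(1)] reassoc[OF c(2)] a e)
  have ba: "b \<cdot> a = Id M (Dom M t)"
    by (rule pullback_jointly_monic[OF T(1)]) (simp_all add: t'ba reassoc[OF b(1)] a e)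
  have kab: "k \<cdot> (a \<cdot> b) = k"
    by (rule pullback_jointly_monic[OF P(1)])
      (simp_all add: reassoc[OF a(1)] reassoc[OF e(1)] reassoc[OF e(2)] b c)
  have ab: "a \<cdot> b = Id M (Dom M k)"
    by (rule pullback_jointly_monic[OF K(1)]) (simp_all add: kab reassoc[OF a(2)] b c)
  have "inverses M \<alpha> b" by (simp add: inverses_iff \<alpha> ba ab)
  thus "\<exists>\<beta>. inverses M \<alpha> \<beta>" by blast
qed

lemma iterated_pullback_jointly_monic:
  assumes F: "F \<in> one_cells M w x" and G: "G \<in> one_cells M x y" and H: "H \<in> one_cells M y z"
    and pq: "pb (rleg F) (lleg G) = Span p q" and kk: "pb (rleg (G \<odot> F)) (lleg H) = Span k k'"
    and f: "f \<in> Ar M" "Cod M f = Dom M k" and g: "g \<in> Ar M" "Cod M g = Dom M k" "Dom M g = Dom M f"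
    and eq: "p \<cdot> (k \<cdot> f) = p \<cdot> (k \<cdot> g)" "q \<cdot> (k \<cdot> f) = q \<cdot> (k \<cdot> g)" "k' \<cdot> f = k' \<cdot> g"
  shows "f = g"
proof -
  note P = span_comp_one_cells[OF F G pq]
  have GF: "G \<odot> F \<in> one_cells M w y" using span_comp_in_one_cells F G by auto
  note K = span_comp_one_cells[OF GF H kk]
  note [simp] = one_cell_typing[OF F] one_cell_typing[OF G] one_cell_typing[OF H]
      one_cell_typing(1-5,7-8)[OF GF]
  have [simp]: "Dom M (lleg (G \<odot> F)) = Dom M p"
    using P(4) one_cell_typing(6)[OF GF] by auto
  note [simp] = pullback_typing(1-5)[OF P(1)] pullback_typing(1-5)[OF K(1)] f g
  have kf: "k \<cdot> f = k \<cdot> g" by (rule pullback_jointly_monic[OF P(1)]) (simp_all add: eq)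
  show ?thesis by (rule pullback_jointly_monic[OF K(1)]) (simp_all add: eq kf)
qed

abbreviation "assoc_cell F G H \<equiv> strict ((H \<odot> G) \<odot> F) (H \<odot> (G \<odot> F)) (assoc_map M pb F G H)"

lemma assoc_map_iso:
  assumes F: "F \<in> one_cells M w x" and G: "G \<in> one_cells M x y" and H: "H \<in> one_cells M y z"
  shows "assoc_map M pb F G H \<in> span_mor M ((H \<odot> G) \<odot> F) (H \<odot> (G \<odot> F))"
      "\<exists>\<beta>. inverses M (assoc_map M pb F G H) \<beta>"
proof -
  obtain p q where 1: "pb (rleg F) (lleg G) = Span p q" by (cases "pb (rleg F) (lleg G)")
  obtain r s where 2: "pb (rleg G) (lleg H) = Span r s" by (cases "pb (rleg G) (lleg H)")
  obtain t t' where 3: "pb (rleg F) (lleg (H \<odot> G)) = Span t t'" by (cases "pb (rleg F) (lleg (H \<odot> G))")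
  obtain k k' where 4: "pb (rleg (G \<odot> F)) (lleg H) = Span k k'" by (cases "pb (rleg (G \<odot> F)) (lleg H)")
  show "assoc_map M pb F G H \<in> span_mor M ((H \<odot> G) \<odot> F) (H \<odot> (G \<odot> F))" "\<exists>\<beta>. inverses M (assoc_map M pb F G H) \<beta>"
    using assoc_map_properties[OF F G H 1 2 3 4] by auto
qed

text \<open>The apex \<open>\<alpha> \<times> (\<beta> \<times> \<gamma>)\<close> of the right side maps by \<open>m2\<close> to the source of the associator and by
  the canonical rebracketing \<open>h\<close> to the apex \<open>(\<alpha> \<times> \<beta>) \<times> \<gamma>\<close> on the left side. This is a cone for the
  vertical composite on the left, and both sides are represented by the same span of spans.\<close>

lemma assoc_natural:
  assumes A: "A \<in> hom (hcat w x) F F'" and B: "B \<in> hom (hcat x y) G G'" and C: "C \<in> hom (hcat y z) H H'"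
  shows "(C \<star> (B \<star> A)) \<bullet> assoc_cell F G H = assoc_cell F' G' H' \<bullet> (C \<star> B \<star> A)"
proof -
  obtain a b c where a: "a \<in> two_reps M F F'" "A = two_class M F F' a"
      and b: "b \<in> two_reps M G G'" "B = two_class M G G' b"
    and c: "c \<in> two_reps M H H'" "C = two_class M H H' c"
    and F: "F \<in> one_cells M w x" "F' \<in> one_cells M w x" and G: "G \<in> one_cells M x y" "G' \<in> one_cells M x y"
    and H: "H \<in> one_cells M y z" "H' \<in> one_cells M y z"
    using A B C unfolding mem_hom_hcat by blast
  note GF = span_comp_in_one_cells[OF F(1) G(1)] span_comp_in_one_cells[OF F(2) G(2)]
  note HG = span_comp_in_one_cells[OF G(1) H(1)] span_comp_in_one_cells[OF G(2) H(2)]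
  note HG_F = span_comp_in_one_cells[OF F(1) HG(1)] span_comp_in_one_cells[OF F(2) HG(2)]
  note H_GF = span_comp_in_one_cells[OF GF(1) H(1)] span_comp_in_one_cells[OF GF(2) H(2)]
  obtain p q where pq: "pb (rleg F) (lleg G) = Span p q" by (cases "pb (rleg F) (lleg G)")
  obtain r s where rs: "pb (rleg G) (lleg H) = Span r s" by (cases "pb (rleg G) (lleg H)")
  obtain t l where tl: "pb (rleg F) (lleg (H \<odot> G)) = Span t l" by (cases "pb (rleg F) (lleg (H \<odot> G))")
  obtain k j where kj: "pb (rleg (G \<odot> F)) (lleg H) = Span k j" by (cases "pb (rleg (G \<odot> F)) (lleg H)")
  obtain p' q' where pq': "pb (rleg F') (lleg G') = Span p' q'" by (cases "pb (rleg F') (lleg G')")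
  obtain r' s' where rs': "pb (rleg G') (lleg H') = Span r' s'" by (cases "pb (rleg G') (lleg H')")
  obtain t' l' where tl': "pb (rleg F') (lleg (H' \<odot> G')) = Span t' l'"
      by (cases "pb (rleg F') (lleg (H' \<odot> G'))")
  obtain k' j' where kj': "pb (rleg (G' \<odot> F')) (lleg H') = Span k' j'"
      by (cases "pb (rleg (G' \<odot> F')) (lleg H')")
  note P = span_comp_one_cells[OF F(1) G(1) pq] span_comp_one_cells[OF F(2) G(2) pq']
    span_comp_one_cells[OF G(1) H(1) rs] span_comp_one_cells[OF G(2) H(2) rs']
    span_comp_one_cells[OF F(1) HG(1) tl] span_comp_one_cells[OF F(2) HG(2) tl']
    span_comp_one_cells[OF GF(1) H(1) kj] span_comp_one_cells[OF GF(2) H(2) kj']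
  note [simp] = one_cell_typing[OF F(1)] one_cell_typing[OF F(2)] one_cell_typing[OF G(1)]
      one_cell_typing[OF G(2)]
    one_cell_typing[OF H(1)] one_cell_typing[OF H(2)]
    one_cell_typing(1-5)[OF GF(1)] one_cell_typing(1-5)[OF GF(2)] one_cell_typing(1-5)[OF HG(1)]
        one_cell_typing(1-5)[OF HG(2)]
    two_rep_typing[OF a(1)] two_rep_typing[OF b(1)] two_rep_typing[OF c(1)]
  note apices [simp] = P(4,8,12,16,20,24,28,32)
  have [simp]: "Dom M (lleg (G \<odot> F)) = Dom M p" "Dom M (lleg (G' \<odot> F')) = Dom M p'"
    "Dom M (lleg (H \<odot> G)) = Dom M r" "Dom M (lleg (H' \<odot> G')) = Dom M r'"
    using apices(1-4) one_cell_typing(6)[OF GF(1)] one_cell_typing(6)[OF GF(2)] one_cell_typing(6)[OF HG(1)]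
        one_cell_typing(6)[OF HG(2)]
    by auto
  note [simp] = pullback_typing(1-5)[OF P(1)] pullback_typing(1-5)[OF P(5)] pullback_typing(1-5)[OF P(9)]
      pullback_typing(1-5)[OF P(13)]
    pullback_typing(1-5)[OF P(17)] pullback_typing(1-5)[OF P(21)] pullback_typing(1-5)[OF P(25)]
        pullback_typing(1-5)[OF P(29)]
  note \<alpha> = assoc_map_properties[OF F(1) G(1) H(1) pq rs tl kj]
      and \<alpha>' = assoc_map_properties[OF F(2) G(2) H(2) pq' rs' tl' kj']
  let ?\<alpha> = "assoc_map M pb F G H" and ?\<alpha>' = "assoc_map M pb F' G' H'"
  note [simp] = \<alpha>(1-3) \<alpha>'(1-3)
  obtain u1 v1 m1 n1 where T1: "is_pullback M (rleg G \<cdot> lleg b) (lleg H \<cdot> lleg c) (Span u1 v1)"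
    and rep1: "hcomp_rep M pb H H' G G' c b = Span m1 n1"
    and two_rep1: "Span m1 n1 \<in> two_reps M (H \<odot> G) (H' \<odot> G')"
    and [simp]: "u1 \<in> Ar M" "v1 \<in> Ar M" "Dom M v1 = Dom M u1" "Cod M u1 = Dom M (lleg b)"
        "Cod M v1 = Dom M (lleg c)"
      "m1 \<in> Ar M" "Dom M m1 = Dom M u1" "Cod M m1 = Dom M r" "n1 \<in> Ar M" "Dom M n1 = Dom M u1"
          "Cod M n1 = Dom M r'"
    and m1: "r \<cdot> m1 = lleg b \<cdot> u1" "s \<cdot> m1 = lleg c \<cdot> v1"
        and n1: "r' \<cdot> n1 = rleg b \<cdot> u1" "s' \<cdot> n1 = rleg c \<cdot> v1"
    by (rule hcomp_rep_cases[OF G H b(1) c(1) rs rs'])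
  obtain u2 v2 m2 n2 where T2: "is_pullback M (rleg F \<cdot> lleg a) (lleg (H \<odot> G) \<cdot> lleg (Span m1 n1)) (Span u2 v2)"
    and rep2: "hcomp_rep M pb (H \<odot> G) (H' \<odot> G') F F' (Span m1 n1) a = Span m2 n2"
    and two_rep2: "Span m2 n2 \<in> two_reps M ((H \<odot> G) \<odot> F) ((H' \<odot> G') \<odot> F')"
    and m2A: "m2 \<in> AFib"
    and [simp]: "u2 \<in> Ar M" "v2 \<in> Ar M" "Dom M v2 = Dom M u2" "Cod M u2 = Dom M (lleg a)"
      "m2 \<in> Ar M" "Dom M m2 = Dom M u2" "Cod M m2 = Dom M t" "n2 \<in> Ar M" "Dom M n2 = Dom M u2"
          "Cod M n2 = Dom M t'"
    and "Cod M v2 = Dom M (lleg (Span m1 n1))"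
    and m2: "t \<cdot> m2 = lleg a \<cdot> u2" and "l \<cdot> m2 = lleg (Span m1 n1) \<cdot> v2"
    and n2: "t' \<cdot> n2 = rleg a \<cdot> u2" and "l' \<cdot> n2 = rleg (Span m1 n1) \<cdot> v2"
    by (rule hcomp_rep_cases[OF F HG a(1) two_rep1 tl tl'])
  hence [simp]: "Cod M v2 = Dom M u1" and m2': "l \<cdot> m2 = m1 \<cdot> v2" and n2': "l' \<cdot> n2 = n1 \<cdot> v2" by simp_all
  obtain u3 v3 m3 n3 where T3: "is_pullback M (rleg F \<cdot> lleg a) (lleg G \<cdot> lleg b) (Span u3 v3)"
    and rep3: "hcomp_rep M pb G G' F F' b a = Span m3 n3"
    and two_rep3: "Span m3 n3 \<in> two_reps M (G \<odot> F) (G' \<odot> F')"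
    and [simp]: "u3 \<in> Ar M" "v3 \<in> Ar M" "Dom M v3 = Dom M u3" "Cod M u3 = Dom M (lleg a)"
        "Cod M v3 = Dom M (lleg b)"
      "m3 \<in> Ar M" "Dom M m3 = Dom M u3" "Cod M m3 = Dom M p" "n3 \<in> Ar M" "Dom M n3 = Dom M u3"
          "Cod M n3 = Dom M p'"
    and m3: "p \<cdot> m3 = lleg a \<cdot> u3" "q \<cdot> m3 = lleg b \<cdot> v3"
        and n3: "p' \<cdot> n3 = rleg a \<cdot> u3" "q' \<cdot> n3 = rleg b \<cdot> v3"
    by (rule hcomp_rep_cases[OF F G a(1) b(1) pq pq'])
  obtain u4 v4 m4 n4 where T4: "is_pullback M (rleg (G \<odot> F) \<cdot> lleg (Span m3 n3)) (lleg H \<cdot> lleg c) (Span u4 v4)"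
    and rep4: "hcomp_rep M pb H H' (G \<odot> F) (G' \<odot> F') c (Span m3 n3) = Span m4 n4"
    and two_rep4: "Span m4 n4 \<in> two_reps M (H \<odot> (G \<odot> F)) (H' \<odot> (G' \<odot> F'))"
    and [simp]: "u4 \<in> Ar M" "v4 \<in> Ar M" "Dom M v4 = Dom M u4" "Cod M v4 = Dom M (lleg c)"
      "m4 \<in> Ar M" "Dom M m4 = Dom M u4" "Cod M m4 = Dom M k" "n4 \<in> Ar M" "Dom M n4 = Dom M u4"
          "Cod M n4 = Dom M k'"
    and "Cod M u4 = Dom M (lleg (Span m3 n3))"
    and "k \<cdot> m4 = lleg (Span m3 n3) \<cdot> u4" and m4: "j \<cdot> m4 = lleg c \<cdot> v4"
    and "k' \<cdot> n4 = rleg (Span m3 n3) \<cdot> u4" and n4: "j' \<cdot> n4 = rleg c \<cdot> v4"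
    by (rule hcomp_rep_cases[OF GF H two_rep3 c(1) kj kj'])
  hence [simp]: "Cod M u4 = Dom M u3" and m4': "k \<cdot> m4 = m3 \<cdot> u4" and n4': "k' \<cdot> n4 = n3 \<cdot> u4" by simp_all
  \<comment> \<open>The rebracketing \<open>\<alpha> \<times> (\<beta> \<times> \<gamma>) \<rightarrow> (\<alpha> \<times> \<beta>) \<times> \<gamma>\<close>, induced in two stages by \<open>e\<close> and \<open>h\<close>.\<close>
  have T1_6: "rleg G \<cdot> (lleg b \<cdot> u1) = lleg H \<cdot> (lleg c \<cdot> v1)" using pullback_typing(6)[OF T1] by simp
  have "rleg F \<cdot> (lleg a \<cdot> u2) = lleg G \<cdot> (lleg b \<cdot> (u1 \<cdot> v2))"
    using pullback_typing(6)[OF T2] by (simp add: P(10) reassoc[OF m1(1)])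
  then obtain e where [simp]: "e \<in> Ar M" "Dom M e = Dom M u2" "Cod M e = Dom M u3"
      and e: "u3 \<cdot> e = u2" "v3 \<cdot> e = u1 \<cdot> v2"
    using pullback_induced[OF T3, of u2 "u1 \<cdot> v2"] by auto
  have "rleg (G \<odot> F) \<cdot> (m3 \<cdot> e) = lleg H \<cdot> (lleg c \<cdot> (v1 \<cdot> v2))"
    by (simp add: P(2) reassoc[OF m3(2)] e reassoc3[OF T1_6])
  then obtain h where [simp]: "h \<in> Ar M" "Dom M h = Dom M u2" "Cod M h = Dom M u4"
      and h: "u4 \<cdot> h = e" "v4 \<cdot> h = v1 \<cdot> v2"
    using pullback_induced[OF T4, of e "v1 \<cdot> v2"] by auto
  have 1: "?\<alpha> \<cdot> m2 = m4 \<cdot> h"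
    by (rule iterated_pullback_jointly_monic[OF F(1) G(1) H(1) pq kj])
      (simp_all add: reassoc3[OF \<alpha>(4)] reassoc3[OF \<alpha>(5)] reassoc[OF \<alpha>(6)] m2 m2' reassoc[OF m1(1)]
          reassoc[OF m1(2)]
        reassoc[OF m4] reassoc[OF m4'] h reassoc[OF m3(1)] reassoc[OF m3(2)] e)
  have 2: "n4 \<cdot> h = ?\<alpha>' \<cdot> n2"
    by (rule iterated_pullback_jointly_monic[OF F(2) G(2) H(2) pq' kj'])
      (simp_all add: reassoc3[OF \<alpha>'(4)] reassoc3[OF \<alpha>'(5)] reassoc[OF \<alpha>'(6)] n2 n2' reassoc[OF n1(1)]
          reassoc[OF n1(2)]
        reassoc[OF n4] reassoc[OF n4'] h reassoc[OF n3(1)] reassoc[OF n3(2)] e)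
  note rep\<alpha> = strict_rep[OF HG_F(1) H_GF(1) \<alpha>(7)]
  have "(C \<star> (B \<star> A)) \<bullet> assoc_cell F G H
    = two_class M ((H \<odot> G) \<odot> F) (H' \<odot> (G' \<odot> F'))
        (span_comp M pb (Span m4 n4) (Span (Id M (apex M ((H \<odot> G) \<odot> F))) ?\<alpha>))"
    unfolding a(2) b(2) c(2) hcomp_two_class[OF F G a(1) b(1)] rep3 hcomp_two_class[OF GF H two_rep3 c(1)] rep4
        strict_def
    by (rule vcomp_two_class[OF HG_F(1) H_GF rep\<alpha> two_rep4])
  also have "\<dots> = two_class M ((H \<odot> G) \<odot> F) (H' \<odot> (G' \<odot> F')) (Span m2 (?\<alpha>' \<cdot> n2))"
    using two_class_vcomp_cone[OF HG_F(1) H_GF rep\<alpha> two_rep4, of m2 h] m2A by (simp add: 1 2)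
  also have "\<dots> = assoc_cell F' G' H' \<bullet> (C \<star> B \<star> A)"
    unfolding a(2) b(2) c(2) hcomp_two_class[OF G H b(1) c(1)] rep1 hcomp_two_class[OF F HG a(1) two_rep1] rep2
    using strict_vcomp[OF HG_F H_GF(2) two_rep2 \<alpha>'(7)] by simp
  finally show ?thesis .
qed

text \<open>All five cells come from morphisms of spans, so both sides are given by maps into the pullback
  \<open>((f \<times> g) \<times> h) \<times> k\<close>. They agree because they have the same components in \<open>f\<close>, \<open>g\<close>, \<open>h\<close> and \<open>k\<close>.\<close>

lemma pentagon_cells:
  assumes F: "F \<in> one_cells M v w" and G: "G \<in> one_cells M w x" and H: "H \<in> one_cells M x y"
      and K: "K \<in> one_cells M y z"
  shows "assoc_cell (G \<odot> F) H K \<bullet> assoc_cell F G (K \<odot> H)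
    = (strict K K (Id M (apex M K)) \<star> assoc_cell F G H) \<bullet> assoc_cell F (H \<odot> G) K \<bullet>
        (assoc_cell G H K \<star> strict F F (Id M (apex M F)))"
proof -
  note GF = span_comp_in_one_cells[OF F G] and HG = span_comp_in_one_cells[OF G H]
      and KH = span_comp_in_one_cells[OF H K]
  note HG_F = span_comp_in_one_cells[OF F HG] and H_GF = span_comp_in_one_cells[OF GF H]
    and KH_G = span_comp_in_one_cells[OF G KH] and K_HG = span_comp_in_one_cells[OF HG K]
  note KHG_F = span_comp_in_one_cells[OF F KH_G] and KH_GF = span_comp_in_one_cells[OF GF KH]
    and K_H_GF = span_comp_in_one_cells[OF H_GF K] and K_HGF = span_comp_in_one_cells[OF HG_F K]
    and K_HG_F = span_comp_in_one_cells[OF F K_HG]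
  obtain p1 q1 where e1: "pb (rleg F) (lleg G) = Span p1 q1" by (cases "pb (rleg F) (lleg G)")
  obtain p2 q2 where e2: "pb (rleg G) (lleg H) = Span p2 q2" by (cases "pb (rleg G) (lleg H)")
  obtain p3 q3 where e3: "pb (rleg H) (lleg K) = Span p3 q3" by (cases "pb (rleg H) (lleg K)")
  obtain p4 q4 where e4: "pb (rleg F) (lleg (H \<odot> G)) = Span p4 q4" by (cases "pb (rleg F) (lleg (H \<odot> G))")
  obtain p5 q5 where e5: "pb (rleg (G \<odot> F)) (lleg H) = Span p5 q5" by (cases "pb (rleg (G \<odot> F)) (lleg H)")
  obtain p6 q6 where e6: "pb (rleg G) (lleg (K \<odot> H)) = Span p6 q6" by (cases "pb (rleg G) (lleg (K \<odot> H))")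
  obtain p7 q7 where e7: "pb (rleg (H \<odot> G)) (lleg K) = Span p7 q7" by (cases "pb (rleg (H \<odot> G)) (lleg K)")
  obtain p8 q8 where e8: "pb (rleg F) (lleg ((K \<odot> H) \<odot> G)) = Span p8 q8"
      by (cases "pb (rleg F) (lleg ((K \<odot> H) \<odot> G))")
  obtain p9 q9 where e9: "pb (rleg (G \<odot> F)) (lleg (K \<odot> H)) = Span p9 q9"
      by (cases "pb (rleg (G \<odot> F)) (lleg (K \<odot> H))")
  obtain p10 q10 where e10: "pb (rleg (H \<odot> (G \<odot> F))) (lleg K) = Span p10 q10"
      by (cases "pb (rleg (H \<odot> (G \<odot> F))) (lleg K)")
  obtain p11 q11 where e11: "pb (rleg ((H \<odot> G) \<odot> F)) (lleg K) = Span p11 q11"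
      by (cases "pb (rleg ((H \<odot> G) \<odot> F)) (lleg K)")
  obtain p12 q12 where e12: "pb (rleg F) (lleg (K \<odot> (H \<odot> G))) = Span p12 q12"
      by (cases "pb (rleg F) (lleg (K \<odot> (H \<odot> G)))")
  note P = span_comp_one_cells[OF F G e1] span_comp_one_cells[OF G H e2] span_comp_one_cells[OF H K e3]
    span_comp_one_cells[OF F HG e4] span_comp_one_cells[OF GF H e5] span_comp_one_cells[OF G KH e6]
    span_comp_one_cells[OF HG K e7] span_comp_one_cells[OF F KH_G e8] span_comp_one_cells[OF GF KH e9]
    span_comp_one_cells[OF H_GF K e10] span_comp_one_cells[OF HG_F K e11] span_comp_one_cells[OF F K_HG e12]
  note [simp] = one_cell_typing[OF F] one_cell_typing[OF G] one_cell_typing[OF H] one_cell_typing[OF K]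
    one_cell_typing(1-5)[OF GF] one_cell_typing(1-5)[OF HG] one_cell_typing(1-5)[OF KH]
    one_cell_typing(1-5)[OF HG_F] one_cell_typing(1-5)[OF H_GF] one_cell_typing(1-5)[OF KH_G]
        one_cell_typing(1-5)[OF K_HG]
  have [simp]: "Dom M (lleg (G \<odot> F)) = Dom M p1" "Dom M (lleg (H \<odot> G)) = Dom M p2"
      "Dom M (lleg (K \<odot> H)) = Dom M p3"
    "Dom M (lleg ((H \<odot> G) \<odot> F)) = Dom M p4" "Dom M (lleg (H \<odot> (G \<odot> F))) = Dom M p5"
    "Dom M (lleg ((K \<odot> H) \<odot> G)) = Dom M p6" "Dom M (lleg (K \<odot> (H \<odot> G))) = Dom M p7"
    using P(4,8,12,16,20,24,28) by (simp_all add: apex_def)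
  note [simp] = P(4,8,12,16,20,24,28)
  note [simp] = pullback_typing(1-5)[OF P(1)] pullback_typing(1-5)[OF P(5)] pullback_typing(1-5)[OF P(9)]
    pullback_typing(1-5)[OF P(13)] pullback_typing(1-5)[OF P(17)] pullback_typing(1-5)[OF P(21)]
    pullback_typing(1-5)[OF P(25)] pullback_typing(1-5)[OF P(29)] pullback_typing(1-5)[OF P(33)]
    pullback_typing(1-5)[OF P(37)] pullback_typing(1-5)[OF P(41)] pullback_typing(1-5)[OF P(45)]
  note \<alpha>1 = assoc_map_properties[OF GF H K e5 e3 e9 e10]
    and \<alpha>2 = assoc_map_properties[OF F G KH e1 e6 e8 e9]
    and \<alpha>3 = assoc_map_properties[OF F HG K e4 e7 e12 e11]
    and \<alpha>4 = assoc_map_properties[OF F G H e1 e2 e4 e5]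
    and \<alpha>5 = assoc_map_properties[OF G H K e2 e3 e6 e7]
  let ?\<alpha>1 = "assoc_map M pb (G \<odot> F) H K" and ?\<alpha>2 = "assoc_map M pb F G (K \<odot> H)"
      and ?\<alpha>3 = "assoc_map M pb F (H \<odot> G) K"
  note [simp] = \<alpha>1(1-3) \<alpha>2(1-3) \<alpha>3(1-3) \<alpha>4(1-3) \<alpha>5(1-3)
  obtain b1 where [simp]: "b1 \<in> Ar M" "Dom M b1 = Dom M p11" "Cod M b1 = Dom M p10"
    and b1: "p10 \<cdot> b1 = assoc_map M pb F G H \<cdot> p11" "q10 \<cdot> b1 = Id M (apex M K) \<cdot> q11"
    and s1: "b1 \<in> span_mor M (K \<odot> ((H \<odot> G) \<odot> F)) (K \<odot> (H \<odot> (G \<odot> F)))"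
    and c1: "strict K K (Id M (apex M K)) \<star> assoc_cell F G H
        = strict (K \<odot> ((H \<odot> G) \<odot> F)) (K \<odot> (H \<odot> (G \<odot> F))) b1"
    by (rule hcomp_strict[OF HG_F H_GF K K \<alpha>4(7) Id_span_mor[OF K] e11 e10])
  obtain b2 where [simp]: "b2 \<in> Ar M" "Dom M b2 = Dom M p8" "Cod M b2 = Dom M p12"
    and b2: "p12 \<cdot> b2 = Id M (apex M F) \<cdot> p8" "q12 \<cdot> b2 = assoc_map M pb G H K \<cdot> q8"
    and s2: "b2 \<in> span_mor M (((K \<odot> H) \<odot> G) \<odot> F) ((K \<odot> (H \<odot> G)) \<odot> F)"
    and c2: "assoc_cell G H K \<star> strict F F (Id M (apex M F))
        = strict (((K \<odot> H) \<odot> G) \<odot> F) ((K \<odot> (H \<odot> G)) \<odot> F) b2"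
    by (rule hcomp_strict[OF F F KH_G K_HG Id_span_mor[OF F] \<alpha>5(7) e8 e12])
  have b: "q10 \<cdot> b1 = q11" "p12 \<cdot> b2 = p8" using b1(2) b2(1) by simp_all
  \<comment> \<open>The components in \<open>f\<close>, \<open>g\<close> and \<open>h\<close>, followed by the component in \<open>k\<close>.\<close>
  have p10: "p10 \<cdot> (?\<alpha>1 \<cdot> ?\<alpha>2) = p10 \<cdot> ((b1 \<cdot> ?\<alpha>3) \<cdot> b2)"
    by (rule iterated_pullback_jointly_monic[OF F G H e1 e5])
      (simp_all add: reassoc3[OF \<alpha>1(4)] reassoc3[OF \<alpha>1(5)] \<alpha>2 reassoc[OF \<alpha>2(6)] reassoc[OF b1(1)]
        reassoc3[OF \<alpha>4(4)] reassoc3[OF \<alpha>4(5)] reassoc[OF \<alpha>4(6)] reassoc3[OF \<alpha>3(4)] reassoc3[OF \<alpha>3(5)] b b2(2)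
        \<alpha>5 reassoc3[OF \<alpha>5(4)] reassoc3[OF \<alpha>5(5)])
  have q10: "q10 \<cdot> (?\<alpha>1 \<cdot> ?\<alpha>2) = q10 \<cdot> ((b1 \<cdot> ?\<alpha>3) \<cdot> b2)"
    by (simp add: reassoc[OF \<alpha>1(6)] \<alpha>2 reassoc[OF b(1)] reassoc[OF \<alpha>3(6)] b2(2) reassoc[OF \<alpha>5(6)])
  have "?\<alpha>1 \<cdot> ?\<alpha>2 = (b1 \<cdot> ?\<alpha>3) \<cdot> b2"
    by (rule pullback_jointly_monic[OF P(37)]) (use p10 q10 in simp_all)
  thus ?thesis
    unfolding c1 c2
    by (simp only: strict_vcomp_strict[OF KHG_F KH_GF K_H_GF \<alpha>2(7) \<alpha>1(7)]
        strict_vcomp_strict[OF K_HG_F K_HGF K_H_GF \<alpha>3(7) s1]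
        strict_vcomp_strict[OF KHG_F K_HG_F K_H_GF s2 span_mor_comp[OF K_HG_F K_HGF K_H_GF \<alpha>3(7) s1]])
qed

section \<open>The unitors\<close>

lemma id_span_one_cell: "x \<in> Ob M \<Longrightarrow> id_span M x \<in> one_cells M x x"
  using classes_Id by (simp add: id_span_def mem_one_cells)

lemma id_span_sel [simp]: "lleg (id_span M x) = Id M x" "rleg (id_span M x) = Id M x"
  by (simp_all add: id_span_def)

text \<open>Pulling back along an identity does nothing: the section of the projection \<open>p\<close> is induced by
  the identity of \<open>f\<close> and the right leg \<open>f \<rightarrow> y\<close>.\<close>

lemma lunit_map_iso:
  assumes F: "F \<in> one_cells M x y" and pq: "pb (rleg F) (Id M y) = Span p q"
  shows "lunit_map M pb F = p" "p \<in> span_mor M (id_span M y \<odot> F) F" "\<exists>n. inverses M p n"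
proof -
  have y [simp]: "y \<in> Ob M" using one_cell_boundary[OF F] by simp
  note [simp] = one_cell_typing[OF F]
  note P = span_comp_one_cells[OF F id_span_one_cell[OF y], simplified, OF pq]
  note [simp] = pullback_typing(1-5)[OF P(1), simplified] P(4)
  have P6: "rleg F \<cdot> p = q" using pullback_typing(6)[OF P(1)] by simp
  show "lunit_map M pb F = p" by (simp add: lunit_map_def pq)
  show "p \<in> span_mor M (id_span M y \<odot> F) F" by (simp add: mem_span_mor) (simp add: P(2) P6)
  obtain n where [simp]: "n \<in> Ar M" "Dom M n = Dom M (lleg F)" "Cod M n = Dom M p"
      and n: "p \<cdot> n = Id M (Dom M (lleg F))" "q \<cdot> n = rleg F"
    by (rule pullback_induced[OF P(1), of "Id M (Dom M (lleg F))" "rleg F"]) simp_all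
  have "n \<cdot> p = Id M (Dom M p)"
    by (rule pullback_jointly_monic[OF P(1)]) (simp_all add: reassoc[OF n(1)] reassoc[OF n(2)] P6)
  hence "inverses M p n" by (simp add: inverses_iff n)
  thus "\<exists>n. inverses M p n" by blast
qed

lemma runit_map_iso:
  assumes F: "F \<in> one_cells M x y" and pq: "pb (Id M x) (lleg F) = Span p q"
  shows "runit_map M pb F = q" "q \<in> span_mor M (F \<odot> id_span M x) F" "\<exists>n. inverses M q n"
proof -
  have x [simp]: "x \<in> Ob M" using one_cell_boundary[OF F] by simp
  note [simp] = one_cell_typing[OF F]
  note P = span_comp_one_cells[OF id_span_one_cell[OF x] F, simplified, OF pq]
  note [simp] = pullback_typing(1-5)[OF P(1), simplified] P(4)
  have P6: "lleg F \<cdot> q = p" using pullback_typing(6)[OF P(1)] by simp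
  show "runit_map M pb F = q" by (simp add: runit_map_def pq)
  show "q \<in> span_mor M (F \<odot> id_span M x) F" by (simp add: mem_span_mor) (simp add: P(2) P6)
  obtain n where [simp]: "n \<in> Ar M" "Dom M n = Dom M (lleg F)" "Cod M n = Dom M p"
      and n: "p \<cdot> n = lleg F" "q \<cdot> n = Id M (Dom M (lleg F))"
    by (rule pullback_induced[OF P(1), of "lleg F" "Id M (Dom M (lleg F))"]) simp_all
  have "n \<cdot> q = Id M (Dom M p)"
    by (rule pullback_jointly_monic[OF P(1)]) (simp_all add: reassoc[OF n(1)] reassoc[OF n(2)] P6)
  hence "inverses M q n" by (simp add: inverses_iff n)
  thus "\<exists>n. inverses M q n" by blast
qed

abbreviation "lunit_cell y F \<equiv> strict (id_span M y \<odot> F) F (lunit_map M pb F)"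
abbreviation "runit_cell x F \<equiv> strict (F \<odot> id_span M x) F (runit_map M pb F)"
abbreviation "id_cell F \<equiv> strict F F (Id M (apex M F))"

text \<open>The representative of \<open>1 * \<alpha>\<close> comes with a left leg \<open>m\<close> into \<open>f \<times> y\<close> and a projection \<open>u\<close> to
  \<open>\<alpha>\<close>; these form a cone for the composite of the unitor with \<open>\<alpha>\<close>, and the two composites then have
  equal legs.\<close>

lemma lunit_natural:
  assumes A: "A \<in> hom (hcat x y) F F'"
  shows "A \<bullet> lunit_cell y F = lunit_cell y F' \<bullet> (id_cell (id_span M y) \<star> A)"
proof -
  obtain a where a: "a \<in> two_reps M F F'" "A = two_class M F F' a"
    and F: "F \<in> one_cells M x y" "F' \<in> one_cells M x y"
    using A unfolding mem_hom_hcat by blast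
  have y [simp]: "y \<in> Ob M" using one_cell_boundary[OF F(1)] by simp
  note I = id_span_one_cell[OF y]
  note IF = span_comp_in_one_cells[OF F(1) I] span_comp_in_one_cells[OF F(2) I]
  obtain p q where pq: "pb (rleg F) (Id M y) = Span p q" by (cases "pb (rleg F) (Id M y)")
  obtain p' q' where pq': "pb (rleg F') (Id M y) = Span p' q'" by (cases "pb (rleg F') (Id M y)")
  note L = lunit_map_iso[OF F(1) pq] and L' = lunit_map_iso[OF F(2) pq']
  note P = span_comp_one_cells[OF F(1) I, simplified, OF pq] span_comp_one_cells[OF F(2) I, simplified, OF pq']
  note [simp] = one_cell_typing[OF F(1)] one_cell_typing[OF F(2)] one_cell_typing(6)[OF I]
      two_rep_typing[OF a(1)]
    pullback_typing(1-5)[OF P(1)] pullback_typing(1-5)[OF P(5)] P(4) P(8)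
  note idrep = strict_rep[OF I I Id_span_mor[OF I]]
  obtain u v m n where
      rep: "hcomp_rep M pb (id_span M y) (id_span M y) F F' (Span (Id M (apex M (id_span M y))) (Id M (apex M (id_span M y)))) a = Span m n"
    and two_rep: "Span m n \<in> two_reps M (id_span M y \<odot> F) (id_span M y \<odot> F')"
    and [simp]: "u \<in> Ar M" "Cod M u = Dom M (lleg a)" 
      "m \<in> Ar M" "Dom M m = Dom M u" "Cod M m = Dom M p" "n \<in> Ar M" "Dom M n = Dom M u" "Cod M n = Dom M p'"
    and mA: "m \<in> AFib" and m: "p \<cdot> m = lleg a \<cdot> u" and n: "p' \<cdot> n = rleg a \<cdot> u"
    by (rule hcomp_rep_cases[OF F I I a(1) idrep, simplified id_span_sel, OF pq pq'])
  note repl = strict_rep[OF IF(1) F(1) L(2)]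
  have "A \<bullet> lunit_cell y F
      = two_class M (id_span M y \<odot> F) F' (span_comp M pb a (Span (Id M (apex M (id_span M y \<odot> F))) p))"
    unfolding a(2) L(1) strict_def by (rule vcomp_two_class[OF IF(1) F repl a(1)])
  also have "\<dots> = two_class M (id_span M y \<odot> F) F' (Span m (p' \<cdot> n))"
    using two_class_vcomp_cone[OF IF(1) F repl a(1), of m u] mA by (simp add: m n)
  also have "\<dots> = lunit_cell y F' \<bullet> (id_cell (id_span M y) \<star> A)"
    unfolding a(2) L'(1) strict_def[of "id_span M y" "id_span M y"] hcomp_two_class[OF F I I a(1) idrep] rep
    using strict_vcomp[OF IF F(2) two_rep L'(2)] by simp
  finally show ?thesis .
qed

lemma runit_natural:
  assumes A: "A \<in> hom (hcat x y) F F'"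
  shows "A \<bullet> runit_cell x F = runit_cell x F' \<bullet> (A \<star> id_cell (id_span M x))"
proof -
  obtain a where a: "a \<in> two_reps M F F'" "A = two_class M F F' a"
    and F: "F \<in> one_cells M x y" "F' \<in> one_cells M x y"
    using A unfolding mem_hom_hcat by blast
  have x [simp]: "x \<in> Ob M" using one_cell_boundary[OF F(1)] by simp
  note I = id_span_one_cell[OF x]
  note FI = span_comp_in_one_cells[OF I F(1)] span_comp_in_one_cells[OF I F(2)]
  obtain p q where pq: "pb (Id M x) (lleg F) = Span p q" by (cases "pb (Id M x) (lleg F)")
  obtain p' q' where pq': "pb (Id M x) (lleg F') = Span p' q'" by (cases "pb (Id M x) (lleg F')")
  note R = runit_map_iso[OF F(1) pq] and R' = runit_map_iso[OF F(2) pq']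
  note P = span_comp_one_cells[OF I F(1), simplified, OF pq] span_comp_one_cells[OF I F(2), simplified, OF pq']
  note [simp] = one_cell_typing[OF F(1)] one_cell_typing[OF F(2)] one_cell_typing(6)[OF I]
      two_rep_typing[OF a(1)]
    pullback_typing(1-5)[OF P(1)] pullback_typing(1-5)[OF P(5)] P(4) P(8)
  note idrep = strict_rep[OF I I Id_span_mor[OF I]]
  obtain u v m n where
      rep: "hcomp_rep M pb F F' (id_span M x) (id_span M x) a (Span (Id M (apex M (id_span M x))) (Id M (apex M (id_span M x)))) = Span m n"
    and two_rep: "Span m n \<in> two_reps M (F \<odot> id_span M x) (F' \<odot> id_span M x)"
    and [simp]: "v \<in> Ar M" "Dom M v = Dom M u" "Cod M v = Dom M (lleg a)"
      "m \<in> Ar M" "Dom M m = Dom M u" "Cod M m = Dom M p" "n \<in> Ar M" "Dom M n = Dom M u" "Cod M n = Dom M p'"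
    and mA: "m \<in> AFib" and m: "q \<cdot> m = lleg a \<cdot> v" and n: "q' \<cdot> n = rleg a \<cdot> v"
    by (rule hcomp_rep_cases[OF I I F idrep a(1), simplified id_span_sel, OF pq pq'])
  note repl = strict_rep[OF FI(1) F(1) R(2)]
  have "A \<bullet> runit_cell x F
      = two_class M (F \<odot> id_span M x) F' (span_comp M pb a (Span (Id M (apex M (F \<odot> id_span M x))) q))"
    unfolding a(2) R(1) strict_def by (rule vcomp_two_class[OF FI(1) F repl a(1)])
  also have "\<dots> = two_class M (F \<odot> id_span M x) F' (Span m (q' \<cdot> n))"
    using two_class_vcomp_cone[OF FI(1) F repl a(1), of m v] mA by (simp add: m n)
  also have "\<dots> = runit_cell x F' \<bullet> (A \<star> id_cell (id_span M x))"
    unfolding a(2) R'(1) strict_def[of "id_span M x" "id_span M x"] hcomp_two_class[OF I I F idrep a(1)] rep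
    using strict_vcomp[OF FI F(2) two_rep R'(2)] by simp
  finally show ?thesis .
qed

text \<open>Both sides are given by maps into \<open>f \<times> g\<close>, which are compared on the two projections.\<close>

lemma triangle_cells:
  assumes F: "F \<in> one_cells M x y" and G: "G \<in> one_cells M y z"
  shows "(id_cell G \<star> lunit_cell y F) \<bullet> assoc_cell F (id_span M y) G = runit_cell y G \<star> id_cell F"
proof -
  have y [simp]: "y \<in> Ob M" using one_cell_boundary[OF F] by simp
  note I = id_span_one_cell[OF y]
  note IF = span_comp_in_one_cells[OF F I] and GI = span_comp_in_one_cells[OF I G]
      and GF = span_comp_in_one_cells[OF F G]
  note GI_F = span_comp_in_one_cells[OF F GI] and G_IF = span_comp_in_one_cells[OF IF G]
  obtain p1 q1 where e1: "pb (rleg F) (lleg G) = Span p1 q1" by (cases "pb (rleg F) (lleg G)")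
  obtain p2 q2 where e2: "pb (rleg F) (lleg (id_span M y)) = Span p2 q2"
      by (cases "pb (rleg F) (lleg (id_span M y))")
  obtain p3 q3 where e3: "pb (rleg (id_span M y)) (lleg G) = Span p3 q3"
      by (cases "pb (rleg (id_span M y)) (lleg G)")
  obtain p4 q4 where e4: "pb (rleg F) (lleg (G \<odot> id_span M y)) = Span p4 q4"
      by (cases "pb (rleg F) (lleg (G \<odot> id_span M y))")
  obtain p5 q5 where e5: "pb (rleg (id_span M y \<odot> F)) (lleg G) = Span p5 q5"
      by (cases "pb (rleg (id_span M y \<odot> F)) (lleg G)")
  note P = span_comp_one_cells[OF F G e1] span_comp_one_cells[OF F I e2] span_comp_one_cells[OF I G e3]
    span_comp_one_cells[OF F GI e4] span_comp_one_cells[OF IF G e5]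
  note [simp] = one_cell_typing[OF F] one_cell_typing[OF G]
    one_cell_typing(1-5)[OF IF] one_cell_typing(1-5)[OF GI] P(4,8,12,16,20)
  have [simp]: "Dom M (lleg (id_span M y \<odot> F)) = Dom M p2" "Dom M (lleg (G \<odot> id_span M y)) = Dom M p3"
    using P(8,12) by (simp_all add: apex_def)
  note [simp] = pullback_typing(1-5)[OF P(1)] pullback_typing(1-5)[OF P(5), simplified]
      pullback_typing(1-5)[OF P(9), simplified]
    pullback_typing(1-5)[OF P(13)] pullback_typing(1-5)[OF P(17)]
  note \<alpha> = assoc_map_properties[OF F I G e2 e3 e4 e5]
  note [simp] = \<alpha>(1-3)
  note L = lunit_map_iso[OF F e2[simplified]] and R = runit_map_iso[OF G e3[simplified]]
  obtain b where [simp]: "b \<in> Ar M" "Dom M b = Dom M p5" "Cod M b = Dom M p1"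
    and b: "p1 \<cdot> b = p2 \<cdot> p5" "q1 \<cdot> b = Id M (apex M G) \<cdot> q5"
    and s: "b \<in> span_mor M (G \<odot> (id_span M y \<odot> F)) (G \<odot> F)"
    and c: "id_cell G \<star> strict (id_span M y \<odot> F) F p2 = strict (G \<odot> (id_span M y \<odot> F)) (G \<odot> F) b"
    by (rule hcomp_strict[OF IF F G G L(2) Id_span_mor[OF G] e5 e1])
  obtain d where [simp]: "d \<in> Ar M" "Dom M d = Dom M p4" "Cod M d = Dom M p1"
    and d: "p1 \<cdot> d = Id M (apex M F) \<cdot> p4" "q1 \<cdot> d = q3 \<cdot> q4"
    and t: "d \<in> span_mor M ((G \<odot> id_span M y) \<odot> F) (G \<odot> F)"
    and c': "strict (G \<odot> id_span M y) G q3 \<star> id_cell F = strict ((G \<odot> id_span M y) \<odot> F) (G \<odot> F) d"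
    by (rule hcomp_strict[OF F F GI G Id_span_mor[OF F] R(2) e4 e1])
  have b2: "q1 \<cdot> b = q5" using b(2) by simp
  have "b \<cdot> assoc_map M pb F (id_span M y) G = d"
    by (rule pullback_jointly_monic[OF P(1)]) (simp_all add: d reassoc[OF b(1)] reassoc[OF b2] \<alpha>(4-6))
  thus ?thesis
    unfolding L(1) R(1) c c' using strict_vcomp_strict[OF GI_F G_IF GF \<alpha>(7) s] by simp
qed

section \<open>The bicategory axioms\<close>

lemma id_cell_in_hom: "F \<in> one_cells M x y \<Longrightarrow> id_cell F \<in> hom (hcat x y) F F"
  by (simp add: strict_in_hom Id_span_mor)

lemma span2_simps [simp]:
  "Ob0 (span2 M pb) = Ob M" "HomCat (span2 M pb) = hcat" "Id1 (span2 M pb) = id_span M"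
  "fob (HComp (span2 M pb) x y z) (G, F) = G \<odot> F" "far (HComp (span2 M pb) x y z) (B, A) = B \<star> A"
  "Assoc (span2 M pb) w x y z (H, G, F) = assoc_cell F G H"
  "LUnit (span2 M pb) x y F = lunit_cell y F" "RUnit (span2 M pb) x y F = runit_cell x F"
  by (simp_all add: span2_def strict_def Let_def)

lemma is_iso_strict:
  assumes F: "F \<in> one_cells M x y" "F' \<in> one_cells M x y"
    and m: "m \<in> span_mor M F F'" and inv: "inverses M m n"
  shows "is_iso (hcat x y) (strict F F' m)"
proof -
  interpret H: category "hcat x y" by (rule category_hcat)
  note n = strict_inverse(1)[OF F m inv]
  note [simp] = one_cell_typing[OF F(1)] one_cell_typing[OF F(2)]
  have *: "strict F F' m \<in> hom (hcat x y) F F'" "strict F' F n \<in> hom (hcat x y) F' F"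
    using F m n by (simp_all add: strict_in_hom)
  have "n \<cdot> m = Id M (apex M F)" "m \<cdot> n = Id M (apex M F')"
    using inv m by (auto simp: inverses_iff mem_span_mor)
  hence "inverses (hcat x y) (strict F F' m) (strict F' F n)"
    using * F m n by (auto simp: H.inverses_iff H.hom_iff strict_vcomp_strict)
  thus ?thesis unfolding is_iso_def by blast
qed

lemma hcomp_functor:
  "cat_functor (prod_cat (hcat y z) (hcat x y)) (hcat x z) (HComp (span2 M pb) x y z)"
proof (rule cat_functor.intro[OF category_prod_cat[OF category_hcat category_hcat] category_hcat], unfold_locales)
  show "fob (HComp (span2 M pb) x y z) p \<in> Ob (hcat x z)" if "p \<in> Ob (prod_cat (hcat y z) (hcat x y))" for p
    using that by (auto simp: span_comp_in_one_cells)
  show "far (HComp (span2 M pb) x y z) f \<in> hom (hcat x z) (fob (HComp (span2 M pb) x y z) s) (fob (HComp (span2 M pb) x y z) t)"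
    if "f \<in> hom (prod_cat (hcat y z) (hcat x y)) s t" for f s t
    using that by (cases f; cases s; cases t) (auto simp: mem_hom_prod_cat intro: hcomp_in_hom)
  show "far (HComp (span2 M pb) x y z) (cat.Id (prod_cat (hcat y z) (hcat x y)) p)
      = cat.Id (hcat x z) (fob (HComp (span2 M pb) x y z) p)"
    if "p \<in> Ob (prod_cat (hcat y z) (hcat x y))" for p
    using that by (cases p) (auto intro: hcomp_Id)
  show "far (HComp (span2 M pb) x y z) (Comp (prod_cat (hcat y z) (hcat x y)) g f)
      = Comp (hcat x z) (far (HComp (span2 M pb) x y z) g) (far (HComp (span2 M pb) x y z) f)"
    if "f \<in> hom (prod_cat (hcat y z) (hcat x y)) s t" "g \<in> hom (prod_cat (hcat y z) (hcat x y)) t u" for f g s t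
        u
    using that by (cases f; cases g; cases s; cases t; cases u) (auto simp: mem_hom_prod_cat intro: interchange)
qed

lemma assoc_nat_iso:
  "nat_iso (prod_cat (hcat y z) (prod_cat (hcat x y) (hcat w x))) (hcat w z)
    \<lparr>fob = (\<lambda>(h, g, f). (h \<odot> g) \<odot> f), far = (\<lambda>(h, g, f). h \<star> g \<star> f)\<rparr>
    \<lparr>fob = (\<lambda>(h, g, f). h \<odot> (g \<odot> f)), far = (\<lambda>(h, g, f). h \<star> (g \<star> f))\<rparr>
    (Assoc (span2 M pb) w x y z)" (is "nat_iso ?A ?B ?F ?G ?t")
proof -
  note cats = category_prod_cat[OF category_hcat category_prod_cat[OF category_hcat category_hcat]]
      category_hcat
  have F: "cat_functor ?A ?B ?F"
  proof (rule cat_functor.intro[OF cats], unfold_locales)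
    fix p assume "p \<in> Ob ?A"
    then obtain h g f where p: "p = (h, g, f)" and f: "f \<in> one_cells M w x" and g: "g \<in> one_cells M x y"
        and h: "h \<in> one_cells M y z"
      by auto
    note gf = span_comp_in_one_cells[OF f g] and hg = span_comp_in_one_cells[OF g h]
    show "fob ?F p \<in> Ob ?B" using span_comp_in_one_cells[OF f hg] by (simp add: p)
    show "far ?F (cat.Id ?A p) = cat.Id ?B (fob ?F p)" using hcomp_Id[OF f hg] hcomp_Id[OF g h] by (simp add: p)
  next
    show "far ?F f \<in> hom ?B (fob ?F s) (fob ?F t)" if "f \<in> hom ?A s t" for f s t
      using that by (cases f; cases s; cases t) (auto simp: mem_hom_prod_cat intro!: hcomp_in_hom)
  next
    fix f g s t u assume "f \<in> hom ?A s t" "g \<in> hom ?A t u"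
    moreover obtain a b c a' b' c' where fg: "f = (c, b, a)" "g = (c', b', a')" by (cases f; cases g) auto
    ultimately have c: "c \<in> hom (hcat y z) (fst s) (fst t)" "c' \<in> hom (hcat y z) (fst t) (fst u)"
      and b: "b \<in> hom (hcat x y) (fst (snd s)) (fst (snd t))" "b' \<in> hom (hcat x y) (fst (snd t)) (fst (snd u))"
      and a: "a \<in> hom (hcat w x) (snd (snd s)) (snd (snd t))" "a' \<in> hom (hcat w x) (snd (snd t)) (snd (snd u))"
      by (auto simp: mem_hom_prod_cat)
    show "far ?F (Comp ?A g f) = Comp ?B (far ?F g) (far ?F f)"
      using interchange[OF a hcomp_in_hom[OF b(1) c(1)] hcomp_in_hom[OF b(2) c(2)]] interchange[OF b c]
          by (simp add: fg)
  qed
  have G: "cat_functor ?A ?B ?G"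
  proof (rule cat_functor.intro[OF cats], unfold_locales)
    fix p assume "p \<in> Ob ?A"
    then obtain h g f where p: "p = (h, g, f)" and f: "f \<in> one_cells M w x" and g: "g \<in> one_cells M x y"
        and h: "h \<in> one_cells M y z"
      by auto
    note gf = span_comp_in_one_cells[OF f g] and hg = span_comp_in_one_cells[OF g h]
    show "fob ?G p \<in> Ob ?B" using span_comp_in_one_cells[OF gf h] by (simp add: p)
    show "far ?G (cat.Id ?A p) = cat.Id ?B (fob ?G p)" using hcomp_Id[OF gf h] hcomp_Id[OF f g] by (simp add: p)
  next
    show "far ?G f \<in> hom ?B (fob ?G s) (fob ?G t)" if "f \<in> hom ?A s t" for f s t
      using that by (cases f; cases s; cases t) (auto simp: mem_hom_prod_cat intro!: hcomp_in_hom)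
  next
    fix f g s t u assume "f \<in> hom ?A s t" "g \<in> hom ?A t u"
    moreover obtain a b c a' b' c' where fg: "f = (c, b, a)" "g = (c', b', a')" by (cases f; cases g) auto
    ultimately have c: "c \<in> hom (hcat y z) (fst s) (fst t)" "c' \<in> hom (hcat y z) (fst t) (fst u)"
      and b: "b \<in> hom (hcat x y) (fst (snd s)) (fst (snd t))" "b' \<in> hom (hcat x y) (fst (snd t)) (fst (snd u))"
      and a: "a \<in> hom (hcat w x) (snd (snd s)) (snd (snd t))" "a' \<in> hom (hcat w x) (snd (snd t)) (snd (snd u))"
      by (auto simp: mem_hom_prod_cat)
    show "far ?G (Comp ?A g f) = Comp ?B (far ?G g) (far ?G f)"
      using interchange[OF hcomp_in_hom[OF a(1) b(1)] hcomp_in_hom[OF a(2) b(2)] c] interchange[OF a b]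
          by (simp add: fg)
  qed
  show ?thesis
  proof (rule nat_iso.intro[OF nat_trans.intro[OF F G]], unfold_locales)
    fix p assume "p \<in> Ob ?A"
    then obtain h g f where p: "p = (h, g, f)" and f: "f \<in> one_cells M w x" and g: "g \<in> one_cells M x y"
        and h: "h \<in> one_cells M y z"
      by auto
    note o = span_comp_in_one_cells[OF f span_comp_in_one_cells[OF g h]]
        span_comp_in_one_cells[OF span_comp_in_one_cells[OF f g] h]
    show "?t p \<in> hom ?B (fob ?F p) (fob ?G p)"
      using strict_in_hom[OF o assoc_map_iso(1)[OF f g h]] by (simp add: p)
    show "is_iso ?B (?t p)"
      using is_iso_strict[OF o assoc_map_iso(1)[OF f g h]] assoc_map_iso(2)[OF f g h] by (auto simp: p)
  next
    show "Comp ?B (far ?G f) (?t s) = Comp ?B (?t t) (far ?F f)" if "f \<in> hom ?A s t" for f s t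
      using that by (cases f; cases s; cases t) (auto simp: mem_hom_prod_cat intro: assoc_natural)
  qed
qed

lemma lunit_nat_iso:
  assumes y: "y \<in> Ob M"
  shows "nat_iso (hcat x y) (hcat x y)
    \<lparr>fob = (\<lambda>f. id_span M y \<odot> f), far = (\<lambda>\<alpha>. id_cell (id_span M y) \<star> \<alpha>)\<rparr> id_ftor (LUnit (span2 M pb) x y)"
    (is "nat_iso ?A ?A ?F ?G ?t")
proof -
  note I = id_span_one_cell[OF y]
  have F: "cat_functor ?A ?A ?F"
  proof (rule cat_functor.intro[OF category_hcat category_hcat], unfold_locales)
    show "far ?F (Comp ?A g f) = Comp ?A (far ?F g) (far ?F f)" if "f \<in> hom ?A s t" "g \<in> hom ?A t u" for f g s t
        u
      using interchange[OF that id_cell_in_hom[OF I] id_cell_in_hom[OF I]] vcomp_Id(1)[OF id_cell_in_hom[OF I]]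
          by simp
  qed (auto intro!: hcomp_Id[OF _ I] I hcomp_in_hom[OF _ id_cell_in_hom[OF I]] span_comp_in_one_cells[OF _ I])
  have G: "cat_functor ?A ?A ?G"
    by (rule cat_functor.intro[OF category_hcat category_hcat], unfold_locales) (auto simp: id_ftor_def)
  show ?thesis
  proof (rule nat_iso.intro[OF nat_trans.intro[OF F G]], unfold_locales)
    fix f assume "f \<in> Ob ?A"
    hence f: "f \<in> one_cells M x y" by simp
    obtain p q where pq: "pb (rleg f) (cat.Id M y) = Span p q" by (cases "pb (rleg f) (cat.Id M y)")
    note L = lunit_map_iso[OF f pq]
    note If = span_comp_in_one_cells[OF f I]
    show "?t f \<in> hom ?A (fob ?F f) (fob ?G f)"
      using strict_in_hom[OF If f L(2)] by (simp add: L(1) id_ftor_def)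
    show "is_iso ?A (?t f)"
      using is_iso_strict[OF If f L(2)] L(3) by (auto simp: L(1))
  next
    show "Comp ?A (far ?G f) (?t s) = Comp ?A (?t t) (far ?F f)" if "f \<in> hom ?A s t" for f s t
      using lunit_natural[OF that] by (simp add: id_ftor_def)
  qed
qed

lemma runit_nat_iso:
  assumes x: "x \<in> Ob M"
  shows "nat_iso (hcat x y) (hcat x y)
    \<lparr>fob = (\<lambda>f. f \<odot> id_span M x), far = (\<lambda>\<alpha>. \<alpha> \<star> id_cell (id_span M x))\<rparr> id_ftor (RUnit (span2 M pb) x y)"
    (is "nat_iso ?A ?A ?F ?G ?t")
proof -
  note I = id_span_one_cell[OF x]
  have F: "cat_functor ?A ?A ?F"
  proof (rule cat_functor.intro[OF category_hcat category_hcat], unfold_locales)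
    show "far ?F (Comp ?A g f) = Comp ?A (far ?F g) (far ?F f)" if "f \<in> hom ?A s t" "g \<in> hom ?A t u" for f g s t
        u
      using interchange[OF id_cell_in_hom[OF I] id_cell_in_hom[OF I] that] vcomp_Id(1)[OF id_cell_in_hom[OF I]]
          by simp
  qed (auto intro!: hcomp_Id[OF I] I hcomp_in_hom[OF id_cell_in_hom[OF I]] span_comp_in_one_cells[OF I])
  have G: "cat_functor ?A ?A ?G"
    by (rule cat_functor.intro[OF category_hcat category_hcat], unfold_locales) (auto simp: id_ftor_def)
  show ?thesis
  proof (rule nat_iso.intro[OF nat_trans.intro[OF F G]], unfold_locales)
    fix f assume "f \<in> Ob ?A"
    hence f: "f \<in> one_cells M x y" by simp
    obtain p q where pq: "pb (cat.Id M x) (lleg f) = Span p q" by (cases "pb (cat.Id M x) (lleg f)")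
    note R = runit_map_iso[OF f pq]
    note fI = span_comp_in_one_cells[OF I f]
    show "?t f \<in> hom ?A (fob ?F f) (fob ?G f)"
      using strict_in_hom[OF fI f R(2)] by (simp add: R(1) id_ftor_def)
    show "is_iso ?A (?t f)"
      using is_iso_strict[OF fI f R(2)] R(3) by (auto simp: R(1))
  next
    show "Comp ?A (far ?G f) (?t s) = Comp ?A (?t t) (far ?F f)" if "f \<in> hom ?A s t" for f s t
      using runit_natural[OF that] by (simp add: id_ftor_def)
  qed
qed

lemma bicategory_span2: "bicategory (span2 M pb)"
proof (rule bicategory.intro, goal_cases)
  case (7 v w x y z f g h k)
  thus ?case using pentagon_cells[of f v w g x h y k z] by simp
next
  case (8 x y z f g)
  thus ?case using triangle_cells[of f x y g z] by simp
qed (simp_all add: category_hcat id_span_one_cell hcomp_functor assoc_nat_iso lunit_nat_iso runit_nat_iso)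

end

theorem theorem3p5:
  fixes M :: "('o, 'm, 'x) model_scheme" and U :: "'i set" and pb :: "'m \<Rightarrow> 'm \<Rightarrow> 'm span"
  assumes "model_category M U" and "pullback_choice M pb"
  shows "bicategory (span2 M pb)
    \<and> (\<forall>x\<in>Ob M. \<forall>y\<in>Ob M. \<forall>F\<in>one_cells M x y. \<forall>F'\<in>one_cells M x y. \<forall>F''\<in>one_cells M x y.
        \<forall>a\<in>two_reps M F F'. \<forall>a'\<in>two_reps M F' F''.
          span_comp M pb a' a \<in> two_reps M F F'' \<and>
          Comp (HomCat (span2 M pb) x y) (two_class M F' F'' a') (two_class M F F' a)
            = two_class M F F'' (span_comp M pb a' a))
    \<and> (\<forall>x\<in>Ob M. \<forall>y\<in>Ob M. \<forall>z\<in>Ob M. \<forall>F\<in>one_cells M x y. \<forall>F'\<in>one_cells M x y.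
        \<forall>G\<in>one_cells M y z. \<forall>G'\<in>one_cells M y z. \<forall>a\<in>two_reps M F F'. \<forall>b\<in>two_reps M G G'.
          hcomp_rep M pb G G' F F' b a
            \<in> two_reps M (span_comp M pb G F) (span_comp M pb G' F') \<and>
          far (HComp (span2 M pb) x y z) (two_class M G G' b, two_class M F F' a)
            = two_class M (span_comp M pb G F) (span_comp M pb G' F')
                (hcomp_rep M pb G G' F F' b a))
    \<and> (\<forall>w\<in>Ob M. \<forall>x\<in>Ob M. \<forall>y\<in>Ob M. \<forall>z\<in>Ob M.
        \<forall>F\<in>one_cells M w x. \<forall>G\<in>one_cells M x y. \<forall>H\<in>one_cells M y z.
          is_iso M (assoc_map M pb F G H) \<and>
          Assoc (span2 M pb) w x y z (H, G, F)
            = (let S = span_comp M pb (span_comp M pb H G) F;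
                   T = span_comp M pb H (span_comp M pb G F)
               in two_class M S T
                    (Span (inv_of M (assoc_map M pb F G H)) (Id M (apex M T)))))
    \<and> (\<forall>x\<in>Ob M. \<forall>y\<in>Ob M. \<forall>F\<in>one_cells M x y.
          is_iso M (lunit_map M pb F) \<and>
          LUnit (span2 M pb) x y F
            = two_class M (span_comp M pb (id_span M y) F) F
                (Span (inv_of M (lunit_map M pb F)) (Id M (apex M F))) \<and>
          is_iso M (runit_map M pb F) \<and>
          RUnit (span2 M pb) x y F
            = two_class M (span_comp M pb F (id_span M x)) F
                (Span (inv_of M (runit_map M pb F)) (Id M (apex M F))))"
proof -
  interpret model_category M U by fact
  interpret model_category_with_pullbacks M U pb by unfold_locales fact
  \<comment> \<open>An isomorphism may be moved to the other leg; this gives the second description of each structure cell.\<close>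
  have canonical: "is_iso M m \<and> strict S T m = two_class M S T (Span (inv_of M m) (Id M (apex M T)))"
    if "S \<in> one_cells M x y" "T \<in> one_cells M x y" "m \<in> span_mor M S T" "\<exists>n. inverses M m n" for S T m x y
    using that strict_inverse(2)[OF that(1-3)] inv_of_eq by (auto simp: is_iso_def)
  show ?thesis
  proof (intro conjI ballI; (rule bicategory_span2)?)
    fix x y F F' F'' a a'
    assume F: "F \<in> one_cells M x y" "F' \<in> one_cells M x y" "F'' \<in> one_cells M x y"
      and a: "a \<in> two_reps M F F'" "a' \<in> two_reps M F' F''"
    show "span_comp M pb a' a \<in> two_reps M F F''"
      by (cases "pb (rleg a) (lleg a')") (simp add: span_comp_two_reps[OF F a])
    show "Comp (HomCat (span2 M pb) x y) (two_class M F' F'' a') (two_class M F F' a)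
      = two_class M F F'' (span_comp M pb a' a)"
      using vcomp_two_class[OF F a] by simp
  next
    fix x y z F F' G G' a b
    assume F: "F \<in> one_cells M x y" "F' \<in> one_cells M x y" and G: "G \<in> one_cells M y z" "G' \<in> one_cells M y z"
      and a: "a \<in> two_reps M F F'" and b: "b \<in> two_reps M G G'"
    obtain p q where pq: "pb (rleg F) (lleg G) = Span p q" by (cases "pb (rleg F) (lleg G)")
    obtain p' q' where pq': "pb (rleg F') (lleg G') = Span p' q'" by (cases "pb (rleg F') (lleg G')")
    show "hcomp_rep M pb G G' F F' b a \<in> two_reps M (G \<odot> F) (G' \<odot> F')"
      by (rule hcomp_rep_cases[OF F G a b pq pq']) simp
    show "far (HComp (span2 M pb) x y z) (two_class M G G' b, two_class M F F' a)
      = two_class M (G \<odot> F) (G' \<odot> F') (hcomp_rep M pb G G' F F' b a)"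
      using hcomp_two_class[OF F G a b] by simp
  next
    fix w x y z F G H
    assume F: "F \<in> one_cells M w x" and G: "G \<in> one_cells M x y" and H: "H \<in> one_cells M y z"
    note * = canonical[OF span_comp_in_one_cells[OF F span_comp_in_one_cells[OF G H]]
        span_comp_in_one_cells[OF span_comp_in_one_cells[OF F G] H] assoc_map_iso[OF F G H]]
    show "is_iso M (assoc_map M pb F G H)" using * by simp
    show "Assoc (span2 M pb) w x y z (H, G, F) = (let S = H \<odot> G \<odot> F; T = H \<odot> (G \<odot> F)
      in two_class M S T (Span (inv_of M (assoc_map M pb F G H)) (Id M (apex M T))))"
      using * by (simp add: Let_def)
  next
    fix x y F assume x: "x \<in> Ob M" and y: "y \<in> Ob M" and F: "F \<in> one_cells M x y"
    obtain p q where pq: "pb (rleg F) (Id M y) = Span p q" by (cases "pb (rleg F) (Id M y)")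
    note L = lunit_map_iso[OF F pq]
    note l = canonical[OF span_comp_in_one_cells[OF F id_span_one_cell[OF y]] F L(2,3)]
    show "is_iso M (lunit_map M pb F)" using l by (simp add: L(1))
    show "LUnit (span2 M pb) x y F
        = two_class M (id_span M y \<odot> F) F (Span (inv_of M (lunit_map M pb F)) (Id M (apex M F)))"
      using l by (simp add: L(1))
    obtain p' q' where pq': "pb (Id M x) (lleg F) = Span p' q'" by (cases "pb (Id M x) (lleg F)")
    note R = runit_map_iso[OF F pq']
    note r = canonical[OF span_comp_in_one_cells[OF id_span_one_cell[OF x] F] F R(2,3)]
    show "is_iso M (runit_map M pb F)" using r by (simp add: R(1))
    show "RUnit (span2 M pb) x y F
        = two_class M (F \<odot> id_span M x) F (Span (inv_of M (runit_map M pb F)) (Id M (apex M F)))"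
      using r by (simp add: R(1))
  qed
qed

end
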